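(* Let $G=([n],E)$ be a $2$-connected finite simple graph, and let $z_2$ be the coefficient of $t^2$ in \[ Z_G(t):=\sum_{e\in E}\bigl(\gamma_{P_G}(t)-\gamma_{P_{G\setminus e}}(t)\bigr). \] Then \[ z_2=2\bigl(f_1(P_G)-|E|(2n-5)-|E_3(G)|\bigr), \] where $f_1(P_G)$ is the number of edges of $P_G$ and $E_3(G)$ is the set of edges of $G$ lying in some $3$-cycle. In particular $z_2\ge 0$.
   Context: A graph is $2$-connected if it has at least $3$ vertices, is connected, and has no cut vertex. For a graph $G$ on $[n]$, $P_G:=\operatorname{conv}\{\pm(e_i-e_j):\{i,j\}\in E\}\subseteq\mathbb{R}^n$, a lattice polytope (lattice $\mathbb{Z}^n$) of dimension $n$ minus the number of connected components of $G$. For a $d$-dimensional lattice polytope $P$, the $h^*$-polynomial $h^*_P(t)$ is defined by $1+\sum_{m\ge1}|mP\cap\mathbb{Z}^n|t^m=h^*_P(t)/(1-t)^{d+1}$. For connected $G$, $h^*_{P_G}$ satisfies $h^*_{P_G}(t)=t^dh^*_{P_G}(1/t)$ with $d=\dim P_G$, and hence can be written uniquely as $\sum_{i=0}^{\lfloor d/2\rfloor}\gamma_it^i(1+t)^{d-2i}$; the $\gamma$-polynomial is $\gamma_{P_G}(t):=\sum_i\gamma_it^i$. For $G$ $2$-connected and $e\in E$, $G\setminus e$ is connected, so $P_{G\setminus e}$ has the same dimension $n-1$. *)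

theory Defs
  imports "HOL-Analysis.Analysis" "HOL-Computational_Algebra.Computational_Algebra"
begin

section \<open>Finite simple graphs\<close>

text \<open>A graph is a pair of a vertex set \<open>V\<close> and a set \<open>E\<close> of two-element subsets of \<open>V\<close>.\<close>

definition simple_graph :: "'a set \<Rightarrow> 'a set set \<Rightarrow> bool" where
  "simple_graph V E \<longleftrightarrow> finite V \<and> (\<forall>e\<in>E. e \<subseteq> V \<and> card e = 2)"

definition joined :: "'a set set \<Rightarrow> 'a \<Rightarrow> 'a \<Rightarrow> bool" where
  "joined E u v \<longleftrightarrow> (u, v) \<in> {(x, y). {x, y} \<in> E}\<^sup>*"

definition graph_connected :: "'a set \<Rightarrow> 'a set set \<Rightarrow> bool" where
  "graph_connected V E \<longleftrightarrow> V \<noteq> {} \<and> (\<forall>u\<in>V. \<forall>v\<in>V. joined E u v)"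

text \<open>A cut vertex separates two other vertices of its connected component; equivalently, its
  deletion (together with the incident edges) increases the number of components.\<close>

definition cut_vertex :: "'a set \<Rightarrow> 'a set set \<Rightarrow> 'a \<Rightarrow> bool" where
  "cut_vertex V E c \<longleftrightarrow>
     c \<in> V \<and> (\<exists>u\<in>V - {c}. \<exists>v\<in>V - {c}. joined E u v \<and> \<not> joined {e \<in> E. c \<notin> e} u v)"

definition two_connected :: "'a set \<Rightarrow> 'a set set \<Rightarrow> bool" where
  "two_connected V E \<longleftrightarrow> card V \<ge> 3 \<and> graph_connected V E \<and> (\<nexists>c. cut_vertex V E c)"

definition triangle_edges :: "'a set set \<Rightarrow> 'a set set" where
  "triangle_edges E =
     {e \<in> E. \<exists>u v w. distinct [u, v, w] \<and> e = {u, v} \<and> {v, w} \<in> E \<and> {w, u} \<in> E}"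


section \<open>Lattice polytopes\<close>

definition integer_lattice :: "(real ^ 'n) set" where
  "integer_lattice = {x. \<forall>i. x $ i \<in> \<int>}"

text \<open>The constant term is 1 by convention, also for the empty set.\<close>

definition ehrhart_series :: "(real ^ 'n) set \<Rightarrow> int fps" where
  "ehrhart_series P = Abs_fps (\<lambda>m. if m = 0 then 1
     else int (card ((\<lambda>x. real m *\<^sub>R x) ` P \<inter> integer_lattice)))"

text \<open>The numerator of the Ehrhart series over \<open>(1 - t) ^ (dim P + 1)\<close>, with the denominator
  multiplied out. The solution is unique whenever it exists; that it exists for every nonempty
  lattice polytope is the theorem of Ehrhart and Stanley.\<close>

definition h_star :: "(real ^ 'n) set \<Rightarrow> int poly" where
  "h_star P = (THE h.
     fps_of_poly h = ehrhart_series P * (1 - fps_X) ^ (nat (aff_dim P) + 1))"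

text \<open>The coefficients of the \<open>h\<^sup>*\<close>-polynomial in the basis \<open>t ^ i * (1 + t) ^ (d - 2 * i)\<close>,
  \<open>i = 0, \<dots>, \<lfloor>d / 2\<rfloor>\<close>, of the palindromic polynomials with centre of symmetry \<open>d / 2\<close>. They
  exist exactly if the \<open>h\<^sup>*\<close>-polynomial is palindromic in this sense.\<close>

definition gamma_poly :: "(real ^ 'n) set \<Rightarrow> int poly" where
  "gamma_poly P = (let d = nat (aff_dim P) in
     THE g. degree g \<le> d div 2 \<and>
       h_star P = (\<Sum>i\<le>d div 2. smult (coeff g i) (monom 1 i * [:1, 1:] ^ (d - 2 * i))))"

definition num_edges :: "(real ^ 'n) set \<Rightarrow> nat" where
  "num_edges P = card {F. F edge_of P}"


section \<open>Symmetric edge polytopes\<close>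

text \<open>Both signs occur, because \<open>{i, j} = {j, i}\<close>. The vertex set is the whole index type, so that
  deleting an edge from \<open>E\<close> keeps the ambient space.\<close>

definition sym_edge_polytope :: "'n::finite set set \<Rightarrow> (real ^ 'n) set" where
  "sym_edge_polytope E = convex hull {axis i 1 - axis j 1 | i j. {i, j} \<in> E}"

definition Z_poly :: "'n::finite set set \<Rightarrow> int poly" where
  "Z_poly E = (\<Sum>e\<in>E. gamma_poly (sym_edge_polytope E) - gamma_poly (sym_edge_polytope (E - {e})))"

end

theory Submission
  imports Defs
begin

text \<open>
  Let \<open>A\<close> be the set of vectors \<open>e\<^sub>i - e\<^sub>j\<close> belonging to the edges of a connected graph with \<open>n = d + 1\<close>
  vertices. By unimodularity every lattice point has integer coordinates with respect to every basis
  contained in \<open>A\<close>. A generic small perturbation of the cost function \<open>1\<close> on \<open>A\<close> singles out the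
  dual feasible bases; their cones form a unimodular fan, and a generic direction \<open>v\<close> turns it into a
  partition into half-open cones, one for each such basis \<open>F\<close>. Summing over the lattice points gives
  \<open>h\<^sup>* = (\<Sum>F. t ^ neg v F)\<close>, where \<open>neg v F\<close> counts the negative coordinates of \<open>v\<close> with respect
  to \<open>F\<close>. Replacing \<open>v\<close> by \<open>- v\<close> shows that \<open>h\<^sup>*\<close> is palindromic of degree \<open>d\<close>, so that \<open>\<gamma>\<^sub>2\<close> is
  an affine function of the numbers of lattice points of \<open>P\<close> and \<open>2P\<close>.

  The lattice points of \<open>2P\<close> are the sums of two elements of \<open>A \<union> {0}\<close>. Such a point disappears
  when the edge \<open>e\<close> is deleted iff all its representations use \<open>e\<close>. Edges of \<open>P\<close> correspond to the
  points with exactly one representation by two different elements of \<open>A\<close>, and each of these is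
  destroyed by exactly two edges. Summing over \<open>e\<close> gives the formula for \<open>z\<^sub>2\<close>.

  For nonnegativity it suffices to count only those edges of \<open>P\<close> that join \<open>e\<^sub>i - e\<^sub>j\<close> to
  \<open>e\<^sub>k - e\<^sub>l\<close> with \<open>k = i\<close>, or \<open>l = j\<close>, or \<open>i, j, k, l\<close> distinct. The claim becomes
  \<open>(\<Sum>ij. deg i + deg j + c\<^sub>4(ij)) + |E\<^sub>3| \<le> |E| (2 |E| - 2 n + 5)\<close>, where \<open>c\<^sub>4(ij)\<close> is the number
  of four-cycles through \<open>ij\<close>. If deleting the ends of any edge leaves a connected graph, this holds
  edge by edge; otherwise the graph is glued from two smaller 2-connected graphs along an edge, and
  induction applies.
\<close>


section \<open>Unimodular vector configurations\<close>

text \<open>\<open>h_star\<close> and \<open>gamma_poly\<close> are definite descriptions, so no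
  coefficient of \<open>Z_poly\<close> is accessible before the Ehrhart numerator is known to exist,
  to have degree at most the dimension and to be palindromic; hence the full lattice point count.
  The count does not depend on the generic direction, which gives the symmetry without any
  reciprocity theorem. A 2-connected graph and its edge deletions have polytopes of the same
  dimension, so the differences of second coefficients retain only the loss of lattice points of 2P
  and one constant per edge.

  Four-cycles enter because the sum of two disjoint darts (i, j) and (k, l) has a single competing
  representation, by (i, l) and (k, j) with the heads swapped. Degrees enter because the darts
  sharing a tail or a head with (i, j) and the darts avoiding it together number 2 |E| - deg i - deg
  j.\<close>

lemma representation_unique_sum:
  fixes F :: "'a::real_vector set"
  assumes "independent F" "finite F" "x = (\<Sum>b\<in>F. u b *\<^sub>R b)" "b \<in> F"
  shows "representation F x b = u b"
proof -
  have "representation F x b = (\<Sum>a\<in>F. u a * representation F a b)"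
    using assms(1) unfolding assms(3)
    by (simp add: real_vector.representation_sum real_vector.representation_scale
        real_vector.span_base real_vector.span_scale)
  also have "\<dots> = (\<Sum>a\<in>F. if a = b then u a else 0)"
    using assms(1) by (intro sum.cong) (auto simp: real_vector.representation_basis)
  finally show ?thesis using assms(2,4) by simp
qed

lemma representation_sum_span:
  fixes F :: "'a::real_vector set"
  assumes "independent F" "finite F" "x \<in> span F"
  shows "(\<Sum>b\<in>F. representation F x b *\<^sub>R b) = x"
  using real_vector.sum_representation_eq[OF assms(1,3,2)] by simp

text \<open>The linear functional on \<open>span F\<close> that agrees with \<open>c\<close> on
  \<open>F\<close>: the dual solution of the basis \<open>F\<close> in linear programming. The
  difference \<open>c a - basis_value c F a\<close> is the reduced cost of \<open>a\<close>.\<close>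

definition basis_value :: "('a::real_vector \<Rightarrow> real) \<Rightarrow> 'a set \<Rightarrow> 'a \<Rightarrow> real" where
  "basis_value c F x = (\<Sum>b\<in>F. representation F x b * c b)"

lemma basis_value_sum:
  fixes F :: "'a::real_vector set"
  assumes "independent F" "finite S" "S \<subseteq> span F"
  shows "basis_value c F (\<Sum>a\<in>S. u a *\<^sub>R a) = (\<Sum>a\<in>S. u a * basis_value c F a)"
proof -
  have "basis_value c F (\<Sum>a\<in>S. u a *\<^sub>R a) = (\<Sum>b\<in>F. \<Sum>a\<in>S. u a * representation F a b * c b)"
    unfolding basis_value_def using assms
    by (subst real_vector.representation_sum) (auto simp: real_vector.representation_scale
        real_vector.span_scale sum_distrib_right subset_iff)
  also have "\<dots> = (\<Sum>a\<in>S. u a * basis_value c F a)"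
    unfolding basis_value_def by (subst sum.swap) (simp add: sum_distrib_left mult.assoc)
  finally show ?thesis .
qed

lemma basis_value_base:
  assumes "independent F" "finite F" "b \<in> F"
  shows "basis_value c F b = c b"
proof -
  have "basis_value c F b = (\<Sum>a\<in>F. if a = b then c a else 0)"
    unfolding basis_value_def using assms
    by (intro sum.cong) (auto simp: real_vector.representation_basis)
  with assms show ?thesis by simp
qed

lemma basis_value_add:
  fixes F :: "'a::real_vector set"
  assumes "independent F" "x \<in> span F" "y \<in> span F"
  shows "basis_value c F (x + y) = basis_value c F x + basis_value c F y"
  using assms unfolding basis_value_def
  by (simp add: real_vector.representation_add sum.distrib distrib_right)

lemma basis_value_scale:
  fixes F :: "'a::real_vector set"
  assumes "independent F" "x \<in> span F"
  shows "basis_value c F (r *\<^sub>R x) = r * basis_value c F x"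
  using assms unfolding basis_value_def
  by (simp add: real_vector.representation_scale sum_distrib_left mult.assoc)

section \<open>Symbolic perturbation\<close>

text \<open>The exponents are distinct and positive, so neither \<open>k\<close> nor another summand
  can cancel the coefficient of \<open>s ^ idx a0\<close>. A nonzero polynomial has finitely many
  roots, hence none just to the right of 0.\<close>

lemma eventually_power_sum_nonzero:
  fixes r :: "'a \<Rightarrow> real" and idx :: "'a \<Rightarrow> nat"
  assumes "finite A" "inj_on idx A" "0 \<notin> idx ` A" "a0 \<in> A" "r a0 \<noteq> 0"
  shows "eventually (\<lambda>s. k + (\<Sum>a\<in>A. r a * s ^ idx a) \<noteq> 0) (at_right 0)"
proof -
  define p where "p = [:k:] + (\<Sum>a\<in>A. monom (r a) (idx a))"
  have p: "poly p s = k + (\<Sum>a\<in>A. r a * s ^ idx a)" for s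
    by (simp add: p_def poly_sum poly_monom)
  have pos: "idx a0 > 0" using assms(3,4) by (cases "idx a0") force+
  have "coeff p (idx a0) = (\<Sum>a\<in>A. coeff (monom (r a) (idx a)) (idx a0))"
    using pos unfolding p_def by (cases "idx a0") (simp_all add: coeff_sum)
  also have "\<dots> = (\<Sum>a\<in>A. if a = a0 then r a else 0)"
    using assms(2,4) by (intro sum.cong) (auto dest: inj_onD)
  finally have "coeff p (idx a0) = r a0" using assms(1,4) by simp
  then have "p \<noteq> 0" using assms by auto
  then have fin: "finite {s. poly p s = 0}" by (rule poly_roots_finite)
  have "eventually (\<lambda>s. \<forall>t\<in>{s. poly p s = 0}. s \<noteq> t) (at_right 0)"
    using fin by (intro eventually_ball_finite) (auto intro: eventually_neq_at_within)
  then show ?thesis by eventually_elim (use p in auto)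
qed

text \<open>The sign of \<open>x + s * y\<close> for infinitesimal positive \<open>s\<close>. For a
  fixed nonzero \<open>y\<close> it describes a half-line in \<open>x\<close>, closed at 0 if
  \<open>y\<close> is positive and open if \<open>y\<close> is negative.\<close>

definition lexpos :: "real \<Rightarrow> real \<Rightarrow> bool" where
  "lexpos x y \<longleftrightarrow> x > 0 \<or> (x = 0 \<and> y > 0)"

lemma eventually_lexpos:
  assumes "y \<noteq> 0"
  shows "eventually (\<lambda>s. x + s * y \<noteq> 0 \<and> (x + s * y > 0 \<longleftrightarrow> lexpos x y)) (at_right 0)"
proof -
  have pos: "eventually (\<lambda>s::real. s > 0) (at_right 0)"
    by (simp add: eventually_at_right_less)
  have lim: "((\<lambda>s. x + s * y) \<longlongrightarrow> x + 0 * y) (at_right 0)"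
    by (intro tendsto_intros)
  consider "x > 0" | "x < 0" | "x = 0" by linarith
  then show ?thesis
  proof cases
    case 1
    then have "eventually (\<lambda>s. x + s * y > 0) (at_right 0)"
      using lim by (intro order_tendstoD) auto
    then show ?thesis by eventually_elim (use 1 in \<open>auto simp: lexpos_def\<close>)
  next
    case 2
    then have "eventually (\<lambda>s. x + s * y < 0) (at_right 0)"
      using lim by (intro order_tendstoD) auto
    then show ?thesis by eventually_elim (use 2 in \<open>auto simp: lexpos_def\<close>)
  next
    case 3
    from pos show ?thesis
      by eventually_elim (use 3 assms in \<open>auto simp: lexpos_def zero_less_mult_iff\<close>)
  qed
qed

section \<open>Bases and the simplex method\<close>

text \<open>\<open>representation_Ints\<close> is the unimodularity: the cone over any basis inside
  \<open>A\<close> has as its lattice points exactly the natural combinations of the basis.\<close>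

locale unimodular_system =
  fixes A L :: "'a::euclidean_space set"
  assumes finite_A: "finite A" and A_nonempty: "A \<noteq> {}" and zero_notin_A: "0 \<notin> A"
    and minus_A: "a \<in> A \<Longrightarrow> - a \<in> A"
    and A_subset_L: "A \<subseteq> L" and zero_in_L: "0 \<in> L" and add_in_L: "x \<in> L \<Longrightarrow> y \<in> L \<Longrightarrow> x + y \<in> L"
    and representation_Ints: "F \<subseteq> A \<Longrightarrow> independent F \<Longrightarrow> span F = span A \<Longrightarrow>
      x \<in> L \<Longrightarrow> x \<in> span A \<Longrightarrow> representation F x b \<in> \<int>"
begin

definition bases :: "'a set set" where
  "bases = {F. F \<subseteq> A \<and> independent F \<and> span F = span A}"

lemma basesD:
  assumes "F \<in> bases"
  shows "F \<subseteq> A" "independent F" "span F = span A" "finite F" "card F = dim A"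
  using assms finite_A finite_subset dim_span_eq_card_independent[of F] unfolding bases_def
  by (auto simp: dim_span)

lemma basesI:
  assumes "F \<subseteq> A" "A \<subseteq> span F" "card F \<le> dim A"
  shows "F \<in> bases"
proof -
  have "span F = span A"
    using assms by (metis span_mono span_span subset_antisym)
  moreover have "independent F"
    using assms finite_A by (intro card_le_dim_spanning[of F "span A"])
      (auto simp: finite_subset calculation dest: span_base)
  ultimately show ?thesis using assms by (auto simp: bases_def)
qed

lemma finite_bases: "finite bases"
  using finite_A by (auto simp: bases_def intro: finite_subset[of _ "Pow A"])

lemma bases_nonempty: "bases \<noteq> {}"
proof -
  obtain B where "B \<subseteq> A" "independent B" "A \<subseteq> span B"
    by (rule basis_exists[of A]) blast
  moreover from this have "span B = span A"
    by (simp add: span_minimal span_mono subset_antisym)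
  ultimately have "B \<in> bases" by (simp add: bases_def)
  then show ?thesis by blast
qed

text \<open>One simplex step for writing \<open>y\<close> as a nonnegative combination of
  \<open>A\<close> at minimal cost: \<open>a\<close> has negative reduced cost and enters the basis.
  Nondegeneracy, in the form of \<open>nz\<close>, keeps the new coordinates strictly
  positive.\<close>

lemma pivot:
  assumes F: "F \<in> bases" and y: "y \<in> span A" and nz: "\<And>B b. B \<in> bases \<Longrightarrow> b \<in> B \<Longrightarrow> representation B y b \<noteq> 0"
    and pos: "\<And>b. b \<in> F \<Longrightarrow> representation F y b > 0" and c: "\<And>a. a \<in> A \<Longrightarrow> c a > 0"
    and a: "a \<in> A" "basis_value c F a > c a"
  obtains F' where "F' \<in> bases" "\<And>b. b \<in> F' \<Longrightarrow> representation F' y b > 0"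
    "basis_value c F' y < basis_value c F y"
proof -
  note Fb = basesD[OF F]
  define r where "r = representation F a"
  define l where "l = representation F y"
  have spF: "a \<in> span F" "y \<in> span F" using a y Fb by (auto simp: span_base)
  have ar: "a = (\<Sum>b\<in>F. r b *\<^sub>R b)" and yl: "y = (\<Sum>b\<in>F. l b *\<^sub>R b)"
    using representation_sum_span[OF Fb(2,4)] spF by (auto simp: r_def l_def)
  have "a \<notin> F" using a(2) basis_value_base[OF Fb(2,4)] by force
  \<comment> \<open>Positive costs keep the linear program bounded: without a positive coordinate
    the value of \<open>a\<close> would be at most 0, but it exceeds \<open>c a\<close>.\<close>
  have "\<exists>b\<in>F. r b > 0"
  proof (rule ccontr)
    assume "\<not> ?thesis"
    then have "basis_value c F a \<le> 0" unfolding basis_value_def r_def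
      using c Fb(1) by (intro sum_nonpos) (auto simp: not_less mult_le_0_iff less_imp_le subset_iff)
    with a c show False by fastforce
  qed
  then have P: "finite {b\<in>F. r b > 0}" "{b\<in>F. r b > 0} \<noteq> {}" using Fb(4) by auto
  \<comment> \<open>The ratio test: \<open>b\<close> is a coordinate that reaches 0 first as the
    weight of \<open>a\<close> grows.\<close>
  define b where "b = arg_min_on (\<lambda>b. l b / r b) {b\<in>F. r b > 0}"
  have b: "b \<in> F" "r b > 0" and bmin: "\<And>b'. b' \<in> F \<Longrightarrow> r b' > 0 \<Longrightarrow> l b / r b \<le> l b' / r b'"
    using arg_min_if_finite[OF P, of "\<lambda>b. l b / r b"] unfolding b_def by (auto simp: not_less)
  define t where "t = l b / r b"
  have tpos: "t > 0" using b pos by (simp add: t_def l_def)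
  define F' where "F' = insert a (F - {b})"
  \<comment> \<open>The coordinates of \<open>y\<close> after weight \<open>t\<close> has been moved
    to \<open>a\<close>; the one of \<open>b\<close> becomes 0.\<close>
  define u where "u x = (if x = a then t else l x - t * r x)" for x
  have unn: "u x \<ge> 0" if "x \<in> F'" for x
  proof (cases "x = a \<or> r x \<le> 0")
    case True
    then show ?thesis using tpos that pos
      by (auto simp: u_def F'_def l_def less_imp_le mult_le_0_iff
          intro!: order_trans[of "t * r x" 0 "representation F y x" for x])
  next
    case False
    then have "t \<le> l x / r x" using bmin that by (auto simp: t_def F'_def)
    with False show ?thesis by (simp add: u_def field_simps)
  qed
  have bsum: "b = (1 / r b) *\<^sub>R a - (\<Sum>x\<in>F-{b}. (r x / r b) *\<^sub>R x)"
  proof -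
    have "a = r b *\<^sub>R b + (\<Sum>x\<in>F-{b}. r x *\<^sub>R x)"
      using ar sum.remove[OF Fb(4) b(1), of "\<lambda>x. r x *\<^sub>R x"] by simp
    then have "(1 / r b) *\<^sub>R a = (1 / r b) *\<^sub>R (r b *\<^sub>R b) + (1 / r b) *\<^sub>R (\<Sum>x\<in>F-{b}. r x *\<^sub>R x)"
      by (metis scaleR_right_distrib)
    then have "(1 / r b) *\<^sub>R a = b + (\<Sum>x\<in>F-{b}. (r x / r b) *\<^sub>R x)"
      using b by (simp add: scaleR_sum_right)
    then show ?thesis by (simp add: algebra_simps)
  qed
  have "b \<in> span F'"
    by (subst bsum) (intro span_diff span_scale span_sum span_base; auto simp: F'_def)
  moreover have "x \<in> span F'" if "x \<in> F" "x \<noteq> b" for x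
    using that by (intro span_base) (auto simp: F'_def)
  ultimately have "F \<subseteq> span F'" by auto
  then have "A \<subseteq> span F'" using Fb(3) by (metis span_minimal span_superset subset_trans subspace_span)
  moreover have cardF': "card F' = card F"
    using b \<open>a \<notin> F\<close> Fb(4) card_gt_0_iff[of F] by (auto simp: F'_def)
  ultimately have F': "F' \<in> bases"
    using Fb a by (intro basesI) (auto simp: F'_def)
  note Fb' = basesD[OF F']
  have split: "(\<Sum>x\<in>F'. f x) = f a + (\<Sum>x\<in>F. f x) - f b" for f :: "'a \<Rightarrow> 'z::ab_group_add"
    using b \<open>a \<notin> F\<close> Fb(4) by (simp add: F'_def sum_diff1 algebra_simps)
  have ub: "u b = 0" using b \<open>a \<notin> F\<close> by (auto simp: u_def t_def)
  have "(\<Sum>x\<in>F'. u x *\<^sub>R x) = t *\<^sub>R a + (\<Sum>x\<in>F. u x *\<^sub>R x)"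
    unfolding split using ub by (simp add: u_def)
  also have "(\<Sum>x\<in>F. u x *\<^sub>R x) = (\<Sum>x\<in>F. l x *\<^sub>R x - t *\<^sub>R (r x *\<^sub>R x))"
    using \<open>a \<notin> F\<close> by (intro sum.cong) (auto simp: u_def algebra_simps)
  also have "\<dots> = y - t *\<^sub>R a" by (simp only: sum_subtractf scaleR_sum_right[symmetric] ar[symmetric] yl[symmetric])
  finally have yu: "y = (\<Sum>x\<in>F'. u x *\<^sub>R x)" by simp
  have rep: "representation F' y x = u x" if "x \<in> F'" for x
    by (rule representation_unique_sum[OF Fb'(2,4) yu that])
  show thesis
  proof
    show "F' \<in> bases" by fact
    show "representation F' y x > 0" if "x \<in> F'" for x
      using unn[OF that] nz[OF F' that] rep[OF that] by simp
    have "basis_value c F' y = (\<Sum>x\<in>F'. u x * c x)"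
      unfolding basis_value_def by (intro sum.cong) (auto simp: rep)
    also have "\<dots> = t * c a + (\<Sum>x\<in>F. u x * c x)"
      unfolding split using ub by (simp add: u_def)
    also have "(\<Sum>x\<in>F. u x * c x) = (\<Sum>x\<in>F. l x * c x - t * (r x * c x))"
      using \<open>a \<notin> F\<close> by (intro sum.cong) (auto simp: u_def algebra_simps)
    also have "\<dots> = basis_value c F y - t * basis_value c F a"
      by (simp add: basis_value_def l_def r_def sum_subtractf sum_distrib_left)
    finally show "basis_value c F' y < basis_value c F y"
      using mult_strict_left_mono[OF a(2) tpos] by linarith
  qed
qed

text \<open>The symmetry of \<open>A\<close> provides a starting point for the simplex method: in
  any basis, negate the elements at which \<open>y\<close> has a negative coordinate.\<close>

lemma positive_basis_exists:
  assumes y: "y \<in> span A" and nz: "\<And>B b. B \<in> bases \<Longrightarrow> b \<in> B \<Longrightarrow> representation B y b \<noteq> 0"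
  obtains F where "F \<in> bases" "\<And>b. b \<in> F \<Longrightarrow> representation F y b > 0"
proof -
  obtain B where B: "B \<in> bases" using bases_nonempty by auto
  note Bb = basesD[OF B]
  define f where "f b = (if representation B y b > 0 then b else - b)" for b
  define F where "F = f ` B"
  have "b \<in> span F" if "b \<in> B" for b
  proof -
    have "f b \<in> span F" using that by (auto simp: F_def intro: span_base)
    then show ?thesis using span_neg[of "f b" F] by (auto simp: f_def split: if_splits)
  qed
  then have "A \<subseteq> span F" using Bb(3) by (metis span_minimal span_superset subset_iff subspace_span)
  moreover have "F \<subseteq> A" using Bb(1) minus_A by (auto simp: F_def f_def)
  ultimately have F: "F \<in> bases"
    using card_image_le[OF Bb(4), of f] Bb(5) by (intro basesI) (auto simp: F_def)
  note Fb = basesD[OF F]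
  have inj: "inj_on f B" using Fb(5) Bb(4,5) by (intro eq_card_imp_inj_on) (auto simp: F_def)
  have "y = (\<Sum>b\<in>B. representation B y b *\<^sub>R b)"
    using representation_sum_span[OF Bb(2,4)] y Bb(3) by auto
  also have "\<dots> = (\<Sum>b\<in>B. \<bar>representation B y b\<bar> *\<^sub>R f b)"
    by (intro sum.cong) (auto simp: f_def)
  also have "\<dots> = (\<Sum>b\<in>F. \<bar>representation B y (the_inv_into B f b)\<bar> *\<^sub>R b)"
    unfolding F_def using inj by (subst sum.reindex) (auto simp: the_inv_into_f_f intro!: sum.cong)
  finally have yF: "y = \<dots>" .
  show thesis
  proof
    show "F \<in> bases" by fact
    fix b assume b: "b \<in> F"
    then have "the_inv_into B f b \<in> B" using inj by (auto simp: F_def the_inv_into_f_f)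
    then show "representation F y b > 0"
      using representation_unique_sum[OF Fb(2,4) yF b] nz[OF B] by auto
  qed
qed

text \<open>Among the finitely many bases with \<open>y\<close> in the interior of their cone, one
  of least value must be dual feasible, as \<open>pivot\<close> would otherwise improve it. Taking
  the minimum replaces a termination argument.\<close>

lemma optimal_basis_exists:
  assumes y: "y \<in> span A" and nz: "\<And>B b. B \<in> bases \<Longrightarrow> b \<in> B \<Longrightarrow> representation B y b \<noteq> 0"
    and c: "\<And>a. a \<in> A \<Longrightarrow> c a > 0"
  obtains F where "F \<in> bases" "\<And>b. b \<in> F \<Longrightarrow> representation F y b > 0"
    "\<And>a. a \<in> A \<Longrightarrow> basis_value c F a \<le> c a"
proof -
  define S where "S = {F\<in>bases. \<forall>b\<in>F. representation F y b > 0}"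
  have S: "finite S" "S \<noteq> {}"
    using finite_bases by (auto simp: S_def) (metis positive_basis_exists[OF y nz])
  define F where "F = arg_min_on (\<lambda>F. basis_value c F y) S"
  have F: "F \<in> S" and Fmin: "\<And>F'. F' \<in> S \<Longrightarrow> \<not> basis_value c F' y < basis_value c F y"
    using arg_min_if_finite[OF S, of "\<lambda>F. basis_value c F y"] unfolding F_def by auto
  show thesis
  proof
    show "F \<in> bases" "\<And>b. b \<in> F \<Longrightarrow> representation F y b > 0" using F by (auto simp: S_def)
    fix a assume a: "a \<in> A"
    show "basis_value c F a \<le> c a"
    proof (rule ccontr)
      assume "\<not> basis_value c F a \<le> c a"
      then have less: "basis_value c F a > c a" by simp
      obtain F' where "F' \<in> bases" "\<And>b. b \<in> F' \<Longrightarrow> representation F' y b > 0"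
        "basis_value c F' y < basis_value c F y"
        by (rule pivot[OF _ y nz _ c a less]) (use F in \<open>auto simp: S_def\<close>)
      then show False using Fmin[of F'] by (auto simp: S_def)
    qed
  qed
qed

end

section \<open>Generating functions of half-open simplicial cones\<close>

text \<open>Coordinate vectors of the lattice points up to height \<open>m\<close> in a simplicial
  cone from which some facets are removed; \<open>l\<close> will be 1 at these facets and 0
  elsewhere. The value 0 outside \<open>F\<close> makes each function correspond to one
  point.\<close>

definition bounded_funs :: "'a set \<Rightarrow> ('a \<Rightarrow> nat) \<Rightarrow> nat \<Rightarrow> ('a \<Rightarrow> nat) set" where
  "bounded_funs F l m = {g. (\<forall>b. b \<notin> F \<longrightarrow> g b = 0) \<and> (\<forall>b\<in>F. l b \<le> g b) \<and> sum g F \<le> m}"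

lemma finite_bounded_funs: "finite F \<Longrightarrow> finite (bounded_funs F l m)"
proof -
  assume F: "finite F"
  have "bounded_funs F l m \<subseteq> {g. \<forall>b. (b \<in> F \<longrightarrow> g b \<in> {..m}) \<and> (b \<notin> F \<longrightarrow> g b = 0)}"
    using F by (auto simp: bounded_funs_def dest: order_trans[OF member_le_sum[of _ F]])
  then show "finite (bounded_funs F l m)"
    by (rule finite_subset) (intro finite_set_of_finite_funs F finite_atMost)
qed

lemma card_bounded_funs_insert:
  assumes F: "finite F" "b \<notin> F"
  shows "card (bounded_funs (insert b F) l m) =
    (if m < l b then 0 else card (bounded_funs F l (m - l b))) +
    (if m = 0 then 0 else card (bounded_funs (insert b F) l (m - 1)))"
proof -
  let ?S = "bounded_funs (insert b F) l m"
  have upd: "(\<Sum>x\<in>F. if x = b then k else g x) = sum g F" for g :: "'a \<Rightarrow> nat" and k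
    using F by (intro sum.cong) auto
  have 1: "card {g\<in>?S. g b = l b} = (if m < l b then 0 else card (bounded_funs F l (m - l b)))"
  proof (cases "m < l b")
    case True
    then have "{g\<in>?S. g b = l b} = {}" using F by (auto simp: bounded_funs_def)
    with True show ?thesis by (simp only: card.empty if_True)
  next
    case False
    have "bij_betw (\<lambda>g. g(b := 0)) {g\<in>?S. g b = l b} (bounded_funs F l (m - l b))"
      using F False
      by (intro bij_betw_byWitness[where f' = "\<lambda>g. g(b := l b)"])
         (auto simp: bounded_funs_def upd fun_eq_iff)
    with False show ?thesis by (simp add: bij_betw_same_card)
  qed
  have 2: "card {g\<in>?S. g b \<noteq> l b} = (if m = 0 then 0 else card (bounded_funs (insert b F) l (m - 1)))"
  proof (cases "m = 0")
    case True
    then have "{g\<in>?S. g b \<noteq> l b} = {}" using F by (auto simp: bounded_funs_def)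
    with True show ?thesis by (simp only: card.empty if_True refl)
  next
    case False
    have "bij_betw (\<lambda>g. g(b := g b - 1)) {g\<in>?S. g b \<noteq> l b} (bounded_funs (insert b F) l (m - 1))"
      using F False
      by (intro bij_betw_byWitness[where f' = "\<lambda>g. g(b := Suc (g b))"])
         (auto simp: bounded_funs_def upd fun_eq_iff)
    with False show ?thesis by (simp add: bij_betw_same_card)
  qed
  have "?S = {g\<in>?S. g b = l b} \<union> {g\<in>?S. g b \<noteq> l b}" by auto
  then have "card ?S = card {g\<in>?S. g b = l b} + card {g\<in>?S. g b \<noteq> l b}"
    using F finite_bounded_funs[of "insert b F" l m]
    by (subst card_Un_disjoint[symmetric]) auto
  with 1 2 show ?thesis by simp
qed

text \<open>Each coordinate contributes a factor t^(l b) / (1 - t). The extra factor 1 - t in the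
  exponent \<open>card F + 1\<close> belongs to the slack, as the sum is only bounded by
  \<open>m\<close>.\<close>

lemma fps_bounded_funs:
  assumes "finite F"
  shows "Abs_fps (\<lambda>m. int (card (bounded_funs F l m))) * (1 - fps_X) ^ (card F + 1) = fps_X ^ (sum l F)"
  using assms
proof (induction F)
  case empty
  have "bounded_funs {} l m = {\<lambda>_. 0}" for m by (auto simp: bounded_funs_def)
  then have "Abs_fps (\<lambda>m. int (card (bounded_funs {} l m))) = Abs_fps (\<lambda>_. 1)" by simp
  also have "\<dots> * (1 - fps_X) = 1"
    by (rule fps_ext) (auto simp: algebra_simps)
  finally show ?case by simp
next
  case (insert b F)
  let ?f = "\<lambda>F. Abs_fps (\<lambda>m. int (card (bounded_funs F l m)))"
  have "?f (insert b F) = fps_X ^ l b * ?f F + fps_X * ?f (insert b F)"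
    by (rule fps_ext)
      (simp add: fps_X_power_mult_nth card_bounded_funs_insert[OF insert.hyps(1,2)])
  then have "?f (insert b F) * (1 - fps_X) = fps_X ^ l b * ?f F"
    by (simp add: algebra_simps)
  then have "?f (insert b F) * (1 - fps_X) ^ (card (insert b F) + 1) =
      fps_X ^ l b * (?f F * (1 - fps_X) ^ (card F + 1))"
    using insert.hyps by (simp add: mult.assoc[symmetric])
  also have "\<dots> = fps_X ^ sum l (insert b F)"
    unfolding insert.IH using insert.hyps by (simp add: power_add)
  finally show ?case .
qed

section \<open>Generic costs and directions, and the half-open cones they define\<close>

context unimodular_system
begin

text \<open>The last condition makes the perturbation so small that the dual feasible bases lie on the
  boundary of the convex hull of \<open>A\<close>.\<close>

definition generic_cost :: "('a \<Rightarrow> real) \<Rightarrow> bool" where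
  "generic_cost c \<longleftrightarrow> (\<forall>a\<in>A. c a > 0) \<and>
    (\<forall>F\<in>bases. \<forall>a\<in>A - F. basis_value c F a \<noteq> c a) \<and>
    (\<forall>F\<in>bases. \<forall>a\<in>A. basis_value c F a \<le> c a \<longrightarrow> basis_value (\<lambda>_. 1) F a \<le> 1)"

definition generic_direction :: "'a \<Rightarrow> bool" where
  "generic_direction v \<longleftrightarrow> v \<in> span A \<and> (\<forall>F\<in>bases. \<forall>b\<in>F. representation F v b \<noteq> 0)"

lemma index_exists: obtains idx :: "'a \<Rightarrow> nat" where "inj_on idx A" "0 \<notin> idx ` A"
proof -
  obtain f :: "'a \<Rightarrow> nat" where "inj_on f A"
    using finite_imp_inj_to_nat_seg[OF finite_A] by auto
  then have "inj_on (Suc \<circ> f) A" "0 \<notin> (Suc \<circ> f) ` A" by (auto simp: inj_on_def)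
  then show thesis by (rule that)
qed

lemma generic_cost_exists: obtains c where "generic_cost c"
proof -
  obtain idx :: "'a \<Rightarrow> nat" where idx: "inj_on idx A" "0 \<notin> idx ` A" by (rule index_exists)
  \<comment> \<open>Powers of one parameter with distinct exponents: each of the finitely many
    conditions holds for all small \<open>s\<close>, so one \<open>s\<close> satisfies them
    all.\<close>
  define c where "c s a = 1 + s ^ idx a" for s :: real and a
  have bv: "basis_value (c s) F a = basis_value (\<lambda>_. 1) F a + (\<Sum>b\<in>F. representation F a b * s ^ idx b)"
    for s F a by (simp add: basis_value_def c_def distrib_left sum.distrib)
  have 1: "eventually (\<lambda>s. basis_value (c s) F a \<noteq> c s a) (at_right 0)" if F: "F \<in> bases" and a: "a \<in> A - F" for F a
  proof -
    note Fb = basesD[OF F]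
    \<comment> \<open>The coefficients of the reduced cost of \<open>a\<close> as a polynomial in
      \<open>s\<close>. As \<open>a\<close> is not in \<open>F\<close>, the power of
      \<open>a\<close> has coefficient 1, so the polynomial is not zero.\<close>
    define r where "r x = (if x = a then 1 else if x \<in> F then - representation F a x else 0)" for x
    have "c s a - basis_value (c s) F a = (1 - basis_value (\<lambda>_. 1) F a) + (\<Sum>x\<in>A. r x * s ^ idx x)" for s
    proof -
      have "(\<Sum>x\<in>A. r x * s ^ idx x) = (\<Sum>x\<in>insert a F. r x * s ^ idx x)"
        using a Fb finite_A by (intro sum.mono_neutral_right) (auto simp: r_def)
      also have "\<dots> = s ^ idx a + (\<Sum>x\<in>F. r x * s ^ idx x)"
        using a Fb by (simp add: r_def)
      also have "(\<Sum>x\<in>F. r x * s ^ idx x) = (\<Sum>x\<in>F. - (representation F a x * s ^ idx x))"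
        using a by (intro sum.cong) (auto simp: r_def)
      finally show ?thesis by (simp add: bv c_def sum_negf)
    qed
    moreover have "eventually (\<lambda>s. (1 - basis_value (\<lambda>_. 1) F a) + (\<Sum>x\<in>A. r x * s ^ idx x) \<noteq> 0) (at_right 0)"
      by (rule eventually_power_sum_nonzero[OF finite_A idx, of a]) (use a in \<open>auto simp: r_def\<close>)
    ultimately have "eventually (\<lambda>s. c s a - basis_value (c s) F a \<noteq> 0) (at_right 0)" by simp
    then show ?thesis by (rule eventually_mono) auto
  qed
  \<comment> \<open>If \<open>a\<close> violates dual feasibility for the cost 1, it does so
    strictly, and by continuity it still does after a small perturbation.\<close>
  have 2: "eventually (\<lambda>s. basis_value (c s) F a \<le> c s a \<longrightarrow> basis_value (\<lambda>_. 1) F a \<le> 1) (at_right 0)"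
    if F: "F \<in> bases" and a: "a \<in> A" for F a
  proof (cases "basis_value (\<lambda>_. 1) F a \<le> 1")
    case False
    note Fb = basesD[OF F]
    have idx0: "idx b \<noteq> 0" if "b \<in> A" for b using that idx by force
    have "((\<lambda>s. c s a - basis_value (c s) F a) \<longlongrightarrow>
        (1 + 0 ^ idx a) - (basis_value (\<lambda>_. 1) F a + (\<Sum>b\<in>F. representation F a b * 0 ^ idx b))) (at_right 0)"
      unfolding bv unfolding c_def by (intro tendsto_intros)
    also have "(\<Sum>b\<in>F. representation F a b * 0 ^ idx b) = 0"
      using idx0 Fb(1) by (intro sum.neutral ballI) (metis mult_zero_right power_0_left subsetD)
    finally have "((\<lambda>s. c s a - basis_value (c s) F a) \<longlongrightarrow> 1 - basis_value (\<lambda>_. 1) F a) (at_right 0)"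
      using idx0[OF a] by (simp add: power_0_left)
    then have "eventually (\<lambda>s. c s a - basis_value (c s) F a < 0) (at_right 0)"
      using False by (intro order_tendstoD) auto
    then show ?thesis by eventually_elim auto
  qed simp
  have "eventually (\<lambda>s::real. s > 0) (at_right 0)"
    by (simp add: eventually_at_right_less)
  moreover have "eventually (\<lambda>s. \<forall>F\<in>bases. \<forall>a\<in>A - F. basis_value (c s) F a \<noteq> c s a) (at_right 0)"
    using finite_A finite_bases 1 by (intro eventually_ball_finite ballI) auto
  moreover have "eventually (\<lambda>s. \<forall>F\<in>bases. \<forall>a\<in>A. basis_value (c s) F a \<le> c s a \<longrightarrow> basis_value (\<lambda>_. 1) F a \<le> 1) (at_right 0)"
    using finite_A finite_bases 2 by (intro eventually_ball_finite ballI) auto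
  ultimately have "eventually (\<lambda>s. generic_cost (c s)) (at_right 0)"
    by eventually_elim (auto simp: generic_cost_def c_def add_pos_pos)
  then show thesis using that eventually_happens'[OF trivial_limit_at_right_real] by blast
qed

lemma generic_direction_exists: obtains v where "generic_direction v"
proof -
  obtain idx :: "'a \<Rightarrow> nat" where idx: "inj_on idx A" "0 \<notin> idx ` A" by (rule index_exists)
  define v where "v s = (\<Sum>a\<in>A. s ^ idx a *\<^sub>R a)" for s :: real
  have v: "v s \<in> span A" for s
    unfolding v_def by (intro span_sum span_scale span_base)
  have "eventually (\<lambda>s. representation F (v s) b \<noteq> 0) (at_right 0)" if F: "F \<in> bases" and b: "b \<in> F" for F b
  proof -
    note Fb = basesD[OF F]
    have "representation F (v s) b = 0 + (\<Sum>a\<in>A. representation F a b * s ^ idx a)" for s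
      unfolding v_def using Fb
      by (subst real_vector.representation_sum)
         (auto simp: real_vector.representation_scale span_scale span_base mult.commute)
    moreover have "eventually (\<lambda>s. 0 + (\<Sum>a\<in>A. representation F a b * s ^ idx a) \<noteq> 0) (at_right 0)"
      by (rule eventually_power_sum_nonzero[OF finite_A idx, of b])
         (use b Fb in \<open>auto simp: real_vector.representation_basis\<close>)
    ultimately show ?thesis by simp
  qed
  then have "eventually (\<lambda>s. \<forall>F\<in>bases. \<forall>b\<in>F. representation F (v s) b \<noteq> 0) (at_right 0)"
    using finite_bases basesD(4) by (intro eventually_ball_finite ballI) auto
  then have "eventually (\<lambda>s. generic_direction (v s)) (at_right 0)"
    by eventually_elim (auto simp: generic_direction_def v)
  then show thesis using that eventually_happens'[OF trivial_limit_at_right_real] by blast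
qed

lemma generic_direction_minus:
  assumes "generic_direction v" shows "generic_direction (- v)"
  using assms basesD unfolding generic_direction_def
  by (auto simp: span_neg real_vector.representation_neg)

text \<open>For generic \<open>c\<close> these are the maximal cones of the regular triangulation
  with heights \<open>c\<close>.\<close>

definition optimal_bases :: "('a \<Rightarrow> real) \<Rightarrow> 'a set set" where
  "optimal_bases c = {F\<in>bases. \<forall>a\<in>A. basis_value c F a \<le> c a}"

text \<open>For generic \<open>v\<close>: the points that enter the open cone over \<open>F\<close>
  when moved slightly in the direction \<open>v\<close>.\<close>

definition half_open_cone :: "'a \<Rightarrow> 'a set \<Rightarrow> 'a set" where
  "half_open_cone v F = {x\<in>span A. \<forall>b\<in>F. lexpos (representation F x b) (representation F v b)}"

text \<open>Complementary slackness: each dual value at \<open>y\<close> bounds the other, so they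
  agree, and positivity of the coordinates makes the functional of \<open>F\<close> tight on all of
  \<open>G\<close>. By genericity it is tight only on \<open>F\<close>.\<close>

lemma optimal_basis_unique:
  assumes c: "generic_cost c" and F: "F \<in> optimal_bases c" "G \<in> optimal_bases c" and y: "y \<in> span A"
    and pos: "\<And>b. b \<in> F \<Longrightarrow> representation F y b > 0" "\<And>b. b \<in> G \<Longrightarrow> representation G y b > 0"
  shows "F = G"
proof -
  have sum: "basis_value c F y = (\<Sum>b\<in>G. representation G y b * basis_value c F b)"
    if "F \<in> bases" "G \<in> bases" for F G
  proof -
    note b = basesD[OF that(1)] basesD[OF that(2)]
    have "basis_value c F y = basis_value c F (\<Sum>b\<in>G. representation G y b *\<^sub>R b)"
      using representation_sum_span[OF b(7,9)] y b by simp
    also have "\<dots> = (\<Sum>b\<in>G. representation G y b * basis_value c F b)"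
      using b by (intro basis_value_sum) (auto intro: span_base)
    finally show ?thesis .
  qed
  have le: "basis_value c F y \<le> basis_value c G y"
    if "F \<in> optimal_bases c" "G \<in> optimal_bases c" "\<And>b. b \<in> G \<Longrightarrow> representation G y b > 0" for F G
  proof -
    have "basis_value c F y = (\<Sum>b\<in>G. representation G y b * basis_value c F b)"
      using that by (intro sum) (auto simp: optimal_bases_def)
    also have "\<dots> \<le> (\<Sum>b\<in>G. representation G y b * c b)"
      using that basesD(1)[of G] by (intro sum_mono mult_left_mono) (auto simp: optimal_bases_def less_imp_le)
    finally show ?thesis by (simp add: basis_value_def)
  qed
  have b: "F \<in> bases" "G \<in> bases" using F by (auto simp: optimal_bases_def)
  note Fb = basesD[OF b(1)] and Gb = basesD[OF b(2)]
  have "basis_value c F y = basis_value c G y" using le F pos by (meson order_antisym)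
  then have "(\<Sum>b\<in>G. representation G y b * (c b - basis_value c F b)) = 0"
    unfolding sum[OF b] by (simp add: basis_value_def[of c G] right_diff_distrib sum_subtractf)
  moreover have "representation G y b * (c b - basis_value c F b) \<ge> 0" if "b \<in> G" for b
    using that pos(2)[OF that] F Gb(1) by (intro mult_nonneg_nonneg) (auto simp: optimal_bases_def)
  ultimately have "\<forall>b\<in>G. representation G y b * (c b - basis_value c F b) = 0"
    using Gb(4) by (subst (asm) sum_nonneg_eq_0_iff) auto
  then have "\<forall>b\<in>G. basis_value c F b = c b" using pos(2) by fastforce
  then have "G \<subseteq> F" using c b Gb(1) unfolding generic_cost_def by blast
  then show ?thesis using Fb(4,5) Gb(5) card_subset_eq[of F G] by simp
qed

text \<open>Moving \<open>x\<close> to \<open>x + s *\<^sub>R v\<close>, with one small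
  \<open>s\<close> that works for all bases at once, gives a nondegenerate point. This lies in the
  open cone of exactly one optimal basis.\<close>

lemma unique_half_open_cone:
  assumes c: "generic_cost c" and v: "generic_direction v" and x: "x \<in> span A"
  shows "\<exists>!F. F \<in> optimal_bases c \<and> x \<in> half_open_cone v F"
proof -
  let ?P = "\<lambda>s. \<forall>F\<in>bases. \<forall>b\<in>F. representation F x b + s * representation F v b \<noteq> 0 \<and>
      (representation F x b + s * representation F v b > 0 \<longleftrightarrow> lexpos (representation F x b) (representation F v b))"
  have "eventually ?P (at_right 0)"
    using finite_bases basesD(4) v
    by (intro eventually_ball_finite ballI eventually_lexpos) (auto simp: generic_direction_def)
  then obtain s where s: "?P s"
    using eventually_happens'[OF trivial_limit_at_right_real] by blast
  define y where "y = x + s *\<^sub>R v"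
  have vs: "v \<in> span A" using v by (simp add: generic_direction_def)
  have y: "y \<in> span A" unfolding y_def using x vs by (intro span_add span_scale)
  have rep: "representation F y b = representation F x b + s * representation F v b" if "F \<in> bases" for F b
    using basesD[OF that] x vs unfolding y_def
    by (simp add: real_vector.representation_add real_vector.representation_scale span_scale)
  have nz: "representation F y b \<noteq> 0" if "F \<in> bases" "b \<in> F" for F b using that s rep by auto
  have cone: "x \<in> half_open_cone v F \<longleftrightarrow> (\<forall>b\<in>F. representation F y b > 0)" if "F \<in> bases" for F
    using that s rep x by (auto simp: half_open_cone_def)
  obtain F where "F \<in> bases" "\<And>b. b \<in> F \<Longrightarrow> representation F y b > 0"
    "\<And>a. a \<in> A \<Longrightarrow> basis_value c F a \<le> c a"
    by (rule optimal_basis_exists[OF y nz, of c]) (use c in \<open>auto simp: generic_cost_def\<close>)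
  then have "F \<in> optimal_bases c \<and> x \<in> half_open_cone v F" by (simp add: optimal_bases_def cone)
  moreover have "F = G" if "F \<in> optimal_bases c \<and> x \<in> half_open_cone v F" "G \<in> optimal_bases c \<and> x \<in> half_open_cone v G" for F G
    using that by (intro optimal_basis_unique[OF c _ _ y]) (auto simp: optimal_bases_def cone)
  ultimately show ?thesis by blast
qed

end

section \<open>Counting the lattice points of the dilates\<close>

context unimodular_system
begin

abbreviation "dilate m \<equiv> (\<lambda>x. real m *\<^sub>R x) ` (convex hull A)"

lemma zero_in_hull: "0 \<in> convex hull A"
proof -
  obtain a where a: "a \<in> A" using A_nonempty by auto
  then have "(1/2) *\<^sub>R a + (1/2) *\<^sub>R (- a) \<in> convex hull A"
    using minus_A by (intro convexD[OF convex_convex_hull] hull_inc) auto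
  then show ?thesis by simp
qed

lemma hull_subset_span: "convex hull A \<subseteq> span A"
  by (intro hull_minimal span_superset subspace_imp_convex subspace_span)

lemma mem_dilateI:
  assumes "finite S" "S \<subseteq> A" "\<And>b. b \<in> S \<Longrightarrow> u b \<ge> 0" "sum u S \<le> real m"
  shows "(\<Sum>b\<in>S. u b *\<^sub>R b) \<in> dilate m"
proof (cases "m = 0")
  case True
  then have "sum u S = 0" using assms by (simp add: sum_nonneg order_antisym)
  then have "\<forall>b\<in>S. u b = 0" using assms by (subst (asm) sum_nonneg_eq_0_iff) auto
  then have "(\<Sum>b\<in>S. u b *\<^sub>R b) = 0" by simp
  with True zero_in_hull show ?thesis by (auto simp: image_iff)
next
  case False
  \<comment> \<open>The missing weight is placed on 0, which lies in the hull by symmetry and is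
    different from all elements of \<open>S\<close>.\<close>
  have "(\<Sum>b\<in>insert 0 S. (if b = 0 then 1 - sum u S / m else u b / m) *\<^sub>R b) \<in> convex hull A"
  proof (intro convex_sum[OF _ convex_convex_hull])
    have "0 \<notin> S" using assms zero_notin_A by auto
    then have "(\<Sum>b\<in>S. if b = 0 then 1 - sum u S / m else u b / m) = (\<Sum>b\<in>S. u b / m)"
      by (intro sum.cong) auto
    with \<open>0 \<notin> S\<close> show "(\<Sum>b\<in>insert 0 S. if b = 0 then 1 - sum u S / m else u b / m) = 1"
      using assms(1) by (simp add: sum_divide_distrib)
    show "b \<in> convex hull A" if "b \<in> insert 0 S" for b
      using that assms zero_in_hull by (auto intro: hull_inc)
    show "(if b = 0 then 1 - sum u S / m else u b / m) \<ge> 0" if "b \<in> insert 0 S" for b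
      using that assms False by (auto simp: field_simps)
  qed (use assms in auto)
  also have "(\<Sum>b\<in>insert 0 S. (if b = 0 then 1 - sum u S / m else u b / m) *\<^sub>R b) = (\<Sum>b\<in>S. (u b / m) *\<^sub>R b)"
    using assms zero_notin_A by (subst sum.insert) (auto intro!: sum.cong)
  finally have "(\<Sum>b\<in>S. (u b / m) *\<^sub>R b) \<in> convex hull A" .
  moreover have "(\<Sum>b\<in>S. u b *\<^sub>R b) = real m *\<^sub>R (\<Sum>b\<in>S. (u b / m) *\<^sub>R b)"
    using False by (simp add: scaleR_sum_right)
  ultimately show ?thesis by blast
qed

text \<open>The last condition on a generic cost makes \<open>F\<close> dual feasible for the cost 1
  as well: the functional that is 1 on \<open>F\<close> is at most 1 on the polytope. Within the
  cone of \<open>F\<close>, the coordinate sum thus decides membership in a dilate.\<close>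

lemma value_le_dilate:
  assumes c: "generic_cost c" and F: "F \<in> optimal_bases c" and x: "x \<in> dilate m"
  shows "basis_value (\<lambda>_. 1) F x \<le> m"
proof -
  have b: "F \<in> bases" using F by (auto simp: optimal_bases_def)
  note Fb = basesD[OF b]
  obtain p where p: "p \<in> convex hull A" "x = real m *\<^sub>R p" using x by auto
  have "A \<subseteq> {x\<in>span A. basis_value (\<lambda>_. 1) F x \<le> 1}"
    using c F b by (auto simp: generic_cost_def optimal_bases_def span_base)
  moreover have "convex {x\<in>span A. basis_value (\<lambda>_. 1) F x \<le> 1}"
    using Fb by (auto simp: convex_def basis_value_add basis_value_scale span_add span_scale
        intro: convex_bound_le)
  ultimately have "convex hull A \<subseteq> {x\<in>span A. basis_value (\<lambda>_. 1) F x \<le> 1}"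
    by (rule hull_minimal)
  then have "p \<in> span F" "basis_value (\<lambda>_. 1) F p \<le> 1" using p Fb by auto
  then show ?thesis using Fb p by (simp add: basis_value_scale mult_left_le)
qed

lemma nat_combination_in_L:
  assumes "finite S" "S \<subseteq> L"
  shows "(\<Sum>b\<in>S. real (g b) *\<^sub>R b) \<in> L"
proof -
  have n: "real n *\<^sub>R b \<in> L" if "b \<in> L" for b n
    using that by (induction n) (auto simp: zero_in_L algebra_simps intro: add_in_L)
  show ?thesis using assms
    by (induction S rule: finite_induct) (auto simp: zero_in_L intro!: add_in_L n)
qed

text \<open>The value 1 marks the removed facets, where an integral coordinate has to be at least
  1.\<close>

abbreviation lower_bound :: "'a \<Rightarrow> 'a set \<Rightarrow> 'a \<Rightarrow> nat" where
  "lower_bound v F b \<equiv> if representation F v b < 0 then 1 else 0"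

text \<open>Unimodularity makes the coordinates natural numbers, \<open>v\<close> decides which of
  them must be positive, and \<open>value_le_dilate\<close> turns the dilate into a bound on their
  sum.\<close>

lemma lattice_points_of_cone:
  assumes c: "generic_cost c" and v: "generic_direction v" and F: "F \<in> optimal_bases c"
  shows "bij_betw (\<lambda>g. \<Sum>b\<in>F. real (g b) *\<^sub>R b) (bounded_funs F (lower_bound v F) m)
    {x \<in> dilate m \<inter> L. x \<in> half_open_cone v F}"
    (is "bij_betw ?f ?B ?C")
proof -
  have b: "F \<in> bases" using F by (auto simp: optimal_bases_def)
  note Fb = basesD[OF b]
  have rep: "representation F (?f g) b = real (g b)" if "b \<in> F" for g b
    by (rule representation_unique_sum[OF Fb(2,4) refl that])
  have lex: "lexpos (real n) (representation F v b) \<longleftrightarrow> lower_bound v F b \<le> n" if "b \<in> F" for n b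
    using v b that by (auto simp: lexpos_def generic_direction_def) (metis less_linear less_numeral_extra(3))
  show ?thesis
  proof (rule bij_betw_imageI)
    show "inj_on ?f ?B"
    proof (rule inj_onI, rule ext)
      fix g h b assume "g \<in> ?B" "h \<in> ?B" "?f g = ?f h"
      then show "g b = h b" using rep[of b g] rep[of b h]
        by (cases "b \<in> F") (auto simp: bounded_funs_def)
    qed
    show "?f ` ?B = ?C"
    proof (intro subset_antisym subsetI)
      fix x assume "x \<in> ?f ` ?B"
      then obtain g where g: "g \<in> ?B" "x = ?f g" by auto
      have "x \<in> dilate m" unfolding g(2)
        using g(1) Fb by (intro mem_dilateI) (auto simp: bounded_funs_def simp flip: of_nat_sum)
      moreover have "x \<in> L" unfolding g(2)
        using Fb A_subset_L by (intro nat_combination_in_L) auto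
      moreover have "x \<in> half_open_cone v F"
      proof -
        have "x \<in> span A" unfolding g(2) using Fb
          by (intro span_sum span_scale span_base) auto
        moreover have "lexpos (representation F x b) (representation F v b)" if "b \<in> F" for b
          using g that rep[OF that] lex[OF that] by (auto simp: bounded_funs_def)
        ultimately show ?thesis by (auto simp: half_open_cone_def)
      qed
      ultimately show "x \<in> ?C" by auto
    next
      fix x assume x: "x \<in> ?C"
      then have xs: "x \<in> span A" by (auto simp: half_open_cone_def)
      define g where "g b = (if b \<in> F then nat \<lfloor>representation F x b\<rfloor> else 0)" for b
      have pos: "representation F x b \<ge> 0" if "b \<in> F" for b
        using x that by (force simp: half_open_cone_def lexpos_def)
      have g: "real (g b) = representation F x b" if "b \<in> F" for b
        using representation_Ints[OF Fb(1-3) _ xs, of b] x pos[OF that] that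
        by (auto simp: g_def Ints_def)
      have "x = ?f g" using representation_sum_span[OF Fb(2,4), of x] xs Fb(3) g by simp
      moreover have "real (sum g F) = basis_value (\<lambda>_. 1) F x"
        using g by (simp add: basis_value_def)
      then have "sum g F \<le> m" using value_le_dilate[OF c F, of x m] x by (metis (lifting) IntD1 mem_Collect_eq of_nat_le_iff)
      moreover have "lower_bound v F b \<le> g b" if "b \<in> F" for b
        using x that lex[OF that, of "g b"] g[OF that] by (auto simp: half_open_cone_def)
      moreover have "g b = 0" if "b \<notin> F" for b using that by (simp add: g_def)
      ultimately show "x \<in> ?f ` ?B" by (intro image_eqI[of _ _ g]) (auto simp: bounded_funs_def)
    qed
  qed
qed

lemma card_dilate:
  assumes c: "generic_cost c" and v: "generic_direction v"
  shows "card (dilate m \<inter> L) = (\<Sum>F\<in>optimal_bases c. card (bounded_funs F (lower_bound v F) m))"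
proof -
  let ?C = "\<lambda>F. {x \<in> dilate m \<inter> L. x \<in> half_open_cone v F}"
  have fin: "finite (optimal_bases c)" using finite_bases by (auto simp: optimal_bases_def)
  have "dilate m \<subseteq> span A" using hull_subset_span by (auto intro: span_scale)
  then have ex: "\<exists>!F. F \<in> optimal_bases c \<and> x \<in> half_open_cone v F" if "x \<in> dilate m" for x
    using unique_half_open_cone[OF c v, of x] that by auto
  have "dilate m \<inter> L = (\<Union>F\<in>optimal_bases c. ?C F)"
  proof (intro subset_antisym subsetI)
    fix x assume x: "x \<in> dilate m \<inter> L"
    then obtain F where "F \<in> optimal_bases c" "x \<in> half_open_cone v F" using ex[of x] by auto
    with x show "x \<in> (\<Union>F\<in>optimal_bases c. ?C F)" by blast
  qed blast
  then have "card (dilate m \<inter> L) = card (\<Union>F\<in>optimal_bases c. ?C F)" by (rule arg_cong)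
  also have "\<dots> = (\<Sum>F\<in>optimal_bases c. card (?C F))"
  proof (intro card_UN_disjoint ballI impI fin)
    show "finite (?C F)" if "F \<in> optimal_bases c" for F
      using lattice_points_of_cone[OF c v that, of m] finite_bounded_funs[of F "lower_bound v F" m]
        basesD(4)[of F] that
      by (auto simp: optimal_bases_def dest: bij_betw_finite)
    show "?C F \<inter> ?C G = {}" if "F \<in> optimal_bases c" "G \<in> optimal_bases c" "F \<noteq> G" for F G
      using ex that by blast
  qed
  also have "\<dots> = (\<Sum>F\<in>optimal_bases c. card (bounded_funs F (lower_bound v F) m))"
    by (intro sum.cong refl bij_betw_same_card[symmetric, OF lattice_points_of_cone[OF c v]])
  finally show ?thesis .
qed

definition numerator :: "('a \<Rightarrow> real) \<Rightarrow> 'a \<Rightarrow> int poly" where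
  "numerator c v = (\<Sum>F\<in>optimal_bases c. monom 1 (sum (lower_bound v F) F))"

lemma fps_numerator:
  assumes c: "generic_cost c" and v: "generic_direction v"
  shows "fps_of_poly (numerator c v) = Abs_fps (\<lambda>m. int (card (dilate m \<inter> L))) * (1 - fps_X) ^ (dim A + 1)"
proof -
  have "Abs_fps (\<lambda>m. int (card (dilate m \<inter> L))) =
      (\<Sum>F\<in>optimal_bases c. Abs_fps (\<lambda>m. int (card (bounded_funs F (lower_bound v F) m))))"
    by (rule fps_ext) (simp add: card_dilate[OF c v] fps_sum_nth)
  then have "Abs_fps (\<lambda>m. int (card (dilate m \<inter> L))) * (1 - fps_X) ^ (dim A + 1) =
     (\<Sum>F\<in>optimal_bases c. Abs_fps (\<lambda>m. int (card (bounded_funs F (lower_bound v F) m))) * (1 - fps_X) ^ (dim A + 1))"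
    by (simp only: sum_distrib_right)
  also have "\<dots> = (\<Sum>F\<in>optimal_bases c. fps_X ^ sum (lower_bound v F) F)"
  proof (intro sum.cong refl)
    fix F assume "F \<in> optimal_bases c"
    then have "finite F" "card F = dim A" using basesD by (auto simp: optimal_bases_def)
    then show "Abs_fps (\<lambda>m. int (card (bounded_funs F (lower_bound v F) m))) * (1 - fps_X) ^ (dim A + 1) =
        fps_X ^ sum (lower_bound v F) F"
      using fps_bounded_funs[of F "lower_bound v F"] by simp
  qed
  also have "\<dots> = fps_of_poly (numerator c v)"
    by (simp add: numerator_def fps_of_poly_sum fps_of_poly_monom')
  finally show ?thesis by simp
qed

text \<open>Reversing the generic direction exchanges the open and the closed facets of every cone.\<close>

theorem ehrhart_numerator_palindromic:
  obtains h :: "int poly" where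
    "fps_of_poly h = Abs_fps (\<lambda>m. int (card (dilate m \<inter> L))) * (1 - fps_X) ^ (dim A + 1)"
    "degree h \<le> dim A" "\<And>k. k \<le> dim A \<Longrightarrow> coeff h k = coeff h (dim A - k)"
proof -
  obtain c v where c: "generic_cost c" and v: "generic_direction v"
    using generic_cost_exists generic_direction_exists by metis
  \<comment> \<open>The series on the right of \<open>fps_numerator\<close> does not involve the
    direction.\<close>
  have eq: "numerator c (- v) = numerator c v"
    using fps_numerator[OF c v] fps_numerator[OF c generic_direction_minus[OF v]]
    by (metis fps_of_poly_eq_iff)
  have flip: "sum (lower_bound v F) F + sum (lower_bound (- v) F) F = dim A"
    if "F \<in> optimal_bases c" for F
  proof -
    have F: "F \<in> bases" using that by (auto simp: optimal_bases_def)
    note Fb = basesD[OF F]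
    have "sum (lower_bound v F) F + sum (lower_bound (- v) F) F = (\<Sum>b\<in>F. 1)"
      unfolding sum.distrib[symmetric]
    proof (intro sum.cong refl)
      fix b assume "b \<in> F"
      then show "lower_bound v F b + lower_bound (- v) F b = 1"
        using v F Fb by (auto simp: generic_direction_def real_vector.representation_neg not_less)
    qed
    with Fb show ?thesis by simp
  qed
  show thesis
  proof
    show "fps_of_poly (numerator c v) = Abs_fps (\<lambda>m. int (card (dilate m \<inter> L))) * (1 - fps_X) ^ (dim A + 1)"
      by (rule fps_numerator[OF c v])
    show "degree (numerator c v) \<le> dim A"
      unfolding numerator_def
    proof (intro degree_sum_le)
      show "finite (optimal_bases c)" using finite_bases by (auto simp: optimal_bases_def)
      show "degree (monom (1::int) (sum (lower_bound v F) F)) \<le> dim A" if "F \<in> optimal_bases c" for F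
        using flip[OF that] degree_monom_le[of "1::int" "sum (lower_bound v F) F"] by linarith
    qed
    fix k assume k: "k \<le> dim A"
    have "coeff (numerator c v) k = (\<Sum>F\<in>optimal_bases c. if sum (lower_bound v F) F = k then 1 else 0)"
      by (simp add: numerator_def coeff_sum)
    also have "\<dots> = (\<Sum>F\<in>optimal_bases c. if sum (lower_bound (- v) F) F = dim A - k then 1 else 0)"
    proof (intro sum.cong refl)
      fix F assume "F \<in> optimal_bases c"
      then have "sum (lower_bound v F) F = k \<longleftrightarrow> sum (lower_bound (- v) F) F = dim A - k"
        using flip[of F] k by arith
      then show "(if sum (lower_bound v F) F = k then 1 else 0) =
          (if sum (lower_bound (- v) F) F = dim A - k then 1 else 0)" by (simp only:)
    qed
    also have "\<dots> = coeff (numerator c (- v)) (dim A - k)"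
      by (simp add: numerator_def coeff_sum)
    finally show "coeff (numerator c v) k = coeff (numerator c v) (dim A - k)"
      by (simp add: eq)
  qed
qed

lemma dilate_0: "dilate 0 \<inter> L = {0}"
  using zero_in_hull zero_in_L by auto

text \<open>The integer decomposition property. A nonzero lattice point has a positive coordinate in
  its half-open cone; subtracting that basis element leaves a lattice point whose coordinate sum is
  smaller by one.\<close>

lemma dilate_Suc: "dilate (Suc m) \<inter> L = {a + y | a y. a \<in> insert 0 A \<and> y \<in> dilate m \<inter> L}"
proof (intro subset_antisym subsetI)
  fix x assume x: "x \<in> dilate (Suc m) \<inter> L"
  obtain c v where cv: "generic_cost c" "generic_direction v"
    using generic_cost_exists generic_direction_exists by metis
  have "x \<in> span A" using x hull_subset_span by (auto intro: span_scale)
  then obtain F where F: "F \<in> optimal_bases c" "x \<in> half_open_cone v F"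
    using unique_half_open_cone[OF cv] by blast
  then obtain g where g: "g \<in> bounded_funs F (lower_bound v F) (Suc m)" "x = (\<Sum>b\<in>F. real (g b) *\<^sub>R b)"
    using lattice_points_of_cone[OF cv F(1), of "Suc m"] x by (auto simp: bij_betw_def)
  have "F \<in> bases" using F by (auto simp: optimal_bases_def)
  note Fb = basesD[OF this]
  show "x \<in> {a + y | a y. a \<in> insert 0 A \<and> y \<in> dilate m \<inter> L}"
  proof (cases "\<exists>b\<in>F. g b > 0")
    case False
    then have "x = 0 + 0" using g by simp
    moreover have "0 \<in> dilate m" using zero_in_hull by force
    ultimately show ?thesis using zero_in_L by blast
  next
    case True
    then obtain b where b: "b \<in> F" "g b > 0" by auto
    define g' where "g' = g(b := g b - 1)"
    have g': "sum g F = sum g' F + 1"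
      using b Fb(4) sum.remove[of F b g] sum.remove[of F b g'] by (auto simp: g'_def intro!: sum.cong)
    have "x = real (g b) *\<^sub>R b + (\<Sum>x\<in>F-{b}. real (g x) *\<^sub>R x)"
      unfolding g(2) by (rule sum.remove[OF Fb(4) b(1)])
    also have "\<dots> = b + (real (g' b) *\<^sub>R b + (\<Sum>x\<in>F-{b}. real (g' x) *\<^sub>R x))"
      using b by (auto simp: g'_def of_nat_diff algebra_simps intro!: sum.cong)
    also have "real (g' b) *\<^sub>R b + (\<Sum>x\<in>F-{b}. real (g' x) *\<^sub>R x) = (\<Sum>x\<in>F. real (g' x) *\<^sub>R x)"
      by (rule sum.remove[OF Fb(4) b(1), symmetric])
    finally have "x = b + (\<Sum>x\<in>F. real (g' x) *\<^sub>R x)" .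
    moreover have "(\<Sum>x\<in>F. real (g' x) *\<^sub>R x) \<in> L"
      using Fb A_subset_L by (intro nat_combination_in_L) auto
    moreover have "(\<Sum>x\<in>F. real (g' x) *\<^sub>R x) \<in> dilate m"
      using g(1) g' Fb by (intro mem_dilateI) (auto simp: bounded_funs_def simp flip: of_nat_sum)
    ultimately show ?thesis using b Fb by blast
  qed
next
  fix x assume "x \<in> {a + y | a y. a \<in> insert 0 A \<and> y \<in> dilate m \<inter> L}"
  then obtain a p where ap: "a \<in> insert 0 A" "p \<in> convex hull A" "real m *\<^sub>R p \<in> L" "x = a + real m *\<^sub>R p"
    by auto
  then have a: "a \<in> convex hull A" "a \<in> L" using zero_in_hull zero_in_L A_subset_L by (auto intro: hull_inc)
  have "(1 / real (Suc m)) *\<^sub>R a + (real m / real (Suc m)) *\<^sub>R p \<in> convex hull A"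
    using a ap by (intro convexD[OF convex_convex_hull]) (auto simp: field_simps)
  moreover have "x = real (Suc m) *\<^sub>R ((1 / real (Suc m)) *\<^sub>R a + (real m / real (Suc m)) *\<^sub>R p)"
    unfolding ap(4) by (simp add: scaleR_right_distrib del: of_nat_Suc)
  ultimately have "x \<in> dilate (Suc m)" by (rule rev_image_eqI)
  moreover have "x \<in> L" unfolding ap(4) using a(2) ap(3) by (rule add_in_L)
  ultimately show "x \<in> dilate (Suc m) \<inter> L" by simp
qed

end

section \<open>The expansion in the basis of palindromic polynomials\<close>

definition gamma_sum :: "nat \<Rightarrow> int poly \<Rightarrow> int poly" where
  "gamma_sum d g = (\<Sum>i\<le>d div 2. smult (coeff g i) (monom 1 i * [:1, 1:] ^ (d - 2 * i)))"

lemma coeff_one_plus_X_power: "coeff ([:1, 1:] ^ n :: int poly) k = int (n choose k)"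
proof (induction n arbitrary: k)
  case 0 then show ?case by (cases k) auto
next
  case (Suc n) then show ?case by (cases k) (auto simp: coeff_pCons)
qed

lemma coeff_gamma_sum:
  "coeff (gamma_sum d g) k = (\<Sum>i\<le>d div 2. if i \<le> k then coeff g i * int ((d - 2 * i) choose (k - i)) else 0)"
  unfolding gamma_sum_def by (auto simp: coeff_sum coeff_monom_mult coeff_one_plus_X_power intro!: sum.cong)

text \<open>The i-th basis polynomial starts with t^i with coefficient 1, so the coefficients of
  \<open>g\<close> solve a unitriangular system.\<close>

lemma gamma_sum_inj:
  assumes "gamma_sum d g = gamma_sum d g'" "degree g \<le> d div 2" "degree g' \<le> d div 2"
  shows "g = g'"
proof (rule poly_eqI)
  fix k show "coeff g k = coeff g' k"
  proof (induction k rule: less_induct)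
    case (less k)
    show ?case
    proof (cases "k \<le> d div 2")
      case False
      then show ?thesis using assms by (simp add: coeff_eq_0)
    next
      case True
      have split: "coeff (gamma_sum d g) k = coeff g k + (\<Sum>i<k. coeff g i * int ((d - 2 * i) choose (k - i)))" for g
      proof -
        have "coeff (gamma_sum d g) k = (\<Sum>i\<in>{..k}. coeff g i * int ((d - 2 * i) choose (k - i)))"
          unfolding coeff_gamma_sum using True by (intro sum.mono_neutral_cong_right) auto
        also have "\<dots> = coeff g k + (\<Sum>i<k. coeff g i * int ((d - 2 * i) choose (k - i)))"
          by (simp add: lessThan_Suc_atMost[symmetric])
        finally show ?thesis .
      qed
      have "(\<Sum>i<k. coeff g i * int ((d - 2 * i) choose (k - i))) = (\<Sum>i<k. coeff g' i * int ((d - 2 * i) choose (k - i)))"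
        using less by (intro sum.cong) auto
      with assms(1) split[of g] split[of g'] show ?thesis by simp
    qed
  qed
qed

text \<open>Subtracting p(0) (1 + t)^d removes the lowest and, by symmetry, the highest coefficient.
  The remainder is t times a palindromic polynomial for \<open>d - 2\<close>.\<close>

lemma gamma_sum_exists:
  fixes p :: "int poly"
  assumes "degree p \<le> d" "\<And>k. k \<le> d \<Longrightarrow> coeff p k = coeff p (d - k)"
  shows "\<exists>g. degree g \<le> d div 2 \<and> p = gamma_sum d g"
  using assms
proof (induction d arbitrary: p rule: less_induct)
  case (less d)
  define a where "a = coeff p 0"
  have top: "coeff p d = a" using less.prems(2)[of 0] by (simp add: a_def)
  show ?case
  proof (cases "d < 2")
    case True
    have "p = gamma_sum d [:a:]"
    proof (rule poly_eqI)
      fix k show "coeff p k = coeff (gamma_sum d [:a:]) k"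
      proof (cases "k \<le> d")
        case False
        then show ?thesis using less.prems(1) True by (simp add: coeff_gamma_sum coeff_eq_0 div_less)
      next
        case k: True
        then have "k = 0 \<or> k = d" using True by linarith
        then show ?thesis using True top by (auto simp: coeff_gamma_sum a_def div_less)
      qed
    qed
    then show ?thesis by (intro exI[of _ "[:a:]"]) simp
  next
    case False
    define q where "q = p - smult a ([:1, 1:] ^ d)"
    have q: "coeff q k = coeff p k - a * int (d choose k)" for k
      by (simp add: q_def coeff_one_plus_X_power)
    have q0: "coeff q 0 = 0" "coeff q d = 0" using top by (simp_all add: q a_def)
    obtain r where qr: "q = pCons 0 r" using q0(1) by (metis coeff_pCons_0 pCons_cases)
    have r: "coeff r k = coeff p (Suc k) - a * int (d choose Suc k)" for k
      using q[of "Suc k"] by (simp add: qr)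
    have deg: "degree r \<le> d - 2"
    proof (rule degree_le, intro allI impI)
      fix i assume "d - 2 < i"
      then have "Suc i = d \<or> Suc i > d" by linarith
      then show "coeff r i = 0"
        using top less.prems(1) r[of i] by (auto simp: coeff_eq_0 binomial_eq_0)
    qed
    have sym: "coeff r k = coeff r (d - 2 - k)" if "k \<le> d - 2" for k
    proof -
      have "Suc (d - 2 - k) = d - Suc k" using that False by linarith
      moreover have "d choose Suc k = d choose (d - Suc k)"
        using that False by (intro binomial_symmetric) linarith
      moreover have "coeff p (Suc k) = coeff p (d - Suc k)"
        using that False by (intro less.prems(2)) linarith
      ultimately show ?thesis by (simp add: r)
    qed
    obtain g where g: "degree g \<le> (d - 2) div 2" "r = gamma_sum (d - 2) g"
      using less.IH[of "d - 2" r] deg sym False by auto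
    have d2: "d div 2 = Suc ((d - 2) div 2)" using False by (metis add_2_eq_Suc' add_diff_inverse_nat add.commute div2_Suc_Suc)
    have "gamma_sum d (pCons a g) = smult a ([:1, 1:] ^ d) +
        (\<Sum>i\<le>(d - 2) div 2. smult (coeff g i) (monom 1 (Suc i) * [:1, 1:] ^ (d - 2 * Suc i)))"
      unfolding gamma_sum_def d2 by (subst sum.atMost_Suc_shift) simp
    also have "(\<Sum>i\<le>(d - 2) div 2. smult (coeff g i) (monom 1 (Suc i) * [:1, 1:] ^ (d - 2 * Suc i))) = pCons 0 r"
      unfolding g(2) gamma_sum_def
    proof (rule poly_eqI)
      fix n
      show "coeff (\<Sum>i\<le>(d - 2) div 2. smult (coeff g i) (monom 1 (Suc i) * [:1, 1:] ^ (d - 2 * Suc i))) n =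
        coeff (pCons 0 (\<Sum>i\<le>(d - 2) div 2. smult (coeff g i) (monom 1 i * [:1, 1:] ^ (d - 2 - 2 * i)))) n"
        by (cases n) (simp_all add: coeff_sum coeff_monom_mult cong: if_cong)
    qed
    also have "smult a ([:1, 1:] ^ d) + pCons 0 r = p" using qr by (simp add: q_def)
    finally have "p = gamma_sum d (pCons a g)" by simp
    moreover have "degree (pCons a g) \<le> d div 2"
      using g(1) d2 degree_pCons_le[of a g] by linarith
    ultimately show ?thesis by blast
  qed
qed

text \<open>The term \<open>i = 2\<close> is present only for \<open>d \<ge> 4\<close>; for \<open>d < 4\<close> the formula still holds
  because the degree bound forces \<open>coeff g 2 = 0\<close>.\<close>

lemma coeff_2_gamma_sum:
  assumes g: "degree g \<le> d div 2" and d: "d \<ge> 2"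
  defines "h \<equiv> gamma_sum d g"
  shows "coeff g 2 = coeff h 2 - (int d - 2) * coeff h 1 + (int d * (int d - 2) - int (d choose 2)) * coeff h 0"
proof -
  obtain e where e: "d = Suc (Suc e)" using d by (metis add_2_eq_Suc le_Suc_ex)
  have "coeff h k = (\<Sum>i\<le>k. coeff g i * int ((d - 2 * i) choose (k - i)))" if "k \<le> 2" for k
  proof -
    have "coeff h k = (\<Sum>i\<le>max (d div 2) 2. if i \<le> k then coeff g i * int ((d - 2 * i) choose (k - i)) else 0)"
      unfolding h_def coeff_gamma_sum using g
      by (intro sum.mono_neutral_left) (auto simp: coeff_eq_0)
    also have "\<dots> = (\<Sum>i\<le>k. coeff g i * int ((d - 2 * i) choose (k - i)))"
      using that by (intro sum.mono_neutral_cong_right) auto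
    finally show ?thesis .
  qed
  from this[of 0] this[of 1] this[of 2] show ?thesis
    by (simp add: numeral_2_eq_2 e algebra_simps)
qed

text \<open>Discharges both definite descriptions: the series determines \<open>h\<close>, and the
  palindromic symmetry gives existence and uniqueness of the expansion.\<close>

lemma gamma_poly_eqI:
  fixes P :: "(real ^ 'n) set"
  assumes h: "fps_of_poly h = ehrhart_series P * (1 - fps_X) ^ (d + 1)"
    and d: "aff_dim P = int d" and "degree h \<le> d" "\<And>k. k \<le> d \<Longrightarrow> coeff h k = coeff h (d - k)"
  shows "degree (gamma_poly P) \<le> d div 2" "h = gamma_sum d (gamma_poly P)"
proof -
  have hs: "h_star P = h"
    unfolding h_star_def d nat_int h[symmetric] by (rule the_equality) (auto simp: fps_of_poly_eq_iff)
  have "\<exists>!g. degree g \<le> d div 2 \<and> h = gamma_sum d g"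
    using gamma_sum_exists[of h d] gamma_sum_inj assms by metis
  from theI'[OF this] show "degree (gamma_poly P) \<le> d div 2" "h = gamma_sum d (gamma_poly P)"
    unfolding gamma_poly_def d nat_int Let_def hs gamma_sum_def by auto
qed

lemma coeff_2_gamma_poly:
  fixes P :: "(real ^ 'n) set"
  assumes h: "fps_of_poly h = ehrhart_series P * (1 - fps_X) ^ (d + 1)"
    and d: "aff_dim P = int d" and "degree h \<le> d" "\<And>k. k \<le> d \<Longrightarrow> coeff h k = coeff h (d - k)" and "d \<ge> 2"
  defines "N \<equiv> fps_nth (ehrhart_series P)"
  shows "coeff (gamma_poly P) 2 = N 2 - (2 * int d - 1) * N 1 + int d + (int d - 2) * (2 * int d + 1)"
proof -
  have [simp]: "N 0 = 1" by (simp add: N_def ehrhart_series_def)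
  \<comment> \<open>The quadratic coefficients are kept doubled, here and below, to avoid division
    by 2 in the integers.\<close>
  have pw: "fps_nth ((1 - fps_X :: int fps) ^ n) 0 = 1" "fps_nth ((1 - fps_X :: int fps) ^ n) 1 = - int n"
    "2 * fps_nth ((1 - fps_X :: int fps) ^ n) 2 = int n * (int n - 1)" for n
    by (induction n) (auto simp: fps_mult_nth_0 fps_mult_nth numeral_2_eq_2 algebra_simps)
  have c: "coeff h k = fps_nth (ehrhart_series P * (1 - fps_X) ^ (d + 1)) k" for k
    using h by (metis fps_of_poly_nth)
  have h0: "coeff h 0 = 1" using pw(1)[of "d+1"] by (simp add: c fps_mult_nth N_def[symmetric])
  have h1: "coeff h 1 = N 1 - int (d + 1)"
    using pw(1,2)[of "d+1"] by (simp add: c fps_mult_nth N_def[symmetric] del: power_Suc)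
  define q where "q = fps_nth ((1 - fps_X :: int fps) ^ (d + 1))"
  have q: "q 0 = 1" "q 1 = - int (d + 1)" "2 * q 2 = int (d + 1) * int d"
    using pw[of "d+1"] by (simp_all add: q_def del: power_Suc)
  have "coeff h 2 = N 0 * q 2 + N 1 * q 1 + N 2 * q 0"
    by (simp add: c fps_mult_nth numeral_2_eq_2 N_def q_def del: power_Suc)
  then have "2 * coeff h 2 = 2 * q 2 + 2 * (N 1 * q 1) + 2 * N 2" using q(1) by simp
  then have h2: "2 * coeff h 2 = 2 * N 2 - 2 * int (d + 1) * N 1 + int (d + 1) * int d"
    unfolding q by (simp add: algebra_simps)
  have "2 * (d choose 2) = d * (d - 1)" by (cases d) (auto simp: choose_two)
  then have "2 * int (d choose 2) = int (d * (d - 1))" by (metis of_nat_mult of_nat_numeral)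
  then have ch: "2 * int (d choose 2) = int d * (int d - 1)" using \<open>d \<ge> 2\<close> by (simp add: of_nat_diff)
  have "coeff (gamma_poly P) 2 = coeff h 2 - (int d - 2) * coeff h 1 + (int d * (int d - 2) - int (d choose 2)) * coeff h 0"
    using gamma_poly_eqI[OF assms(1-4)] coeff_2_gamma_sum[OF _ \<open>d \<ge> 2\<close>, of "gamma_poly P"] by metis
  then have "2 * coeff (gamma_poly P) 2 = 2 * coeff h 2 - 2 * (int d - 2) * (N 1 - int (d + 1)) +
      (2 * (int d * (int d - 2)) - 2 * int (d choose 2))"
    unfolding h0 h1 by (simp add: algebra_simps)
  then have "2 * coeff (gamma_poly P) 2 = 2 * (N 2 - (2 * int d - 1) * N 1 + int d + (int d - 2) * (2 * int d + 1))"
    unfolding h2 ch by (simp add: algebra_simps)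
  then show ?thesis by simp
qed

section \<open>Symmetric edge polytopes\<close>

text \<open>Oriented edges. For a simple graph they are in bijection with the vectors
  \<open>edge_vecs E\<close>, so that counting over darts counts vertices of the polytope.\<close>

definition darts :: "'a set set \<Rightarrow> ('a \<times> 'a) set" where
  "darts E = {(i, j). {i, j} \<in> E}"

lemma mem_darts [simp]: "(i, j) \<in> darts E \<longleftrightarrow> {i, j} \<in> E"
  by (simp add: darts_def)

lemma simple_graphD:
  assumes "simple_graph V E"
  shows "finite V" "finite E" "{i, j} \<in> E \<Longrightarrow> i \<noteq> j" "{i, j} \<in> E \<Longrightarrow> i \<in> V \<and> j \<in> V"
proof -
  show "finite V" using assms by (simp add: simple_graph_def)
  moreover have "E \<subseteq> Pow V" using assms by (auto simp: simple_graph_def)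
  ultimately show "finite E" by (meson finite_Pow_iff finite_subset)
  show "{i, j} \<in> E \<Longrightarrow> i \<noteq> j" using assms by (auto simp: simple_graph_def)
  show "{i, j} \<in> E \<Longrightarrow> i \<in> V \<and> j \<in> V" using assms by (auto simp: simple_graph_def)
qed

lemma simple_graph_edgeE:
  assumes "simple_graph V E" "e \<in> E"
  obtains i j where "e = {i, j}" "i \<noteq> j" "i \<in> V" "j \<in> V"
  using assms by (auto simp: simple_graph_def card_2_iff)

lemma simple_graph_subset: "simple_graph V E \<Longrightarrow> E' \<subseteq> E \<Longrightarrow> simple_graph V E'"
  by (auto simp: simple_graph_def)

lemma finite_darts: "simple_graph V E \<Longrightarrow> finite (darts E)"
  by (rule finite_subset[of _ "V \<times> V"]) (auto simp: darts_def dest: simple_graphD)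

lemma sum_darts:
  fixes f :: "'a set \<Rightarrow> 'b::comm_semiring_1"
  assumes "simple_graph V E"
  shows "(\<Sum>(i, j)\<in>darts E. f {i, j}) = 2 * (\<Sum>e\<in>E. f e)"
proof -
  have "(\<Sum>(i, j)\<in>darts E. f {i, j}) = (\<Sum>e\<in>E. \<Sum>p\<in>{p\<in>darts E. (case p of (i, j) \<Rightarrow> {i, j}) = e}. case p of (i, j) \<Rightarrow> f {i, j})"
    using finite_darts[OF assms] simple_graphD(2)[OF assms]
    by (intro sum.group[symmetric]) auto
  also have "\<dots> = (\<Sum>e\<in>E. 2 * f e)"
  proof (intro sum.cong refl)
    fix e assume e: "e \<in> E"
    then obtain i j where ij: "e = {i, j}" "i \<noteq> j" by (rule simple_graph_edgeE[OF assms])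
    have "{p\<in>darts E. (case p of (i, j) \<Rightarrow> {i, j}) = e} = {(i, j), (j, i)}"
      using e ij by (auto simp: doubleton_eq_iff insert_commute)
    then show "(\<Sum>p\<in>{p\<in>darts E. (case p of (i, j) \<Rightarrow> {i, j}) = e}. case p of (i, j) \<Rightarrow> f {i, j}) = 2 * f e"
      using ij by (simp add: insert_commute mult_2)
  qed
  finally show ?thesis by (simp add: sum_distrib_left)
qed

lemma card_darts: "simple_graph V E \<Longrightarrow> card (darts E) = 2 * card E"
  using sum_darts[of V E "\<lambda>_. 1::nat"] by (simp add: case_prod_unfold)

definition edge_vec :: "'n::finite \<Rightarrow> 'n \<Rightarrow> real ^ 'n" where
  "edge_vec i j = axis i 1 - axis j 1"

definition edge_vecs :: "'n::finite set set \<Rightarrow> (real ^ 'n) set" where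
  "edge_vecs E = {edge_vec i j | i j. {i, j} \<in> E}"

lemma sym_edge_polytope_edge_vecs: "sym_edge_polytope E = convex hull (edge_vecs E)"
  by (simp add: sym_edge_polytope_def edge_vecs_def edge_vec_def)

lemma edge_vec_nth: "edge_vec i j $ k = (if k = i then 1 else 0) - (if k = j then 1 else 0)"
  by (auto simp: edge_vec_def axis_def)

lemma edge_vec_eq_iff:
  assumes "i \<noteq> j" "k \<noteq> l"
  shows "edge_vec i j = edge_vec k l \<longleftrightarrow> i = k \<and> j = l"
proof
  assume eq: "edge_vec i j = edge_vec k l"
  have "edge_vec i j $ i = edge_vec k l $ i" "edge_vec i j $ j = edge_vec k l $ j" by (simp_all add: eq)
  with assms show "i = k \<and> j = l" by (auto simp: edge_vec_nth split: if_splits)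
qed auto

lemma minus_edge_vec: "- edge_vec i j = edge_vec j i" by (simp add: edge_vec_def)

lemma edge_vec_add: "edge_vec i j + edge_vec j k = edge_vec i k" by (simp add: edge_vec_def)

lemma edge_vec_nonzero:
  assumes "i \<noteq> j"
  shows "edge_vec i j \<noteq> 0"
proof
  assume "edge_vec i j = 0"
  then have "edge_vec i j $ i = 0" by simp
  with assms show False by (simp add: edge_vec_nth)
qed

lemma edge_vecsI: "{i, j} \<in> E \<Longrightarrow> edge_vec i j \<in> edge_vecs E"
  by (auto simp: edge_vecs_def)

lemma edge_vecsE:
  assumes "a \<in> edge_vecs E" "simple_graph UNIV E"
  obtains i j where "a = edge_vec i j" "{i, j} \<in> E" "i \<noteq> j"
  using assms simple_graphD(3)[OF assms(2)] by (auto simp: edge_vecs_def)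

lemma bij_betw_edge_vecs:
  assumes "simple_graph UNIV E"
  shows "bij_betw (\<lambda>(i, j). edge_vec i j) (darts E) (edge_vecs E)"
proof (rule bij_betw_imageI)
  show "inj_on (\<lambda>(i, j). edge_vec i j) (darts E)"
    using simple_graphD(3)[OF assms] by (auto simp: inj_on_def edge_vec_eq_iff)
  show "(\<lambda>(i, j). edge_vec i j) ` darts E = edge_vecs E"
    by (force simp: edge_vecs_def)
qed

lemma finite_edge_vecs: "simple_graph UNIV E \<Longrightarrow> finite (edge_vecs E)"
  using bij_betw_edge_vecs finite_darts bij_betw_finite by metis

lemma card_edge_vecs: "simple_graph UNIV E \<Longrightarrow> card (edge_vecs E) = 2 * card E"
  using bij_betw_edge_vecs card_darts bij_betw_same_card by metis

lemma minus_edge_vecs: "a \<in> edge_vecs E \<Longrightarrow> - a \<in> edge_vecs E"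
  by (auto simp: edge_vecs_def minus_edge_vec) (metis insert_commute)

section \<open>Unimodularity of the edge vectors\<close>

definition sum_zero :: "(real ^ 'n::finite) set" where
  "sum_zero = {x. (\<Sum>i\<in>UNIV. x $ i) = 0}"

lemma sum_zero_eq: "sum_zero = {x :: real ^ 'n::finite. (\<chi> i. 1) \<bullet> x = 0}"
  by (simp add: sum_zero_def inner_vec_def)

lemma subspace_sum_zero: "subspace sum_zero"
  unfolding sum_zero_eq by (rule subspace_hyperplane)

lemma dim_sum_zero: "dim (sum_zero :: (real ^ 'n::finite) set) = CARD('n) - 1"
  unfolding sum_zero_eq by (subst dim_hyperplane) (auto simp: vec_eq_iff)

lemma edge_vec_sum_zero: "edge_vec i j \<in> sum_zero"
  by (simp add: sum_zero_def edge_vec_nth sum_subtractf)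

lemma sum_zero_edge_vecs:
  assumes "x \<in> sum_zero"
  shows "x = (\<Sum>i\<in>UNIV. x $ i *\<^sub>R edge_vec i r)"
proof -
  have "(\<Sum>i\<in>UNIV. x $ i *\<^sub>R edge_vec i r) = (\<Sum>i\<in>UNIV. x $ i *\<^sub>R axis i 1) - (\<Sum>i\<in>UNIV. x $ i) *\<^sub>R axis r 1"
    by (simp add: edge_vec_def scaleR_diff_right sum_subtractf scaleR_sum_left)
  also have "\<dots> = x" using assms
    by (simp add: sum_zero_def vec_eq_iff axis_def if_distrib cong: if_cong)
  finally show ?thesis ..
qed

lemma joined_edge_vec_induct:
  assumes "joined H u v" "P (edge_vec u u)"
    and "\<And>w w'. P (edge_vec u w) \<Longrightarrow> {w, w'} \<in> H \<Longrightarrow> P (edge_vec u w')"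
  shows "P (edge_vec u v)"
  using assms(1) unfolding joined_def
  by (induction rule: rtrancl_induct) (use assms(2,3) in auto)

lemma span_edge_vecs:
  assumes "graph_connected (UNIV :: 'n::finite set) E"
  shows "span (edge_vecs E) = sum_zero"
proof
  have "edge_vecs E \<subseteq> sum_zero" by (auto simp: edge_vecs_def edge_vec_sum_zero)
  then show "span (edge_vecs E) \<subseteq> sum_zero" using subspace_sum_zero by (rule span_minimal)
  show "sum_zero \<subseteq> span (edge_vecs E)"
  proof
    fix x :: "real ^ 'n" assume x: "x \<in> sum_zero"
    have "edge_vec r i \<in> span (edge_vecs E)" for r i
    proof (rule joined_edge_vec_induct[where P = "\<lambda>a. a \<in> span (edge_vecs E)"])
      show "joined E r i" using assms by (auto simp: graph_connected_def)
      show "edge_vec r r \<in> span (edge_vecs E)" by (simp add: edge_vec_def span_zero)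
      show "edge_vec r w' \<in> span (edge_vecs E)" if "edge_vec r w \<in> span (edge_vecs E)" "{w, w'} \<in> E" for w w'
        using span_add[OF that(1) span_base[OF edge_vecsI[OF that(2)]]] by (simp add: edge_vec_add)
    qed
    then show "x \<in> span (edge_vecs E)"
      by (subst sum_zero_edge_vecs[OF x]) (intro span_sum span_scale)
  qed
qed

text \<open>The graph of a spanning \<open>F\<close> is connected: otherwise the indicator function
  of the component of \<open>u\<close> would vanish on \<open>F\<close> but not on
  \<open>edge_vec u v\<close>. Along a path, \<open>edge_vec u v\<close> is a sum of elements of
  \<open>F\<close> and their negatives, so its coordinates are integers.\<close>

lemma representation_edge_vec_Ints:
  fixes F :: "(real ^ 'n::finite) set"
  assumes F: "F \<subseteq> range (\<lambda>(i, j). edge_vec i j)" "independent F" "span F = sum_zero"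
  shows "representation F (edge_vec u v) b \<in> \<int>"
proof -
  define H where "H = {{i, j} | i j. edge_vec i j \<in> F}"
  have "joined H u v"
  proof (rule ccontr)
    assume not: "\<not> joined H u v"
    define S where "S = {w. joined H u w}"
    have S: "i \<in> S \<longleftrightarrow> j \<in> S" if "edge_vec i j \<in> F" for i j
    proof -
      have "{i, j} \<in> H" "{j, i} \<in> H" using that by (auto simp: H_def insert_commute)
      then show ?thesis unfolding S_def joined_def by (auto intro: rtrancl_into_rtrancl)
    qed
    have "F \<subseteq> {x. (\<chi> i. if i \<in> S then 1 else 0) \<bullet> x = 0}"
    proof
      fix a assume a: "a \<in> F"
      then obtain i j where ij: "a = edge_vec i j" using F(1) by auto
      have "(\<chi> i. if i \<in> S then 1 else 0) \<bullet> edge_vec i j = (if i \<in> S then 1 else 0) - (if j \<in> S then 1 else 0)"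
        by (simp add: edge_vec_def inner_diff_right inner_axis)
      then show "a \<in> {x. (\<chi> i. if i \<in> S then 1 else 0) \<bullet> x = 0}" using S a ij by simp
    qed
    then have "span F \<subseteq> {x. (\<chi> i. if i \<in> S then 1 else 0) \<bullet> x = 0}"
      by (rule span_minimal) (rule subspace_hyperplane)
    moreover have "edge_vec u v \<in> span F" using F edge_vec_sum_zero by auto
    ultimately have "(\<chi> i. if i \<in> S then 1 else 0) \<bullet> edge_vec u v = 0" by auto
    moreover have "u \<in> S" "v \<notin> S" using not by (auto simp: S_def joined_def)
    ultimately show False by (simp add: edge_vec_def inner_diff_right inner_axis)
  qed
  then show ?thesis
  proof (rule joined_edge_vec_induct[where P = "\<lambda>a. representation F a b \<in> \<int>"])
    show "representation F (edge_vec u u) b \<in> \<int>"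
      by (simp add: edge_vec_def real_vector.representation_zero)
    fix w w' assume w: "representation F (edge_vec u w) b \<in> \<int>" "{w, w'} \<in> H"
    have sp: "edge_vec i j \<in> span F" for i j using F(3) edge_vec_sum_zero by auto
    have base: "representation F a b \<in> \<int>" if "a \<in> F" for a
      using that F(2) by (simp add: real_vector.representation_basis)
    from w(2) have "edge_vec w w' \<in> F \<or> edge_vec w' w \<in> F"
      by (auto simp: H_def doubleton_eq_iff)
    then have "representation F (edge_vec w w') b \<in> \<int>"
      using base[of "edge_vec w w'"] base[of "edge_vec w' w"] minus_edge_vec[of w' w]
        real_vector.representation_neg[OF F(2) sp, of w' w] by (auto simp: Ints_minus)
    then show "representation F (edge_vec u w') b \<in> \<int>"
      using w(1) real_vector.representation_add[OF F(2) sp sp, of u w w w'] by (simp add: edge_vec_add Ints_add)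
  qed
qed

lemma unimodular_edge_vecs:
  fixes E :: "'n::finite set set"
  assumes E: "simple_graph UNIV E" and conn: "graph_connected UNIV E" and "E \<noteq> {}"
  shows "unimodular_system (edge_vecs E) integer_lattice"
proof
  show "finite (edge_vecs E)" by (rule finite_edge_vecs[OF E])
  show "edge_vecs E \<noteq> {}" using \<open>E \<noteq> {}\<close> simple_graph_edgeE[OF E] edge_vecsI by (metis all_not_in_conv)
  show "0 \<notin> edge_vecs E" using edge_vec_nonzero by (metis edge_vecsE E)
  show "- a \<in> edge_vecs E" if "a \<in> edge_vecs E" for a using that by (rule minus_edge_vecs)
  show "edge_vecs E \<subseteq> integer_lattice" by (auto simp: edge_vecs_def integer_lattice_def edge_vec_nth)
  show "0 \<in> (integer_lattice :: (real ^ 'n) set)" by (simp add: integer_lattice_def)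
  show "x + y \<in> integer_lattice" if "x \<in> integer_lattice" "y \<in> integer_lattice" for x y :: "real ^ 'n"
    using that by (simp add: integer_lattice_def)
  fix F x b
  assume F: "F \<subseteq> edge_vecs E" "independent F" "span F = span (edge_vecs E)" and x: "x \<in> integer_lattice" "x \<in> span (edge_vecs E)"
  have sF: "span F = sum_zero" using F(3) span_edge_vecs[OF conn] by simp
  have rF: "F \<subseteq> range (\<lambda>(i, j). edge_vec i j)" using F(1) by (auto simp: edge_vecs_def)
  \<comment> \<open>An arbitrary root: an integral \<open>x\<close> is a combination of the vectors
    \<open>edge_vec i r\<close> with the integral coefficients \<open>x $ i\<close>.\<close>
  obtain r :: 'n where True by simp
  have "x = (\<Sum>i\<in>UNIV. x $ i *\<^sub>R edge_vec i r)"
    using x span_edge_vecs[OF conn] by (intro sum_zero_edge_vecs) auto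
  then have "representation F x b = (\<Sum>i\<in>UNIV. x $ i * representation F (edge_vec i r) b)"
    using F(2) sF edge_vec_sum_zero
    by (metis (no_types, lifting) real_vector.representation_scale real_vector.representation_sum span_scale sum.cong)
  also have "\<dots> \<in> \<int>"
    using x(1) representation_edge_vec_Ints[OF rF F(2) sF]
    by (intro Ints_sum Ints_mult) (auto simp: integer_lattice_def)
  finally show "representation F x b \<in> \<int>" .
qed

lemma aff_dim_sym_edge_polytope:
  fixes E :: "'n::finite set set"
  assumes E: "simple_graph UNIV E" and conn: "graph_connected UNIV E" and "E \<noteq> {}"
  shows "aff_dim (sym_edge_polytope E) = int (CARD('n) - 1)"
proof -
  interpret unimodular_system "edge_vecs E" integer_lattice by (rule unimodular_edge_vecs[OF assms])
  have "aff_dim (sym_edge_polytope E) = int (dim (convex hull (edge_vecs E)))"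
    unfolding sym_edge_polytope_edge_vecs by (intro aff_dim_zero hull_inc zero_in_hull)
  also have "dim (convex hull (edge_vecs E)) = dim (edge_vecs E)"
    using hull_subset_span hull_subset[of "edge_vecs E" convex]
    by (metis dim_span dim_subset order_antisym)
  also have "\<dots> = CARD('n) - 1"
    using span_edge_vecs[OF conn] dim_sum_zero dim_span[of "edge_vecs E"] by metis
  finally show ?thesis .
qed

section \<open>The second gamma coefficient\<close>

text \<open>By integer decomposition these are the lattice points of 2P if the graph is connected
  and has an edge.\<close>

definition two_sums :: "'n::finite set set \<Rightarrow> (real ^ 'n) set" where
  "two_sums E = {a + b | a b. a \<in> insert 0 (edge_vecs E) \<and> b \<in> insert 0 (edge_vecs E)}"

lemma coeff_2_gamma_sym_edge_polytope:
  fixes E :: "'n::finite set set"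
  assumes E: "simple_graph UNIV E" and conn: "graph_connected UNIV E" and n: "CARD('n) \<ge> 3"
  defines "d \<equiv> int CARD('n) - 1"
  shows "coeff (gamma_poly (sym_edge_polytope E)) 2 =
    int (card (two_sums E)) - (2 * d - 1) * (2 * int (card E) + 1) + d + (d - 2) * (2 * d + 1)"
proof -
  have "E \<noteq> {}"
  proof
    assume "E = {}"
    then have "u = v" for u v :: 'n using conn by (auto simp: graph_connected_def joined_def)
    then have "CARD('n) = 1" by (metis (full_types) UNIV_I UNIV_eq_I card_1_singleton_iff insertI1 One_nat_def singletonI)
    with n show False by simp
  qed
  interpret unimodular_system "edge_vecs E" integer_lattice by (rule unimodular_edge_vecs[OF E conn \<open>E \<noteq> {}\<close>])
  have ser: "ehrhart_series (sym_edge_polytope E) = Abs_fps (\<lambda>m. int (card (dilate m \<inter> integer_lattice)))"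
    unfolding ehrhart_series_def sym_edge_polytope_edge_vecs
    by (rule fps_ext) (auto simp: dilate_0 simp del: of_nat_0 of_nat_0_eq_iff)
  have dim: "dim (edge_vecs E) = CARD('n) - 1"
    using span_edge_vecs[OF conn] dim_sum_zero dim_span[of "edge_vecs E"] by metis
  have d: "int (CARD('n) - 1) = d" using n by (simp add: d_def of_nat_diff)
  obtain h :: "int poly" where h:
    "fps_of_poly h = Abs_fps (\<lambda>m. int (card (dilate m \<inter> integer_lattice))) * (1 - fps_X) ^ (dim (edge_vecs E) + 1)"
    "degree h \<le> dim (edge_vecs E)" "\<And>k. k \<le> dim (edge_vecs E) \<Longrightarrow> coeff h k = coeff h (dim (edge_vecs E) - k)"
    by (rule ehrhart_numerator_palindromic) (rule that)
  have N1: "dilate (Suc 0) \<inter> integer_lattice = insert 0 (edge_vecs E)"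
    unfolding dilate_Suc dilate_0 by (simp only: singleton_iff) auto
  then have N1': "card (dilate (Suc 0) \<inter> integer_lattice) = 2 * card E + 1"
    using finite_A zero_notin_A card_edge_vecs[OF E] by simp
  have N2: "dilate (Suc (Suc 0)) \<inter> integer_lattice = two_sums E"
    unfolding dilate_Suc[of "Suc 0"] N1 by (simp add: two_sums_def)
  have "2 \<le> CARD('n) - 1" using n by simp
  from coeff_2_gamma_poly[OF h(1)[unfolded dim, folded ser] aff_dim_sym_edge_polytope[OF E conn \<open>E \<noteq> {}\<close>] h(2,3)[unfolded dim] this]
  show ?thesis unfolding d ser by (simp only: fps_nth_Abs_fps One_nat_def numeral_2_eq_2 N1' N2) simp
qed

section \<open>Four-cycles and common neighbours in 2-connected graphs\<close>

definition nbrs :: "'a set set \<Rightarrow> 'a \<Rightarrow> 'a set" where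
  "nbrs E v = {w. {v, w} \<in> E}"

text \<open>The order of \<open>k\<close> and \<open>l\<close> is such that the cycle x, l, k, y
  allows the heads of (x, y) and (k, l) to be swapped: (x, l) and (k, y) are darts with the same
  vector sum.\<close>

definition four_cycles :: "'a set set \<Rightarrow> 'a \<Rightarrow> 'a \<Rightarrow> ('a \<times> 'a) set" where
  "four_cycles E x y = {(k, l). {x, l} \<in> E \<and> {l, k} \<in> E \<and> {k, y} \<in> E \<and> l \<noteq> y \<and> k \<noteq> x}"

lemma mem_nbrs [simp]: "w \<in> nbrs E v \<longleftrightarrow> {v, w} \<in> E"
  by (simp add: nbrs_def)

lemma nbrs_subset: "simple_graph V E \<Longrightarrow> nbrs E v \<subseteq> V"
  by (auto dest: simple_graphD(4))

lemma finite_nbrs: "simple_graph V E \<Longrightarrow> finite (nbrs E v)"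
  using nbrs_subset simple_graphD(1) finite_subset by metis

lemma joined_refl [simp]: "joined E u u"
  by (simp add: joined_def)

lemma joined_trans: "joined E u v \<Longrightarrow> joined E v w \<Longrightarrow> joined E u w"
  by (simp add: joined_def)

lemma joined_edge: "{u, v} \<in> E \<Longrightarrow> joined E u v"
  by (auto simp: joined_def)

text \<open>Edges may be contracted by \<open>f\<close>; this covers the folding of one side of a
  separation onto an end of its edge.\<close>

lemma joined_hom:
  assumes "joined E u v" "\<And>x y. {x, y} \<in> E \<Longrightarrow> f x = f y \<or> {f x, f y} \<in> E'"
  shows "joined E' (f u) (f v)"
  using assms(1) unfolding joined_def
proof (induction rule: rtrancl_induct)
  case (step y z)
  then show ?case using assms(2)[of y z] by (auto intro: rtrancl_into_rtrancl)
qed simp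

lemma joined_mono: "joined E u v \<Longrightarrow> E \<subseteq> E' \<Longrightarrow> joined E' u v"
  using joined_hom[of E u v id E'] by auto

lemma joined_sym: "joined E u v \<Longrightarrow> joined E v u"
proof -
  have "sym {(x, y). {x, y} \<in> E}" by (auto simp: sym_def insert_commute)
  then show "joined E u v \<Longrightarrow> joined E v u"
    unfolding joined_def by (metis sym_rtrancl symD)
qed

lemma joined_boundary:
  assumes "joined E u v" "u \<in> S" "v \<notin> S"
  obtains a b where "{a, b} \<in> E" "a \<in> S" "b \<notin> S"
proof -
  have "\<exists>a b. {a, b} \<in> E \<and> a \<in> S \<and> b \<notin> S"
    using assms(1,3) unfolding joined_def
    by (induction rule: rtrancl_induct) (use assms(2) in auto)
  then show thesis using that by blast
qed

section \<open>Spanning trees and deletion of vertices\<close>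

text \<open>A maximal set with a parent function has no boundary edge left, hence is everything.
  Acyclicity of the tree is expressed as injectivity: different vertices have different edges to
  their parents.\<close>

lemma spanning_tree:
  assumes W: "finite W" "r \<in> W" and F: "\<And>e. e \<in> F \<Longrightarrow> e \<subseteq> W" and conn: "\<And>w. w \<in> W \<Longrightarrow> joined F r w"
  obtains p where "\<And>v. v \<in> W - {r} \<Longrightarrow> {v, p v} \<in> F" "inj_on (\<lambda>v. {v, p v}) (W - {r})"
proof -
  define P where "P S \<longleftrightarrow> r \<in> S \<and> S \<subseteq> W \<and>
    (\<exists>p. (\<forall>v\<in>S - {r}. p v \<in> S \<and> {v, p v} \<in> F) \<and> inj_on (\<lambda>v. {v, p v}) (S - {r}))" for S
  have "S \<subseteq> W" if "P S" for S using that unfolding P_def by (elim conjE)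
  then have "{S. P S} \<subseteq> Pow W" by blast
  then have "finite {S. P S}" using W by (meson finite_Pow_iff finite_subset)
  moreover have "P {r}" unfolding P_def using W by simp
  then have "{S. P S} \<noteq> {}" by blast
  ultimately have "\<exists>S\<in>{S. P S}. \<forall>S'\<in>{S. P S}. S \<subseteq> S' \<longrightarrow> S = S'"
    by (rule finite_has_maximal)
  then obtain S where S: "P S" and max: "\<And>S'. P S' \<Longrightarrow> S \<subseteq> S' \<Longrightarrow> S = S'"
    by blast
  obtain p where p: "\<And>v. v \<in> S - {r} \<Longrightarrow> p v \<in> S \<and> {v, p v} \<in> F" "inj_on (\<lambda>v. {v, p v}) (S - {r})"
    using S unfolding P_def by blast
  have "S = W"
  proof (rule ccontr)
    assume "S \<noteq> W"
    have "r \<in> S \<and> S \<subseteq> W" using S unfolding P_def by (elim conjE) (rule conjI)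
    then have r: "r \<in> S" "S \<subseteq> W" by auto
    with \<open>S \<noteq> W\<close> obtain w where w: "w \<in> W" "w \<notin> S" by blast
    obtain a b where ab: "{a, b} \<in> F" "a \<in> S" "b \<notin> S"
      by (rule joined_boundary[OF conn[OF w(1)] r(1) w(2)])
    have "P (insert b S)" unfolding P_def
    proof (intro conjI exI[of _ "p(b := a)"] ballI)
      show "r \<in> insert b S" "insert b S \<subseteq> W" using r F[OF ab(1)] by auto
      show "(p(b := a)) v \<in> insert b S" "{v, (p(b := a)) v} \<in> F" if "v \<in> insert b S - {r}" for v
        using that p(1)[of v] ab by (auto simp: insert_commute)
      have 1: "{v, (p(b := a)) v} = {v, p v}" if "v \<in> S - {r}" for v using that ab by auto
      have "inj_on (\<lambda>v. {v, (p(b := a)) v}) (S - {r})"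
        using p(2) by (subst inj_on_cong[OF 1]) auto
      \<comment> \<open>The new edge leaves \<open>S\<close>, whereas old parents stay inside; this
        is why \<open>P\<close> demands \<open>p v \<in> S\<close>.\<close>
      moreover have "{b, a} \<noteq> {v, p v}" if "v \<in> S - {r}" for v
        using that p(1)[OF that] ab by (auto simp: doubleton_eq_iff)
      ultimately have "inj_on (\<lambda>v. {v, (p(b := a)) v}) (insert b (S - {r}))"
        using 1 ab by (subst inj_on_insert) auto
      moreover have "insert b S - {r} = insert b (S - {r})" using ab r by auto
      ultimately show "inj_on (\<lambda>v. {v, (p(b := a)) v}) (insert b S - {r})" by simp
    qed
    then have "S = insert b S" by (rule max) auto
    with ab show False by auto
  qed
  with p show thesis by (intro that[of p]) auto
qed

lemma card_edges_ge:
  assumes "finite W" "W \<noteq> {}" "finite F" "\<And>e. e \<in> F \<Longrightarrow> e \<subseteq> W" "\<And>u v. u \<in> W \<Longrightarrow> v \<in> W \<Longrightarrow> joined F u v"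
  shows "card W \<le> card F + 1"
proof -
  obtain r where r: "r \<in> W" using assms by auto
  obtain p where p: "\<And>v. v \<in> W - {r} \<Longrightarrow> {v, p v} \<in> F" "inj_on (\<lambda>v. {v, p v}) (W - {r})"
    by (rule spanning_tree[OF assms(1) r assms(4) assms(5)[OF r]]) (assumption | rule that)+
  have "card (W - {r}) \<le> card F"
    using p assms by (intro card_inj_on_le[OF p(2)]) auto
  with r assms show ?thesis by (simp add: card_Diff_singleton)
qed

text \<open>Without \<open>j\<close>, the vertex \<open>i\<close> is still joined to a third vertex.
  So all degrees are at least 2.\<close>

lemma nbrs_nonempty:
  assumes E: "simple_graph V E" "two_connected V E" and i: "i \<in> V" and j: "j \<in> V" "i \<noteq> j"
  shows "nbrs E i - {j} \<noteq> {}"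
proof -
  have "card V \<ge> 3" using E by (simp add: two_connected_def)
  then have "\<not> V \<subseteq> {i, j}" by (metis card_2_iff card_mono finite.emptyI finite_insert j(2) not_less_eq_eq numeral_2_eq_2 numeral_3_eq_3)
  then obtain w where w: "w \<in> V" "w \<noteq> i" "w \<noteq> j" by auto
  have "joined E i w" using E i w by (auto simp: two_connected_def graph_connected_def)
  then have "joined {e\<in>E. j \<notin> e} i w"
    using E i j w by (auto simp: two_connected_def cut_vertex_def)
  then obtain a b where "{a, b} \<in> {e\<in>E. j \<notin> e}" "a \<in> {i}" "b \<notin> {i}"
    by (rule joined_boundary) (use w in auto)
  then show ?thesis by auto
qed

lemma connected_delete:
  assumes "two_connected V E" "c \<in> V" "u \<in> V - {c}" "v \<in> V - {c}"
  shows "joined {e\<in>E. c \<notin> e} u v"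
  using assms by (auto simp: two_connected_def cut_vertex_def graph_connected_def)

lemma card_edges_delete:
  assumes "simple_graph V E"
  shows "card E = card {e\<in>E. i \<notin> e} + card (nbrs E i)"
proof -
  have "E = {e\<in>E. i \<notin> e} \<union> (\<lambda>w. {i, w}) ` nbrs E i"
  proof (intro subset_antisym subsetI)
    fix e assume e: "e \<in> E"
    obtain x y where "e = {x, y}" by (rule simple_graph_edgeE[OF assms e])
    with e show "e \<in> {e\<in>E. i \<notin> e} \<union> (\<lambda>w. {i, w}) ` nbrs E i"
      by (auto simp: image_iff insert_commute)
  qed auto
  moreover have "card ((\<lambda>w. {i, w}) ` nbrs E i) = card (nbrs E i)"
    by (intro card_image) (auto simp: inj_on_def doubleton_eq_iff)
  moreover have "finite E" "finite (nbrs E i)"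
    using simple_graphD(2)[OF assms] finite_nbrs[OF assms] by auto
  moreover have "{e\<in>E. i \<notin> e} \<inter> (\<lambda>w. {i, w}) ` nbrs E i = {}" by auto
  ultimately show ?thesis using card_Un_disjoint[of "{e\<in>E. i \<notin> e}" "(\<lambda>w. {i, w}) ` nbrs E i"] by auto
qed

lemma four_cycles_eq:
  assumes "simple_graph V E"
  shows "four_cycles E i j = {(k, l)\<in>darts {e\<in>E. i \<notin> e \<and> j \<notin> e}. {i, l} \<in> E \<and> {k, j} \<in> E}"
proof -
  have "{x} \<notin> E" for x using simple_graphD(3)[OF assms, of x x] by auto
  then show ?thesis by (auto simp: four_cycles_def darts_def insert_commute)
qed

lemma card_edges_avoiding:
  assumes E: "simple_graph V E" and ij: "{i, j} \<in> E"
  shows "card E + 1 = card {e\<in>E. i \<notin> e \<and> j \<notin> e} + card (nbrs E i) + card (nbrs E j)"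
proof -
  have s: "simple_graph V {e\<in>E. i \<notin> e}" using simple_graph_subset[OF E] by auto
  have neq: "i \<noteq> j" using simple_graphD(3)[OF E ij] .
  have "i \<in> nbrs E j" using ij by (simp add: insert_commute)
  then have "card (nbrs E j - {i}) + 1 = card (nbrs E j)"
    using finite_nbrs[OF E] by (metis Suc_eq_plus1 card_Suc_Diff1)
  moreover have "nbrs {e\<in>E. i \<notin> e} j = nbrs E j - {i}" using neq by auto
  moreover have "{e\<in>{e\<in>E. i \<notin> e}. j \<notin> e} = {e\<in>E. i \<notin> e \<and> j \<notin> e}" by auto
  ultimately show ?thesis
    using card_edges_delete[OF E, of i] card_edges_delete[OF s, of j] by simp
qed

text \<open>A spanning tree of the graph without \<open>i\<close> and \<open>j\<close>, rooted at a neighbour of \<open>i\<close> (at a common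
  neighbour if there is one), has for every other vertex \<open>v\<close> with parent \<open>u\<close> the darts \<open>(u, v)\<close>,
  if \<open>v\<close> is not adjacent to \<open>i\<close>, and \<open>(v, u)\<close>, if \<open>v\<close> is not adjacent to \<open>j\<close>; none of them
  is the middle of a four-cycle through \<open>{i, j}\<close>.\<close>

lemma dart_bound:
  assumes E: "simple_graph V E" "two_connected V E" and ij: "{i, j} \<in> E"
    and conn: "\<And>u v. u \<in> V - {i, j} \<Longrightarrow> v \<in> V - {i, j} \<Longrightarrow> joined {e\<in>E. i \<notin> e \<and> j \<notin> e} u v"
  shows "card (nbrs E i) + card (nbrs E j) + card (four_cycles E i j) +
     (if nbrs E i \<inter> nbrs E j = {} then 0 else 1) + 2 * card V \<le> 2 * card E + 5"
proof -
  define W where "W = V - {i, j}"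
  define F where "F = {e\<in>E. i \<notin> e \<and> j \<notin> e}"
  define A where "A = nbrs E i - {j}"
  define B where "B = nbrs E j - {i}"
  note E1 = simple_graphD[OF E(1)]
  have neq: "i \<noteq> j" "j \<noteq> i" using E1(3)[OF ij] by auto
  have no_loop: "{x} \<notin> E" for x using E1(3)[of x x] by auto
  have V: "i \<in> V" "j \<in> V" using E1(4)[OF ij] by auto
  have ji: "{j, i} \<in> E" using ij by (simp add: insert_commute)
  have finW: "finite W" using E1(1) by (simp add: W_def)
  have F: "e \<subseteq> W" if "e \<in> F" for e
    using that E(1) by (auto simp: F_def W_def simple_graph_def)
  have simpleF: "simple_graph V F" using simple_graph_subset[OF E(1)] by (auto simp: F_def)
  have AB: "A \<subseteq> W" "B \<subseteq> W" using nbrs_subset[OF E(1)] no_loop by (auto simp: A_def B_def W_def)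
  have fin: "finite A" "finite B" using AB finW finite_subset by blast+
  have "A \<noteq> {}" using nbrs_nonempty[OF E] V neq by (auto simp: A_def)
  then obtain r where r: "r \<in> A" and rB: "A \<inter> B \<noteq> {} \<Longrightarrow> r \<in> B" by blast
  have common: "nbrs E i \<inter> nbrs E j = A \<inter> B" using no_loop by (auto simp: A_def B_def)
  have rW: "r \<in> W" using r AB by auto
  have conn': "joined F r w" if "w \<in> W" for w
    using conn[of r w] that rW by (simp add: W_def F_def)
  obtain p where p: "\<And>v. v \<in> W - {r} \<Longrightarrow> {v, p v} \<in> F" "inj_on (\<lambda>v. {v, p v}) (W - {r})"
    by (rule spanning_tree[OF finW rW F conn']) (assumption | rule that)+
  define G where "G = {(k, l)\<in>darts F. \<not> (k \<in> B \<and> l \<in> A)}"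
  have finG: "finite (darts F)" by (rule finite_darts[OF simpleF])
  have cyc: "{(k, l)\<in>darts F. k \<in> B \<and> l \<in> A} = four_cycles E i j"
    unfolding four_cycles_eq[OF E(1)] by (auto simp: darts_def F_def A_def B_def insert_commute)
  have "darts F = G \<union> four_cycles E i j" "G \<inter> four_cycles E i j = {}"
    unfolding cyc[symmetric] by (auto simp: G_def)
  then have "card (darts F) = card G + card (four_cycles E i j)"
    using finG by (metis card_Un_disjoint finite_Un)
  then have cG: "2 * card F = card G + card (four_cycles E i j)"
    using card_darts[OF simpleF] by simp
  define X where "X = (\<lambda>v. (p v, v)) ` (W - {r} - A)"
  define Y where "Y = (\<lambda>v. (v, p v)) ` (W - {r} - B)"
  have "(p v, v) \<in> G" if "v \<in> W - {r} - A" for v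
    using p(1)[of v] that by (simp add: G_def insert_commute)
  then have "X \<subseteq> G" by (auto simp: X_def)
  moreover have "(v, p v) \<in> G" if "v \<in> W - {r} - B" for v
    using p(1)[of v] that by (simp add: G_def)
  then have "Y \<subseteq> G" by (auto simp: Y_def)
  \<comment> \<open>A dart in both sets would make \<open>u\<close> and \<open>v\<close> parents of
    each other, so that both have the same tree edge.\<close>
  moreover have "X \<inter> Y = {}"
  proof (rule ccontr)
    assume "X \<inter> Y \<noteq> {}"
    then obtain u v where "v \<in> W - {r} - A" "u \<in> W - {r} - B" "(p v, v) = (u, p u)"
      unfolding X_def Y_def by blast
    then have uv: "u \<in> W - {r}" "v \<in> W - {r}" "p v = u" "p u = v" by (metis DiffD1 prod.inject)+
    have "{v, p v} = {u, p u}" unfolding uv(3,4) by (rule insert_commute)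
    then have "v = u" by (rule inj_onD[OF p(2)]) (use uv in blast)+
    then have "{v} \<in> F" using p(1)[OF uv(2)] uv(3) by simp
    then show False using simple_graphD(3)[OF simpleF, of v v] by simp
  qed
  moreover have "finite G" by (rule finite_subset[OF _ finG]) (auto simp: G_def)
  ultimately have "card X + card Y \<le> card G"
    by (metis Un_least card_Un_disjoint card_mono finite_subset)
  moreover have "card X = card (W - {r} - A)" "card Y = card (W - {r} - B)"
    unfolding X_def Y_def by (rule card_image, simp add: inj_on_def)+
  moreover have "card W = card (W - {r} - A) + card A"
  proof -
    have "W - {r} - A = W - A" using r by auto
    then show ?thesis using AB finW fin by (simp add: card_Diff_subset card_mono)
  qed
  \<comment> \<open>The \<open>+ 1\<close> on the right pays for the common neighbours if
    \<open>r\<close> is in \<open>B\<close>. Otherwise it pays for \<open>r\<close> itself, and then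
    the choice of \<open>r\<close> shows that there are no common neighbours.\<close>
  moreover have "card W + (if A \<inter> B = {} then 0 else 1) \<le> card (W - {r} - B) + card B + 1"
  proof (cases "r \<in> B")
    case True
    then have "W - {r} - B = W - B" by auto
    then show ?thesis using AB finW fin by (simp add: card_Diff_subset card_mono)
  next
    case False
    then have "W - {r} - B = W - insert r B" by auto
    then have "card (W - {r} - B) = card W - (card B + 1)" "card B + 1 \<le> card W"
      using AB finW fin False rW card_mono[of W "insert r B"] by (auto simp: card_Diff_subset)
    then show ?thesis using rB False by auto
  qed
  moreover have "card W + 2 = card V"
    using V neq E1(1) card_mono[of V "{i, j}"] by (simp add: W_def card_Diff_subset)
  moreover have "card A + 1 = card (nbrs E i)" "card B + 1 = card (nbrs E j)"
    using ij ji finite_nbrs[OF E(1)] unfolding A_def B_def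
    by (metis Suc_eq_plus1 card_Suc_Diff1 mem_nbrs)+
  moreover have "card E + 1 = card F + card (nbrs E i) + card (nbrs E j)"
    unfolding F_def by (rule card_edges_avoiding[OF E(1) ij])
  ultimately show ?thesis using cG unfolding common by linarith
qed

section \<open>Degrees and four-cycles as sums over pairs of vertices\<close>

abbreviation codegree :: "'a set set \<Rightarrow> 'a \<Rightarrow> 'a \<Rightarrow> nat" where
  "codegree E x z \<equiv> card (nbrs E x \<inter> nbrs E z)"

definition offdiag :: "'a set \<Rightarrow> ('a \<times> 'a) set" where
  "offdiag V = {(x, z). x \<in> V \<and> z \<in> V \<and> x \<noteq> z}"

text \<open>A four-cycle is a pair of vertices with a pair of common neighbours, and a path of length two is
  a pair of vertices with one common neighbour. So the sum of the degrees and four-cycle counts over all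
  darts is a sum over pairs of vertices, which is easy to split along an edge separation.\<close>

definition codegree_sum :: "'a set \<Rightarrow> 'a set set \<Rightarrow> nat" where
  "codegree_sum V E = (\<Sum>(x, z)\<in>offdiag V. codegree E x z * (codegree E x z + 1))"

definition triangle_darts :: "'a set set \<Rightarrow> ('a \<times> 'a) set" where
  "triangle_darts E = {(i, j)\<in>darts E. nbrs E i \<inter> nbrs E j \<noteq> {}}"

lemma mem_offdiag [simp]: "(x, z) \<in> offdiag V \<longleftrightarrow> x \<in> V \<and> z \<in> V \<and> x \<noteq> z"
  by (simp add: offdiag_def)

lemma finite_offdiag: "finite V \<Longrightarrow> finite (offdiag V)"
  by (rule finite_subset[of _ "V \<times> V"]) auto

lemma card_offdiag: "finite S \<Longrightarrow> card (offdiag S) = card S * (card S - 1)"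
proof -
  assume S: "finite S"
  have "offdiag S = S \<times> S - (\<lambda>x. (x, x)) ` S" by auto
  moreover have "card ((\<lambda>x. (x, x)) ` S) = card S" by (rule card_image) (auto simp: inj_on_def)
  moreover have "card (S \<times> S - (\<lambda>x. (x, x)) ` S) = card (S \<times> S) - card ((\<lambda>x. (x, x)) ` S)"
    using S by (intro card_Diff_subset) auto
  ultimately show ?thesis by (simp add: card_cartesian_product diff_mult_distrib2)
qed

lemma card_fibers:
  assumes "finite S" "finite P" "f ` S \<subseteq> P"
  shows "card S = (\<Sum>p\<in>P. card {s\<in>S. f s = p})"
  using sum.group[OF assms, of "\<lambda>_. 1::nat"] by simp

text \<open>Both sides count the paths x, y, z, by their first dart and by their ends.\<close>

lemma sum_codegree:
  assumes E: "simple_graph V E"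
  shows "(\<Sum>(x, y)\<in>darts E. card (nbrs E y) - 1) = (\<Sum>(x, z)\<in>offdiag V. codegree E x z)"
proof -
  define S where "S = {(x, y, z). {x, y} \<in> E \<and> {y, z} \<in> E \<and> x \<noteq> z}"
  note ED = simple_graphD[OF E]
  have fin: "finite S" by (rule finite_subset[of _ "V \<times> V \<times> V"]) (use ED in \<open>auto simp: S_def\<close>)
  have "card S = (\<Sum>p\<in>darts E. card {s\<in>S. (\<lambda>(x, y, z). (x, y)) s = p})"
    by (rule card_fibers[OF fin finite_darts[OF E]]) (auto simp: S_def)
  also have "\<dots> = (\<Sum>(x, y)\<in>darts E. card (nbrs E y) - 1)"
  proof (intro sum.cong refl, clarify)
    fix x y assume xy: "(x, y) \<in> darts E"
    let ?T = "{s\<in>S. (\<lambda>(x, y, z). (x, y)) s = (x, y)}"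
    have "?T = (\<lambda>z. (x, y, z)) ` (nbrs E y - {x})"
      using xy by (auto simp: S_def)
    then have "card ?T = card (nbrs E y - {x})"
      by (simp add: card_image inj_on_def)
    also have "\<dots> = card (nbrs E y) - 1"
      using xy by (intro card_Diff_singleton) (auto simp: insert_commute)
    finally show "card ?T = card (nbrs E y) - 1" .
  qed
  finally have 1: "card S = \<dots>" .
  have "card S = (\<Sum>p\<in>offdiag V. card {s\<in>S. (\<lambda>(x, y, z). (x, z)) s = p})"
    by (rule card_fibers[OF fin finite_offdiag]) (use ED in \<open>auto simp: S_def\<close>)
  also have "\<dots> = (\<Sum>(x, z)\<in>offdiag V. codegree E x z)"
  proof (intro sum.cong refl, clarify)
    fix x z assume xz: "(x, z) \<in> offdiag V"
    let ?T = "{s\<in>S. (\<lambda>(x, y, z). (x, z)) s = (x, z)}"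
    have "?T = (\<lambda>y. (x, y, z)) ` (nbrs E x \<inter> nbrs E z)"
      using xz by (auto simp: S_def insert_commute)
    then show "card ?T = codegree E x z"
      by (simp add: card_image inj_on_def)
  qed
  finally show ?thesis using 1 by simp
qed

text \<open>Both sides count the closed walks x, y, z, w around four-cycles, by their first dart and
  by the diagonal (x, z), for which (y, w) is an ordered pair of common neighbours.\<close>

lemma sum_four_cycles:
  assumes E: "simple_graph V E"
  shows "(\<Sum>(x, y)\<in>darts E. card (four_cycles E x y)) = (\<Sum>(x, z)\<in>offdiag V. codegree E x z * (codegree E x z - 1))"
proof -
  define S where "S = {(x, y, z, w). {x, y} \<in> E \<and> {y, z} \<in> E \<and> {z, w} \<in> E \<and> {w, x} \<in> E \<and> x \<noteq> z \<and> y \<noteq> w}"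
  note ED = simple_graphD[OF E]
  have fin: "finite S" by (rule finite_subset[of _ "V \<times> V \<times> V \<times> V"]) (use ED in \<open>auto simp: S_def\<close>)
  have "card S = (\<Sum>p\<in>darts E. card {s\<in>S. (\<lambda>(x, y, z, w). (x, y)) s = p})"
    by (rule card_fibers[OF fin finite_darts[OF E]]) (auto simp: S_def)
  also have "\<dots> = (\<Sum>(x, y)\<in>darts E. card (four_cycles E x y))"
  proof (intro sum.cong refl, clarify)
    fix x y assume xy: "(x, y) \<in> darts E"
    let ?T = "{s\<in>S. (\<lambda>(x, y, z, w). (x, y)) s = (x, y)}"
    have "?T = (\<lambda>(z, w). (x, y, z, w)) ` four_cycles E x y"
      using xy by (auto simp: S_def four_cycles_def insert_commute)
    then show "card ?T = card (four_cycles E x y)"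
      by (simp only:) (rule card_image, auto simp: inj_on_def)
  qed
  finally have 1: "card S = \<dots>" .
  have "card S = (\<Sum>p\<in>offdiag V. card {s\<in>S. (\<lambda>(x, y, z, w). (x, z)) s = p})"
    by (rule card_fibers[OF fin finite_offdiag]) (use ED in \<open>auto simp: S_def\<close>)
  also have "\<dots> = (\<Sum>(x, z)\<in>offdiag V. codegree E x z * (codegree E x z - 1))"
  proof (intro sum.cong refl, clarify)
    fix x z assume xz: "(x, z) \<in> offdiag V"
    let ?T = "{s\<in>S. (\<lambda>(x, y, z, w). (x, z)) s = (x, z)}"
    have "?T = (\<lambda>(y, w). (x, y, z, w)) ` offdiag (nbrs E x \<inter> nbrs E z)"
      using xz by (auto simp: S_def insert_commute image_iff)
    then have "card ?T = card (offdiag (nbrs E x \<inter> nbrs E z))"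
      by (simp only:) (rule card_image, auto simp: inj_on_def)
    then show "card ?T = codegree E x z * (codegree E x z - 1)"
      using finite_nbrs[OF E] by (simp add: card_offdiag)
  qed
  finally show ?thesis using 1 by simp
qed

lemma sum_darts_swap: "(\<Sum>(x, y)\<in>darts E. f x y) = (\<Sum>(x, y)\<in>darts E. f y x)"
  by (rule sum.reindex_bij_witness[of _ prod.swap prod.swap]) (auto simp: insert_commute)

text \<open>With c common neighbours, c (c + 1) = c (c - 1) + 2 c: the four-cycles plus the two
  degree sums. The term \<open>4 * card E\<close> is due to the walks x, y, x, which pairs of
  different vertices miss.\<close>

lemma sum_degrees_four_cycles:
  assumes E: "simple_graph V E"
  shows "(\<Sum>(x, y)\<in>darts E. card (nbrs E x) + card (nbrs E y) + card (four_cycles E x y)) =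
    codegree_sum V E + 4 * card E"
proof -
  have "(\<Sum>(x, y)\<in>darts E. card (nbrs E y)) = (\<Sum>(x, y)\<in>darts E. (card (nbrs E y) - 1) + 1)"
  proof (intro sum.cong refl, clarify)
    fix x y assume "(x, y) \<in> darts E"
    then have "x \<in> nbrs E y" by (simp add: insert_commute)
    then have "card (nbrs E y) > 0" using finite_nbrs[OF E] by (auto simp: card_gt_0_iff)
    then show "card (nbrs E y) = card (nbrs E y) - 1 + 1" by simp
  qed
  also have "\<dots> = (\<Sum>(x, z)\<in>offdiag V. codegree E x z) + 2 * card E"
    using sum_codegree[OF E] card_darts[OF E] by (simp only: sum.distrib case_prod_unfold) simp
  finally have deg: "(\<Sum>(x, y)\<in>darts E. card (nbrs E y)) = \<dots>" .
  have "c * (c + 1) = c * (c - 1) + 2 * c" for c :: nat by (cases c) auto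
  then have "codegree_sum V E = (\<Sum>(x, z)\<in>offdiag V. codegree E x z * (codegree E x z - 1) + 2 * codegree E x z)"
    by (simp only: codegree_sum_def)
  also have "\<dots> = (\<Sum>(x, z)\<in>offdiag V. codegree E x z * (codegree E x z - 1)) + 2 * (\<Sum>(x, z)\<in>offdiag V. codegree E x z)"
    by (simp only: case_prod_unfold sum.distrib sum_distrib_left)
  finally have "codegree_sum V E = \<dots>" .
  then show ?thesis
    using deg sum_four_cycles[OF E] sum_darts_swap[of "\<lambda>x y. card (nbrs E x)" E]
    by (simp add: case_prod_unfold sum.distrib)
qed

section \<open>Separation along an edge\<close>

text \<open>If \<open>V - {i, j}\<close> is disconnected, \<open>dart_bound\<close> may fail at \<open>{i, j}\<close>, for instance if several
  four-cycles share this edge; only the sum over all darts satisfies the bound.\<close>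

locale edge_separation =
  fixes V :: "'a set" and E :: "'a set set" and i j :: 'a and W1 W2 :: "'a set"
  assumes simple: "simple_graph V E" and two_conn: "two_connected V E" and ij: "{i, j} \<in> E"
    and V_eq: "V = insert i (insert j (W1 \<union> W2))" and ends: "i \<notin> W1 \<union> W2" "j \<notin> W1 \<union> W2"
    and disjoint: "W1 \<inter> W2 = {}" and no_edge: "x \<in> W1 \<Longrightarrow> y \<in> W2 \<Longrightarrow> {x, y} \<notin> E"
    and nonempty: "W1 \<noteq> {}" "W2 \<noteq> {}"
begin

definition "V1 = insert i (insert j W1)"
definition "V2 = insert i (insert j W2)"
definition "E1 = {e\<in>E. e \<subseteq> V1}"
definition "E2 = {e\<in>E. e \<subseteq> V2}"

lemma no_loop: "{x} \<notin> E"
  using simple_graphD(3)[OF simple, of x x] by auto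

lemma i_neq_j: "i \<noteq> j" using ij no_loop by auto

lemma ji: "{j, i} \<in> E" using ij by (simp add: insert_commute)

lemma swap: "edge_separation V E i j W2 W1"
proof -
  have "{x, y} \<notin> E" if "x \<in> W2" "y \<in> W1" for x y
    using no_edge[OF that(2,1)] by (simp add: insert_commute)
  then show ?thesis
    using simple two_conn ij V_eq ends disjoint nonempty
    by unfold_locales auto
qed

lemma swap_ends: "edge_separation V E j i W1 W2"
  using simple two_conn ji V_eq ends disjoint no_edge nonempty
  by unfold_locales auto

lemma finite_sets: "finite V" "finite E" "finite W1" "finite W2" "finite V1" "finite V2" "finite E1" "finite E2"
  using simple_graphD[OF simple] V_eq by (auto simp: V1_def V2_def E1_def E2_def)

lemma simple1: "simple_graph V1 E1"
  using simple finite_sets by (auto simp: simple_graph_def E1_def)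

lemma edge_cases:
  assumes "{x, y} \<in> E"
  shows "{x, y} \<in> E1 \<or> {x, y} \<in> E2"
  using simple_graphD(4)[OF simple assms] no_edge[of x y] no_edge[of y x] assms
  by (auto simp: E1_def E2_def V_eq V1_def V2_def insert_commute)

lemma E_eq: "E = E1 \<union> E2"
proof (intro subset_antisym subsetI)
  fix e assume e: "e \<in> E"
  obtain x y where "e = {x, y}" by (rule simple_graph_edgeE[OF simple e])
  with e edge_cases show "e \<in> E1 \<union> E2" by auto
qed (auto simp: E1_def E2_def)

lemma E_int: "E1 \<inter> E2 = {{i, j}}"
proof (intro subset_antisym subsetI)
  fix e assume e: "e \<in> E1 \<inter> E2"
  then have "e \<in> E" "e \<subseteq> {i, j}" using disjoint ends by (auto simp: E1_def E2_def V1_def V2_def)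
  moreover obtain x y where "e = {x, y}" "x \<noteq> y" by (rule simple_graph_edgeE[OF simple \<open>e \<in> E\<close>])
  ultimately show "e \<in> {{i, j}}" by auto
qed (auto simp: E1_def E2_def V1_def V2_def ij)

lemma card_E: "card E + 1 = card E1 + card E2"
  using card_Un_Int[of E1 E2] finite_sets E_eq E_int by simp

lemma card_V1: "card V1 = card W1 + 2"
  using finite_sets ends i_neq_j by (simp add: V1_def)

lemma card_V: "card V + 2 = card V1 + card V2"
proof -
  have "card V = card W1 + card W2 + 2"
    using finite_sets ends i_neq_j disjoint by (simp add: V_eq card_Un_disjoint)
  then show ?thesis using finite_sets ends i_neq_j by (simp add: V1_def V2_def)
qed

text \<open>Folding \<open>W2\<close> onto \<open>i\<close> sends every edge to a point or to an
  edge of \<open>E1\<close>: the only neighbours of \<open>W2\<close> outside it are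
  \<open>i\<close> and \<open>j\<close>, and \<open>{i, j}\<close> is an edge. The folding needs
  \<open>i\<close> to survive; for \<open>c = i\<close> one folds onto \<open>j\<close>.\<close>

lemma joined_retract:
  assumes "joined {e\<in>E. c \<notin> e} u v" "c \<noteq> i" "u \<in> V1" "v \<in> V1"
  shows "joined {e\<in>E1. c \<notin> e} u v"
proof -
  define f where "f x = (if x \<in> V1 then x else i)" for x
  have "joined {e\<in>E1. c \<notin> e} (f u) (f v)"
  proof (rule joined_hom[OF assms(1)])
    fix x y assume xy: "{x, y} \<in> {e\<in>E. c \<notin> e}"
    then have E: "{x, y} \<in> E" "{y, x} \<in> E" "x \<noteq> c" "y \<noteq> c" "x \<in> V" "y \<in> V"
      using simple_graphD(4)[OF simple, of x y] by (auto simp: insert_commute)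
    show "f x = f y \<or> {f x, f y} \<in> {e\<in>E1. c \<notin> e}"
      using E no_edge[of x y] no_edge[of y x] ij ji assms(2)
      by (auto simp: f_def E1_def V1_def V_eq insert_commute)
  qed
  then show ?thesis using assms(3,4) by (simp add: f_def)
qed

lemma joined_retract':
  assumes "joined {e\<in>E. c \<notin> e} u v" "u \<in> V1" "v \<in> V1"
  shows "joined {e\<in>E1. c \<notin> e} u v"
proof (cases "c = i")
  case True
  interpret s: edge_separation V E j i W1 W2 by (rule swap_ends)
  have "s.V1 = V1" "s.E1 = E1" by (auto simp: s.V1_def V1_def s.E1_def E1_def)
  with s.joined_retract[OF assms(1)] True i_neq_j assms show ?thesis by auto
qed (use joined_retract assms in auto)

lemma two_connected1: "two_connected V1 E1"
  unfolding two_connected_def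
proof (intro conjI notI)
  show "card V1 \<ge> 3" using card_V1 nonempty finite_sets by (cases "card W1") auto
  have del: "joined {e\<in>E1. c \<notin> e} u v" if "c \<in> V1" "u \<in> V1 - {c}" "v \<in> V1 - {c}" for c u v
    using that connected_delete[OF two_conn, of c u v] by (intro joined_retract') (auto simp: V1_def V_eq)
  show "graph_connected V1 E1"
    unfolding graph_connected_def
  proof (intro conjI ballI)
    show "V1 \<noteq> {}" by (simp add: V1_def)
    fix u v assume uv: "u \<in> V1" "v \<in> V1"
    \<comment> \<open>With at least three vertices there is a \<open>c\<close> to delete, so
      connectedness follows from connectedness after deletion.\<close>
    have "\<not> V1 \<subseteq> {u, v}"
      using \<open>card V1 \<ge> 3\<close> card_mono[of "{u, v}" V1] card_insert_le_m1[of 2 "{v}" u] by auto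
    then obtain c where c: "c \<in> V1" "c \<noteq> u" "c \<noteq> v" by auto
    have "joined {e\<in>E1. c \<notin> e} u v" using c uv by (intro del) auto
    then show "joined E1 u v" by (rule joined_mono) auto
  qed
  assume "\<exists>c. cut_vertex V1 E1 c"
  then show False using del unfolding cut_vertex_def by blast
qed

lemma codegree_E1:
  assumes "x \<in> W1" "z \<in> V1"
  shows "nbrs E x \<inter> nbrs E z = nbrs E1 x \<inter> nbrs E1 z"
proof (intro subset_antisym subsetI)
  fix w assume w: "w \<in> nbrs E x \<inter> nbrs E z"
  then have "w \<in> V1" using simple_graphD(4)[OF simple, of x w] no_edge[OF assms(1), of w] by (auto simp: V1_def V_eq)
  with w assms show "w \<in> nbrs E1 x \<inter> nbrs E1 z" by (auto simp: E1_def V1_def)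
qed (auto simp: E1_def)

lemma edge_ij: "{i, j} \<in> E1" "{i, j} \<in> E2" using E_int by auto

lemma common_ij: "nbrs E i \<inter> nbrs E j = (nbrs E1 i \<inter> nbrs E1 j) \<union> (nbrs E2 i \<inter> nbrs E2 j)"
  and common_ij_disjoint: "(nbrs E1 i \<inter> nbrs E1 j) \<inter> (nbrs E2 i \<inter> nbrs E2 j) = {}"
proof -
  have no: "i \<notin> nbrs E i" "j \<notin> nbrs E j" using no_loop by auto
  show "nbrs E i \<inter> nbrs E j = (nbrs E1 i \<inter> nbrs E1 j) \<union> (nbrs E2 i \<inter> nbrs E2 j)"
  proof (intro subset_antisym subsetI)
    fix w assume w: "w \<in> nbrs E i \<inter> nbrs E j"
    then have "w \<in> W1 \<or> w \<in> W2" using no simple_graphD(4)[OF simple, of i w] by (auto simp: V_eq)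
    with w show "w \<in> (nbrs E1 i \<inter> nbrs E1 j) \<union> (nbrs E2 i \<inter> nbrs E2 j)"
      by (auto simp: E1_def E2_def V1_def V2_def)
  qed (auto simp: E1_def E2_def)
  show "(nbrs E1 i \<inter> nbrs E1 j) \<inter> (nbrs E2 i \<inter> nbrs E2 j) = {}"
    using no disjoint by (auto simp: E1_def E2_def V1_def V2_def)
qed

text \<open>Only \<open>i\<close> and \<open>j\<close> can be common neighbours across the
  separation. If \<alpha> and \<beta> indicate whether they are, then c = \<alpha> + \<beta> and c
  (c + 1) = 2 \<alpha> + 2 \<beta> + 2 \<alpha> \<beta>.\<close>

lemma codegree_cross:
  assumes "x \<in> W1" "z \<in> W2"
  shows "codegree E x z * (codegree E x z + 1) =
    2 * of_bool (x \<in> nbrs E1 i \<and> z \<in> nbrs E2 i) + 2 * of_bool (x \<in> nbrs E1 j \<and> z \<in> nbrs E2 j) +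
    2 * of_bool (x \<in> nbrs E1 i \<inter> nbrs E1 j \<and> z \<in> nbrs E2 i \<inter> nbrs E2 j)"
proof -
  have iff: "x \<in> nbrs E1 i \<longleftrightarrow> {x, i} \<in> E" "z \<in> nbrs E2 i \<longleftrightarrow> {z, i} \<in> E"
    "x \<in> nbrs E1 j \<longleftrightarrow> {x, j} \<in> E" "z \<in> nbrs E2 j \<longleftrightarrow> {z, j} \<in> E"
    using assms by (auto simp: E1_def E2_def V1_def V2_def insert_commute)
  have "nbrs E x \<inter> nbrs E z \<subseteq> {i, j}"
    using no_edge assms simple_graphD(4)[OF simple] disjoint
    by (auto simp: V_eq) (metis insert_commute)+
  then have "nbrs E x \<inter> nbrs E z =
      (if {x, i} \<in> E \<and> {z, i} \<in> E then {i} else {}) \<union> (if {x, j} \<in> E \<and> {z, j} \<in> E then {j} else {})"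
    by auto
  then show ?thesis unfolding Int_iff iff using i_neq_j by auto
qed

end

context edge_separation
begin

lemma swap_simps:
  "edge_separation.V1 i j W2 = V2" "edge_separation.E1 E i j W2 = E2"
  "edge_separation.V2 i j W1 = V1" "edge_separation.E2 E i j W1 = E1"
proof -
  interpret s: edge_separation V E i j W2 W1 by (rule swap)
  show "s.V1 = V2" "s.E1 = E2" "s.V2 = V1" "s.E2 = E1"
    by (simp_all add: s.V1_def V2_def s.E1_def E2_def s.V2_def V1_def s.E2_def E1_def)
qed

abbreviation "A1 \<equiv> nbrs E1 i - {j}"
abbreviation "A2 \<equiv> nbrs E2 i - {j}"
abbreviation "B1 \<equiv> nbrs E1 j - {i}"
abbreviation "B2 \<equiv> nbrs E2 j - {i}"
abbreviation "C1 \<equiv> nbrs E1 i \<inter> nbrs E1 j"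
abbreviation "C2 \<equiv> nbrs E2 i \<inter> nbrs E2 j"

lemma nbrs_W1: "A1 \<subseteq> W1" "B1 \<subseteq> W1"
  using no_loop by (auto simp: E1_def V1_def)

text \<open>The ends \<open>i\<close> and \<open>j\<close> are set apart because only this pair may
  have common neighbours on both sides.\<close>

lemma sum_part:
  "(\<Sum>(x, z)\<in>offdiag V1 - {(i, j), (j, i)}. codegree E x z * (codegree E x z + 1)) + 2 * (codegree E1 i j * (codegree E1 i j + 1))
    = codegree_sum V1 E1"
proof -
  have ij1: "{(i, j), (j, i)} \<subseteq> offdiag V1" using i_neq_j by (auto simp: V1_def)
  have "(\<Sum>(x, z)\<in>offdiag V1 - {(i, j), (j, i)}. codegree E x z * (codegree E x z + 1)) =
      (\<Sum>(x, z)\<in>offdiag V1 - {(i, j), (j, i)}. codegree E1 x z * (codegree E1 x z + 1))"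
  proof (rule sum.cong[OF refl], unfold split_paired_all prod.case)
    fix x z assume "(x, z) \<in> offdiag V1 - {(i, j), (j, i)}"
    then have "x \<in> W1 \<and> z \<in> V1 \<or> z \<in> W1 \<and> x \<in> V1" by (auto simp: V1_def)
    then have "nbrs E x \<inter> nbrs E z = nbrs E1 x \<inter> nbrs E1 z"
      using codegree_E1[of x z] codegree_E1[of z x] by (auto simp: Int_commute)
    then show "codegree E x z * (codegree E x z + 1) = codegree E1 x z * (codegree E1 x z + 1)" by simp
  qed
  moreover have "codegree_sum V1 E1 =
    (\<Sum>(x, z)\<in>offdiag V1 - {(i, j), (j, i)}. codegree E1 x z * (codegree E1 x z + 1)) +
    (\<Sum>(x, z)\<in>{(i, j), (j, i)}. codegree E1 x z * (codegree E1 x z + 1))"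
    unfolding codegree_sum_def by (rule sum.subset_diff[OF ij1 finite_offdiag[OF finite_sets(5)]])
  moreover have "(\<Sum>(x, z)\<in>{(i, j), (j, i)}. codegree E1 x z * (codegree E1 x z + 1)) = 2 * (codegree E1 i j * (codegree E1 i j + 1))"
    using i_neq_j by (simp add: Int_commute)
  ultimately show ?thesis by simp
qed

lemma sum_cross:
  "(\<Sum>(x, z)\<in>W1 \<times> W2. codegree E x z * (codegree E x z + 1)) =
    2 * (card (A1) * card (A2)) + 2 * (card (B1) * card (B2))
     + 2 * (codegree E1 i j * codegree E2 i j)"
proof -
  interpret s: edge_separation V E i j W2 W1 by (rule swap)
  note sub = nbrs_W1 s.nbrs_W1[unfolded swap_simps]
  have count: "(\<Sum>(x, z)\<in>W1 \<times> W2. of_bool (x \<in> A \<and> z \<in> B)) = card A * card B"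
    if "A \<subseteq> W1" "B \<subseteq> W2" for A B
  proof -
    have "(\<Sum>(x, z)\<in>W1 \<times> W2. of_bool (x \<in> A \<and> z \<in> B)) = (\<Sum>p\<in>A \<times> B. 1::nat)"
      using that finite_sets by (intro sum.mono_neutral_cong_right) auto
    then show ?thesis by (simp add: card_cartesian_product)
  qed
  have "(\<Sum>(x, z)\<in>W1 \<times> W2. codegree E x z * (codegree E x z + 1)) =
    (\<Sum>(x, z)\<in>W1 \<times> W2. 2 * of_bool (x \<in> A1 \<and> z \<in> A2) +
      2 * of_bool (x \<in> B1 \<and> z \<in> B2) +
      2 * of_bool (x \<in> C1 \<and> z \<in> C2))"
  proof (intro sum.cong refl, clarify)
    fix x z assume xz: "x \<in> W1" "z \<in> W2"
    then have "x \<noteq> i" "x \<noteq> j" "z \<noteq> i" "z \<noteq> j" using ends by auto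
    then show "codegree E x z * (codegree E x z + 1) =
      2 * of_bool (x \<in> A1 \<and> z \<in> A2) +
      2 * of_bool (x \<in> B1 \<and> z \<in> B2) +
      2 * of_bool (x \<in> C1 \<and> z \<in> C2)"
      unfolding codegree_cross[OF xz] by simp
  qed
  also have "\<dots> = 2 * (\<Sum>(x, z)\<in>W1 \<times> W2. of_bool (x \<in> A1 \<and> z \<in> A2)) +
      2 * (\<Sum>(x, z)\<in>W1 \<times> W2. of_bool (x \<in> B1 \<and> z \<in> B2)) +
      2 * (\<Sum>(x, z)\<in>W1 \<times> W2. of_bool (x \<in> C1 \<and> z \<in> C2))"
    by (simp only: case_prod_unfold sum.distrib sum_distrib_left)
  also have "(\<Sum>(x, z)\<in>W1 \<times> W2. of_bool (x \<in> A1 \<and> z \<in> A2)) =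
      card (A1) * card (A2)" by (rule count) (rule sub)+
  also have "(\<Sum>(x, z)\<in>W1 \<times> W2. of_bool (x \<in> B1 \<and> z \<in> B2)) =
      card (B1) * card (B2)" by (rule count) (rule sub)+
  also have "(\<Sum>(x, z)\<in>W1 \<times> W2. of_bool (x \<in> C1 \<and> z \<in> C2)) =
      codegree E1 i j * codegree E2 i j"
    using sub no_loop by (intro count) (auto simp: E1_def E2_def)
  finally show ?thesis .
qed

text \<open>Half of the term \<open>8 * (codegree E1 i j * codegree E2 i j)\<close> comes from the
  two ordered pairs of ends, at which the codegrees of the sides add up; the other half comes from
  the pairs across the separation in both orders.\<close>

lemma codegree_sum_split:
  "codegree_sum V E = codegree_sum V1 E1 + codegree_sum V2 E2 + 8 * (codegree E1 i j * codegree E2 i j) +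
     4 * (card (A1) * card (A2)) + 4 * (card (B1) * card (B2))"
proof -
  interpret s: edge_separation V E i j W2 W1 by (rule swap)
  let ?f = "\<lambda>(x, z). codegree E x z * (codegree E x z + 1)"
  let ?P = "{(i, j), (j, i)}"
  have "offdiag V = (((offdiag V1 - ?P) \<union> (offdiag V2 - ?P)) \<union> ?P) \<union> (W1 \<times> W2 \<union> W2 \<times> W1)"
    using i_neq_j disjoint ends by (auto simp: V_eq V1_def V2_def)
  then have "codegree_sum V E = sum ?f ((((offdiag V1 - ?P) \<union> (offdiag V2 - ?P)) \<union> ?P) \<union> (W1 \<times> W2 \<union> W2 \<times> W1))"
    by (simp only: codegree_sum_def)
  also have "\<dots> = sum ?f (((offdiag V1 - ?P) \<union> (offdiag V2 - ?P)) \<union> ?P) + sum ?f (W1 \<times> W2 \<union> W2 \<times> W1)"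
  proof (rule sum.union_disjoint)
    have "x \<in> V1 \<and> z \<in> V1 \<or> x \<in> V2 \<and> z \<in> V2" if "(x, z) \<in> ((offdiag V1 - ?P) \<union> (offdiag V2 - ?P)) \<union> ?P" for x z
      using that by (auto simp: V1_def V2_def)
    moreover have "\<not> (x \<in> V1 \<and> z \<in> V1 \<or> x \<in> V2 \<and> z \<in> V2)" if "(x, z) \<in> W1 \<times> W2 \<union> W2 \<times> W1" for x z
      using that ends disjoint by (auto simp: V1_def V2_def)
    ultimately show "(((offdiag V1 - ?P) \<union> (offdiag V2 - ?P)) \<union> ?P) \<inter> (W1 \<times> W2 \<union> W2 \<times> W1) = {}"
      by fast
  qed (use finite_sets finite_offdiag in auto)
  also have "sum ?f (W1 \<times> W2 \<union> W2 \<times> W1) = sum ?f (W1 \<times> W2) + sum ?f (W2 \<times> W1)"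
    using finite_sets disjoint by (intro sum.union_disjoint) auto
  also have "sum ?f (((offdiag V1 - ?P) \<union> (offdiag V2 - ?P)) \<union> ?P) = sum ?f ((offdiag V1 - ?P) \<union> (offdiag V2 - ?P)) + sum ?f ?P"
    using finite_sets finite_offdiag by (intro sum.union_disjoint) auto
  also have "sum ?f ((offdiag V1 - ?P) \<union> (offdiag V2 - ?P)) = sum ?f (offdiag V1 - ?P) + sum ?f (offdiag V2 - ?P)"
  proof (rule sum.union_disjoint)
    have V12: "V1 \<inter> V2 = {i, j}" using ends disjoint by (auto simp: V1_def V2_def)
    have "(x, z) \<in> ?P" if xz: "(x, z) \<in> offdiag V1" "(x, z) \<in> offdiag V2" for x z
    proof -
      have "x \<in> V1 \<inter> V2" "z \<in> V1 \<inter> V2" "x \<noteq> z" using xz by auto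
      then show ?thesis unfolding V12 by auto
    qed
    then show "(offdiag V1 - ?P) \<inter> (offdiag V2 - ?P) = {}" by fast
  qed (use finite_sets finite_offdiag in auto)
  also have "sum ?f ?P = 2 * (codegree E i j * (codegree E i j + 1))"
    using i_neq_j by (simp add: Int_commute)
  also have "codegree E i j = codegree E1 i j + codegree E2 i j"
    unfolding common_ij using finite_nbrs[OF simple1] finite_nbrs[OF s.simple1[unfolded swap_simps]] common_ij_disjoint
    by (intro card_Un_disjoint) auto
  finally show ?thesis
    using sum_part s.sum_part[unfolded swap_simps] sum_cross s.sum_cross[unfolded swap_simps]
    by (simp add: algebra_simps)
qed

text \<open>Every triangle lies on one side. The two darts of \<open>{i, j}\<close> are counted on
  both sides if both contain a triangle through this edge; \<open>weighted_bound_glue\<close>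
  depends on this gain of 2.\<close>

lemma triangle_darts_split:
  "card (triangle_darts E) + (if codegree E1 i j > 0 \<and> codegree E2 i j > 0 then 2 else 0)
    \<le> card (triangle_darts E1) + card (triangle_darts E2)"
proof -
  interpret s: edge_separation V E i j W2 W1 by (rule swap)
  note simple2 = s.simple1[unfolded swap_simps]
  have fin: "finite (triangle_darts E1)" "finite (triangle_darts E2)"
    using finite_darts[OF simple1] finite_darts[OF simple2]
    by (auto simp: triangle_darts_def intro: finite_subset[rotated])
  have "triangle_darts E \<subseteq> triangle_darts E1 \<union> triangle_darts E2"
  proof clarify
    fix x z assume t: "(x, z) \<in> triangle_darts E" "(x, z) \<notin> triangle_darts E2"
    then obtain w where w: "{x, z} \<in> E" "{x, w} \<in> E" "{z, w} \<in> E" by (auto simp: triangle_darts_def)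
    have V: "x \<in> V" "z \<in> V" "w \<in> V" using w simple_graphD(4)[OF simple] by blast+
    have no: "a \<in> W1 \<Longrightarrow> b \<in> W2 \<Longrightarrow> {a, b} \<notin> E \<and> {b, a} \<notin> E" for a b
      using no_edge[of a b] by (simp add: insert_commute)
    have "{x, z, w} \<subseteq> V1 \<or> {x, z, w} \<subseteq> V2"
      using V w no[of x z] no[of z x] no[of x w] no[of w x] no[of z w] no[of w z]
      by (auto simp: V_eq V1_def V2_def)
    then show "(x, z) \<in> triangle_darts E1"
      using w t(2) by (auto simp: triangle_darts_def E1_def E2_def)
  qed
  then have "card (triangle_darts E) \<le> card (triangle_darts E1 \<union> triangle_darts E2)"
    using fin by (intro card_mono) auto
  moreover have "(if codegree E1 i j > 0 \<and> codegree E2 i j > 0 then 2 else 0) \<le> card (triangle_darts E1 \<inter> triangle_darts E2)"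
  proof (cases "codegree E1 i j > 0 \<and> codegree E2 i j > 0")
    case True
    then have "{(i, j), (j, i)} \<subseteq> triangle_darts E1 \<inter> triangle_darts E2"
      using edge_ij by (auto simp: triangle_darts_def insert_commute card_gt_0_iff)
    then have "card {(i, j), (j, i)} \<le> card (triangle_darts E1 \<inter> triangle_darts E2)"
      using fin by (intro card_mono) auto
    with True i_neq_j show ?thesis by simp
  qed auto
  ultimately show ?thesis using card_Un_Int[OF fin] by linarith
qed

text \<open>Deleting \<open>i\<close> removes \<open>card A1 + 1\<close> edges and leaves a
  connected graph, so the cyclomatic number of the side is at least \<open>card A1\<close>.\<close>

lemma cyclomatic_ge:
  "card (A1) + card V1 \<le> card E1 + 1"
proof -
  have "V1 - {i} \<noteq> {}" using i_neq_j by (auto simp: V1_def)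
  then have "card (V1 - {i}) \<le> card {e\<in>E1. i \<notin> e} + 1"
  proof (intro card_edges_ge)
    show "e \<subseteq> V1 - {i}" if "e \<in> {e\<in>E1. i \<notin> e}" for e using that by (auto simp: E1_def)
    show "joined {e\<in>E1. i \<notin> e} u v" if "u \<in> V1 - {i}" "v \<in> V1 - {i}" for u v
      using that connected_delete[OF two_connected1, of i u v] by (auto simp: V1_def)
  qed (use finite_sets in auto)
  moreover have "card (V1 - {i}) + 1 = card V1"
    using finite_sets by (metis Suc_eq_plus1 V1_def card_Suc_Diff1 insertI1)
  moreover have "card (A1) + 1 = card (nbrs E1 i)"
    using edge_ij(1) finite_nbrs[OF simple1] by (metis Suc_eq_plus1 card_Suc_Diff1 mem_nbrs)
  ultimately show ?thesis using card_edges_delete[OF simple1, of i] by linarith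
qed

lemma cyclomatic_ge': "card (B1) + card V1 \<le> card E1 + 1"
proof -
  interpret s: edge_separation V E j i W1 W2 by (rule swap_ends)
  have "s.V1 = V1" "s.E1 = E1" by (auto simp: s.V1_def V1_def s.E1_def E1_def)
  then show ?thesis using s.cyclomatic_ge by simp
qed

lemma codegree_le: "codegree E1 i j \<le> card (A1)"
  using finite_nbrs[OF simple1] no_loop by (intro card_mono) (auto simp: E1_def)

lemma degree_pos: "card (A1) > 0"
  using nbrs_nonempty[OF simple1 two_connected1, of i j] i_neq_j finite_nbrs[OF simple1]
  by (auto simp: V1_def card_gt_0_iff)

end

section \<open>The bound on degrees, four-cycles and triangles\<close>

text \<open>The last factor is 2 g + 1 with the cyclomatic number g = |E| - |V| + 1. The 5 of the
  bound over darts becomes 3 because \<open>4 * card E\<close> from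
  \<open>sum_degrees_four_cycles\<close> has moved to the right.\<close>

definition weighted_bound :: "'a set \<Rightarrow> 'a set set \<Rightarrow> bool" where
  "weighted_bound V E \<longleftrightarrow> int (codegree_sum V E) + int (card (triangle_darts E)) \<le>
     2 * int (card E) * (2 * int (card E) - 2 * int (card V) + 3)"

text \<open>The right-hand side exceeds the sum of those of the two sides by 4 (m1 - 1) g2 + 4 (m2 -
  1) g1 - 2. These mixed terms have to pay for the cross terms of
  \<open>codegree_sum_split\<close>.\<close>

lemma (in edge_separation) weighted_bound_glue:
  assumes "weighted_bound V1 E1" "weighted_bound V2 E2"
  shows "weighted_bound V E"
proof -
  interpret s: edge_separation V E i j W2 W1 by (rule swap)
  define a1 b1 c1 where "a1 = int (card (A1))" and "b1 = int (card (B1))" and "c1 = int (codegree E1 i j)"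
  define a2 b2 c2 where "a2 = int (card (A2))" and "b2 = int (card (B2))" and "c2 = int (codegree E2 i j)"
  define m1 g1 w1 where "m1 = int (card E1)" and "g1 = int (card E1) - int (card V1) + 1" and "w1 = int (card W1)"
  define m2 g2 w2 where "m2 = int (card E2)" and "g2 = int (card E2) - int (card V2) + 1" and "w2 = int (card W2)"
  define x1 x2 where "x1 = max a1 b1" and "x2 = max a2 b2"
  have nn: "0 \<le> a1" "0 \<le> b1" "0 \<le> c1" "0 \<le> a2" "0 \<le> b2" "0 \<le> c2"
    by (simp_all add: a1_def b1_def c1_def a2_def b2_def c2_def)
  have g: "g1 \<ge> x1" "g2 \<ge> x2"
    using cyclomatic_ge cyclomatic_ge' s.cyclomatic_ge[unfolded swap_simps] s.cyclomatic_ge'[unfolded swap_simps]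
    by (auto simp: g1_def g2_def x1_def x2_def a1_def a2_def b1_def b2_def)
  have w: "w1 \<ge> x1" "w2 \<ge> x2"
    using nbrs_W1 s.nbrs_W1[unfolded swap_simps] finite_sets
    by (auto simp: w1_def w2_def x1_def x2_def a1_def a2_def b1_def b2_def intro!: card_mono)
  have m: "m1 - 1 = g1 + w1" "m2 - 1 = g2 + w2"
    using card_V1 s.card_V1[unfolded swap_simps] by (simp_all add: m1_def m2_def g1_def g2_def w1_def w2_def)
  have x: "x1 \<ge> 1" "x2 \<ge> 1"
    using degree_pos s.degree_pos[unfolded swap_simps] by (auto simp: x1_def x2_def a1_def a2_def)
  have c: "c1 \<le> x1" "c2 \<le> x2"
    using codegree_le s.codegree_le[unfolded swap_simps] by (auto simp: c1_def c2_def x1_def x2_def a1_def a2_def)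
  \<comment> \<open>Since m1 - 1 = g1 + w1 and both summands are at least x1, the factor m1 - 1 is
    at least 2 x1; likewise on the other side.\<close>
  have "(2 * x1) * x2 \<le> (m1 - 1) * g2" "(2 * x2) * x1 \<le> (m2 - 1) * g1"
    by (rule mult_mono; use g w m x in linarith)+
  moreover have "(2 * x1) * x2 = 2 * (x1 * x2)" "(2 * x2) * x1 = 2 * (x1 * x2)" by simp_all
  ultimately have slack: "4 * ((m1 - 1) * g2) + 4 * ((m2 - 1) * g1) \<ge> 16 * (x1 * x2)"
    by linarith
  define t :: int where "t = (if c1 > 0 \<and> c2 > 0 then 2 else 0)"
  have "a1 * a2 \<le> x1 * x2" "b1 * b2 \<le> x1 * x2" "c1 * c2 \<le> x1 * x2"
    using nn c x by (auto intro!: mult_mono simp: x1_def x2_def)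
  moreover have "x1 * x2 \<ge> 1" using mult_mono[OF x] x by simp
  \<comment> \<open>The cross terms can reach 16 x1 x2 only if both sides have a triangle through
    \<open>{i, j}\<close>; then \<open>t\<close> covers the missing 2. Otherwise they are at most 8
    x1 x2, and x1 x2 is at least 1.\<close>
  ultimately have cross: "8 * (c1 * c2) + 4 * (a1 * a2) + 4 * (b1 * b2) - t \<le> 16 * (x1 * x2) - 2"
  proof (cases "c1 > 0 \<and> c2 > 0")
    case False
    then have "c1 * c2 = 0" using nn by auto
    then show ?thesis using \<open>a1 * a2 \<le> x1 * x2\<close> \<open>b1 * b2 \<le> x1 * x2\<close> \<open>x1 * x2 \<ge> 1\<close> False
      by (simp only: t_def if_False)
  qed (simp add: t_def)
  have R: "int (codegree_sum V E) = int (codegree_sum V1 E1) + int (codegree_sum V2 E2) + 8 * (c1 * c2) + 4 * (a1 * a2) + 4 * (b1 * b2)"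
    by (simp add: codegree_sum_split a1_def a2_def b1_def b2_def c1_def c2_def)
  have T: "int (card (triangle_darts E)) + t \<le> int (card (triangle_darts E1)) + int (card (triangle_darts E2))"
    using triangle_darts_split by (auto simp: t_def c1_def c2_def split: if_splits)
  have mE: "int (card E) = m1 + m2 - 1" using card_E by (simp add: m1_def m2_def)
  have G: "2 * int (card E) - 2 * int (card V) + 3 = 2 * (g1 + g2) + 1"
    using card_E card_V by (simp add: g1_def g2_def)
  have IH: "int (codegree_sum V1 E1) + int (card (triangle_darts E1)) \<le> 2 * m1 * (2 * g1 + 1)"
    "int (codegree_sum V2 E2) + int (card (triangle_darts E2)) \<le> 2 * m2 * (2 * g2 + 1)"
    using assms by (simp_all add: weighted_bound_def m1_def m2_def g1_def g2_def algebra_simps)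
  have "2 * (m1 + m2 - 1) * (2 * (g1 + g2) + 1) =
      2 * m1 * (2 * g1 + 1) + 2 * m2 * (2 * g2 + 1) + 4 * ((m1 - 1) * g2) + 4 * ((m2 - 1) * g1) - 2"
    by (simp add: algebra_simps)
  then show ?thesis unfolding weighted_bound_def unfolding G unfolding mE using R T IH slack cross by linarith
qed

theorem weighted_bound:
  assumes "simple_graph V E" "two_connected V E"
  shows "weighted_bound V E"
  using assms
proof (induction "card V" arbitrary: V E rule: less_induct)
  case less
  note simple = less.prems(1) and two = less.prems(2)
  show ?case
  proof (cases "\<forall>i j. {i, j} \<in> E \<longrightarrow> (\<forall>u\<in>V - {i, j}. \<forall>v\<in>V - {i, j}. joined {e\<in>E. i \<notin> e \<and> j \<notin> e} u v)")
    case True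
    have "(\<Sum>(i, j)\<in>darts E. card (nbrs E i) + card (nbrs E j) + card (four_cycles E i j) +
        (if nbrs E i \<inter> nbrs E j = {} then 0 else 1) + 2 * card V) \<le> (\<Sum>(i, j)\<in>darts E. 2 * card E + 5)"
      using dart_bound[OF simple two] True by (intro sum_mono) auto
    moreover have "(\<Sum>(i, j)\<in>darts E. if nbrs E i \<inter> nbrs E j = {} then 0 else 1) = card (triangle_darts E)"
      using finite_darts[OF simple]
      by (subst card_eq_sum, intro sum.mono_neutral_cong_right) (auto simp: triangle_darts_def disjoint_iff split: if_splits)
    moreover have "(\<Sum>(i, j)\<in>darts E. card (nbrs E i) + card (nbrs E j) + card (four_cycles E i j) +
        (if nbrs E i \<inter> nbrs E j = {} then 0 else 1) + 2 * card V) =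
      (\<Sum>(i, j)\<in>darts E. card (nbrs E i) + card (nbrs E j) + card (four_cycles E i j)) +
      (\<Sum>(i, j)\<in>darts E. if nbrs E i \<inter> nbrs E j = {} then 0 else 1) + card (darts E) * (2 * card V)"
      by (simp only: case_prod_unfold sum.distrib sum_constant of_nat_id)
    ultimately have "codegree_sum V E + 4 * card E + card (triangle_darts E) + 2 * card E * (2 * card V) \<le> 2 * card E * (2 * card E + 5)"
      using sum_degrees_four_cycles[OF simple] card_darts[OF simple] by (simp add: case_prod_unfold)
    then have "int (codegree_sum V E + 4 * card E + card (triangle_darts E) + 2 * card E * (2 * card V)) \<le> int (2 * card E * (2 * card E + 5))"
      by (simp only: of_nat_le_iff)
    then show ?thesis by (simp add: weighted_bound_def algebra_simps)
  next
    case False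
    then obtain i j u v where ij: "{i, j} \<in> E" and uv: "u \<in> V - {i, j}" "v \<in> V - {i, j}"
      "\<not> joined {e\<in>E. i \<notin> e \<and> j \<notin> e} u v" by blast
    define F where "F = {e\<in>E. i \<notin> e \<and> j \<notin> e}"
    define W1 where "W1 = {w\<in>V - {i, j}. joined F u w}"
    define W2 where "W2 = V - {i, j} - W1"
    interpret edge_separation V E i j W1 W2
    proof
      show "V = insert i (insert j (W1 \<union> W2))"
        using simple_graphD(4)[OF simple ij] by (auto simp: W1_def W2_def)
      show "{x, y} \<notin> E" if "x \<in> W1" "y \<in> W2" for x y
      proof
        assume "{x, y} \<in> E"
        then have "{x, y} \<in> F" using that by (auto simp: F_def W1_def W2_def)
        then have "joined F u y" using that joined_trans[OF _ joined_edge] by (auto simp: W1_def)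
        then show False using that by (auto simp: W1_def W2_def)
      qed
      have "u \<in> W1" "v \<in> W2" using uv by (auto simp: W1_def W2_def F_def)
      then show "W1 \<noteq> {}" "W2 \<noteq> {}" by auto
    qed (use simple two ij in \<open>auto simp: W1_def W2_def\<close>)
    interpret s: edge_separation V E i j W2 W1 by (rule swap)
    have "card V1 < card V" "card V2 < card V"
      using card_V card_V1 s.card_V1[unfolded swap_simps] nonempty finite_sets by (auto simp: card_gt_0_iff)
    then show ?thesis
      using less.hyps simple1 two_connected1 s.simple1[unfolded swap_simps] s.two_connected1[unfolded swap_simps]
      by (intro weighted_bound_glue) auto
  qed
qed

corollary sum_darts_bound:
  assumes "simple_graph V E" "two_connected V E"
  shows "(\<Sum>(i, j)\<in>darts E. int (card (nbrs E i)) + int (card (nbrs E j)) + int (card (four_cycles E i j))) + int (card (triangle_darts E))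
    \<le> 2 * int (card E) * (2 * int (card E) - 2 * int (card V) + 5)"
proof -
  have "(\<Sum>(i, j)\<in>darts E. int (card (nbrs E i)) + int (card (nbrs E j)) + int (card (four_cycles E i j))) =
      int (\<Sum>(i, j)\<in>darts E. card (nbrs E i) + card (nbrs E j) + card (four_cycles E i j))"
    by (simp only: of_nat_sum case_prod_unfold of_nat_add)
  then show ?thesis using weighted_bound[OF assms]
    unfolding sum_degrees_four_cycles[OF assms(1)] weighted_bound_def by (simp add: algebra_simps)
qed

section \<open>Edges of the polytope\<close>

text \<open>The arithmetic form of an edge of the polytope. Sums equal to 0 or to some vector
  \<open>c\<close> are excluded, since they compete with the representations \<open>c + - c\<close>
  and \<open>c + 0\<close> inside the polytope.\<close>

definition unique_pair :: "'n::finite set set \<Rightarrow> real ^ 'n \<Rightarrow> real ^ 'n \<Rightarrow> bool" where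
  "unique_pair E a b \<longleftrightarrow> a \<in> edge_vecs E \<and> b \<in> edge_vecs E \<and> a \<noteq> b \<and> a + b \<notin> insert 0 (edge_vecs E) \<and>
     (\<forall>c\<in>edge_vecs E. \<forall>d\<in>edge_vecs E. c + d = a + b \<longrightarrow> {c, d} = {a, b})"

lemma unique_pairD:
  "unique_pair E a b \<Longrightarrow> c \<in> edge_vecs E \<Longrightarrow> d \<in> edge_vecs E \<Longrightarrow> c + d = a + b \<Longrightarrow> {c, d} = {a, b}"
  unfolding unique_pair_def by blast

lemma unique_pair_sym:
  assumes "unique_pair E a b"
  shows "unique_pair E b a"
  unfolding unique_pair_def
proof (intro conjI ballI impI)
  show "b \<in> edge_vecs E" "a \<in> edge_vecs E" "b \<noteq> a" "b + a \<notin> insert 0 (edge_vecs E)"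
    using assms unfolding unique_pair_def add.commute[of b a] by blast+
  fix c d assume "c \<in> edge_vecs E" "d \<in> edge_vecs E" "c + d = b + a"
  then show "{c, d} = {b, a}"
    using unique_pairD[OF assms, of c d] unfolding add.commute[of b a] insert_commute[of b a] by blast
qed

lemma unique_pair_minus:
  assumes "unique_pair E a b"
  shows "unique_pair E (- a) (- b)"
  unfolding unique_pair_def
proof (intro conjI ballI impI)
  show "- a \<in> edge_vecs E" "- b \<in> edge_vecs E" "- a \<noteq> - b"
    using assms by (auto simp: unique_pair_def minus_edge_vecs)
  have minus: "- x \<in> insert 0 (edge_vecs E)" if "x \<in> insert 0 (edge_vecs E)" for x
    using that minus_edge_vecs by auto
  show "- a + - b \<notin> insert 0 (edge_vecs E)"
  proof
    assume "- a + - b \<in> insert 0 (edge_vecs E)"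
    then have "- (- a + - b) \<in> insert 0 (edge_vecs E)" by (rule minus)
    moreover have "- (- a + - b) = a + b" by simp
    ultimately show False using assms unfolding unique_pair_def by metis
  qed
  fix c d assume cd: "c \<in> edge_vecs E" "d \<in> edge_vecs E" "c + d = - a + - b"
  have "- c + - d = a + b"
    using arg_cong[OF cd(3), of uminus] by (simp add: add.commute)
  then have "{- c, - d} = {a, b}" by (rule unique_pairD[OF assms minus_edge_vecs minus_edge_vecs, OF cd(1,2)])
  then have "uminus ` {- c, - d} = uminus ` {a, b}" by simp
  then show "{c, d} = {- a, - b}" by simp
qed

lemma norm_edge_vec: "i \<noteq> j \<Longrightarrow> norm (edge_vec i j) = sqrt 2"
  by (simp add: norm_eq_sqrt_inner edge_vec_def inner_diff_left inner_diff_right inner_axis_axis)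

lemma neq_minus:
  fixes x :: "'a::real_vector"
  assumes "x \<noteq> 0"
  shows "x \<noteq> - x"
proof
  assume "x = - x"
  then have "x + x = 0" by (metis add.right_inverse)
  then show False using assms by (simp flip: scaleR_2)
qed

section \<open>Recovering two darts from the sum of their vectors\<close>

text \<open>Signs of coordinates reveal the darts: positive ones occur only at tails, negative ones
  only at heads.\<close>

lemma edge_vec_sum_pos:
  assumes "(edge_vec p q + edge_vec r s) $ x > 0"
  shows "x = p \<or> x = r"
  using assms by (auto simp: edge_vec_nth split: if_splits)

lemma edge_vec_sum_neg:
  assumes "(edge_vec p q + edge_vec r s) $ x < 0"
  shows "x = q \<or> x = s"
  using assms by (auto simp: edge_vec_nth split: if_splits)

lemma edge_vec_sum_double:
  assumes "edge_vec p q + edge_vec r s = edge_vec i j + edge_vec i l" "p \<noteq> q" "r \<noteq> s" "i \<noteq> j" "i \<noteq> l"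
  shows "p = i \<and> r = i \<and> (q = j \<and> s = l \<or> q = l \<and> s = j)"
proof -
  have "(edge_vec p q + edge_vec r s) $ i = 2" using assms by (simp add: edge_vec_nth)
  then have pr: "p = i \<and> r = i" by (auto simp: edge_vec_nth split: if_splits)
  have "axis q 1 + axis s (1::real) = axis j 1 + axis l 1"
    using assms(1) pr by (simp add: edge_vec_def algebra_simps)
  then have "(axis q 1 + axis s (1::real)) $ x = (axis j 1 + axis l 1) $ x" for x by simp
  from this[of j] this[of l] this[of q] this[of s] have "q = j \<and> s = l \<or> q = l \<and> s = j"
    by (auto simp: axis_def split: if_splits)
  with pr show ?thesis by simp
qed

lemma edge_vec_sum_disjoint:
  assumes "edge_vec p q + edge_vec r s = edge_vec i j + edge_vec k l" "distinct [i, j, k, l]"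
  shows "(p = i \<and> r = k \<or> p = k \<and> r = i) \<and> (q = j \<and> s = l \<or> q = l \<and> s = j)"
proof -
  have "(edge_vec p q + edge_vec r s) $ i > 0" "(edge_vec p q + edge_vec r s) $ k > 0"
    "(edge_vec p q + edge_vec r s) $ j < 0" "(edge_vec p q + edge_vec r s) $ l < 0"
    unfolding assms(1) using assms(2) by (auto simp: edge_vec_nth)
  from this(1,2)[THEN edge_vec_sum_pos] this(3,4)[THEN edge_vec_sum_neg] show ?thesis
    using assms(2) by auto
qed

lemma edge_vec_sum_path:
  assumes "edge_vec p q + edge_vec r s = edge_vec i l" "p \<noteq> q" "r \<noteq> s" "i \<noteq> l"
  shows "p = i \<and> q = r \<and> s = l \<or> r = i \<and> s = p \<and> q = l"
proof -
  have nth: "(edge_vec p q + edge_vec r s) $ x = edge_vec i l $ x" for x using assms(1) by simp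
  have "(edge_vec p q + edge_vec r s) $ i > 0" "(edge_vec p q + edge_vec r s) $ l < 0"
    unfolding assms(1) using assms(4) by (auto simp: edge_vec_nth)
  then have "(i = p \<or> i = r) \<and> (l = q \<or> l = s)" using edge_vec_sum_pos edge_vec_sum_neg by blast
  then show ?thesis
    using nth[of p] nth[of q] nth[of r] nth[of s] assms(2-4)
    by (auto simp: edge_vec_nth split: if_splits)
qed

text \<open>A vertex potential is a linear functional on the polytope. If its increase along darts
  is at most 1 and equal to 1 just for \<open>a\<close> and \<open>b\<close>, it exposes the segment
  between them as a face.\<close>

lemma potential_edge:
  fixes v :: "'n::finite \<Rightarrow> real"
  assumes E: "simple_graph UNIV E" and ab: "a \<in> edge_vecs E" "b \<in> edge_vecs E" "a \<noteq> b"
    and v: "\<And>p q. {p, q} \<in> E \<Longrightarrow> v p - v q \<le> 1"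
    and tight: "\<And>p q. {p, q} \<in> E \<Longrightarrow> v p - v q = 1 \<longleftrightarrow> edge_vec p q \<in> {a, b}"
  shows "convex hull {a, b} edge_of sym_edge_polytope E"
proof -
  define h where "h = (\<chi> i. v i)"
  have h: "h \<bullet> edge_vec p q = v p - v q" for p q
    by (simp add: h_def edge_vec_def inner_diff_right inner_axis)
  have "edge_vecs E \<subseteq> {x. h \<bullet> x \<le> 1}" using v by (auto simp: edge_vecs_def h)
  then have "convex hull (edge_vecs E) \<subseteq> {x. h \<bullet> x \<le> 1}"
    by (rule hull_minimal) (rule convex_halfspace_le)
  then have F: "(convex hull (edge_vecs E) \<inter> {x. h \<bullet> x = 1}) face_of convex hull (edge_vecs E)"
    by (intro face_of_Int_supporting_hyperplane_le) auto
  obtain S where S: "S \<subseteq> edge_vecs E" "convex hull (edge_vecs E) \<inter> {x. h \<bullet> x = 1} = convex hull S"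
    by (rule face_of_convex_hull_subset[OF finite_imp_compact[OF finite_edge_vecs[OF E]] F])
  have tight': "h \<bullet> c = 1 \<longleftrightarrow> c \<in> {a, b}" if "c \<in> edge_vecs E" for c
    using that tight by (auto simp: edge_vecs_def h)
  have "S \<subseteq> convex hull S" by (rule hull_subset)
  then have "S \<subseteq> {a, b}" using S tight' by blast
  moreover have "{a, b} \<subseteq> convex hull S"
    unfolding S(2)[symmetric] using ab tight'[OF ab(1)] tight'[OF ab(2)] by (auto intro: hull_inc)
  ultimately have "convex hull S = convex hull {a, b}"
    by (metis convex_convex_hull hull_minimal hull_mono subset_antisym)
  then show ?thesis
    using F S ab(3) by (simp add: edge_of_def sym_edge_polytope_edge_vecs aff_dim_convex_hull)
qed

lemma unique_path_imp_edge:
  fixes E :: "'n::finite set set"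
  assumes E: "simple_graph UNIV E" and u: "unique_pair E (edge_vec i j) (edge_vec j l)"
    and ij: "{i, j} \<in> E" and jl: "{j, l} \<in> E"
  shows "convex hull {edge_vec i j, edge_vec j l} edge_of sym_edge_polytope E"
proof -
  have no_loop: "{x} \<notin> E" for x using simple_graphD(3)[OF E, of x x] by auto
  have ne: "i \<noteq> j" "j \<noteq> l" using ij jl no_loop by auto
  have sums: "edge_vec i l \<noteq> 0" "edge_vec i l \<notin> edge_vecs E" using u by (auto simp: unique_pair_def edge_vec_add)
  have ilne: "i \<noteq> l" using sums(1) by (auto simp: edge_vec_def)
  have il: "{i, l} \<notin> E" using sums(2) by (auto simp: edge_vecsI)
  have mid: "m = j" if "{i, m} \<in> E" "{m, l} \<in> E" for m
  proof -
    have "edge_vec i m + edge_vec m l = edge_vec i j + edge_vec j l" by (simp add: edge_vec_add)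
    with that have "{edge_vec i m, edge_vec m l} = {edge_vec i j, edge_vec j l}"
      by (intro unique_pairD[OF u]) (auto intro: edge_vecsI)
    then have "edge_vec i m = edge_vec i j \<or> edge_vec i m = edge_vec j l" by (auto simp: doubleton_eq_iff)
    moreover have "i \<noteq> m" using that no_loop by auto
    ultimately show ?thesis using ne by (auto simp: edge_vec_eq_iff)
  qed
  have mem: "edge_vec p q \<in> {edge_vec i j, edge_vec j l} \<longleftrightarrow> p = i \<and> q = j \<or> p = j \<and> q = l" if "{p, q} \<in> E" for p q
    using that ne no_loop by (cases "p = q") (auto simp: edge_vec_eq_iff)
  have ab: "edge_vec i j \<in> edge_vecs E" "edge_vec j l \<in> edge_vecs E" "edge_vec i j \<noteq> edge_vec j l"
    using u by (auto simp: unique_pair_def)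
  \<comment> \<open>The potential must drop by 1 from \<open>i\<close> to \<open>j\<close> and from
    \<open>j\<close> to \<open>l\<close>. Other neighbours of \<open>i\<close> need a positive value
    and other neighbours of \<open>l\<close> a negative one; these demands do not conflict as
    \<open>j\<close> is the only common neighbour. The size 1 / 3 keeps the remaining differences
    below 1.\<close>
  define v where "v x = (if x = i then 1 else if x = l then - 1 else if x = j then 0 else if {i, x} \<in> E then 1 / 3 
      else if {x, l} \<in> E then - 1 / 3 else 0 :: real)" for x
  show ?thesis
  proof (rule potential_edge[OF E ab, of v])
    fix p q assume pq: "{p, q} \<in> E"
    have qp: "{q, p} \<in> E" using pq by (simp add: insert_commute)
    have bnd: "\<bar>v x\<bar> \<le> 1 / 3 " if "x \<noteq> i" "x \<noteq> l" for x using that by (auto simp: v_def)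
    have vi: "v i = 1" and vl: "v l = - 1" and vj: "v j = 0" using ne ilne by (auto simp: v_def)
    have pl: "v p \<le> 0" if "q = l" "p \<noteq> i"
      using that mid[of p] pq no_loop ilne by (auto simp: v_def)
    have qi: "v q \<ge> 0" if "p = i" "q \<noteq> l"
      using that pq ilne no_loop by (auto simp: v_def)
    have pj: "v p < 0" if "q = l" "p \<noteq> i" "p \<noteq> j"
      using that mid[of p] pq no_loop ilne by (auto simp: v_def)
    have qj: "v q > 0" if "p = i" "q \<noteq> l" "q \<noteq> j"
      using that pq ilne no_loop by (auto simp: v_def)
    have pne: "p \<noteq> q" using pq no_loop by auto
    have "v p - v q \<le> 1 \<and> (v p - v q = 1 \<longleftrightarrow> p = i \<and> q = j \<or> p = j \<and> q = l)"
    proof (cases "p = i")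
      case True
      then have "q \<noteq> l" "q \<noteq> i" using il pq pne by auto
      then show ?thesis using True vi vj qi qj ne by (cases "q = j") auto
    next
      case pi: False
      show ?thesis
      proof (cases "q = l")
        case True
        then show ?thesis using pi vl vj pl pj ne by (cases "p = j") auto
      next
        case ql: False
        have "v p \<le> 1 / 3 " using bnd[of p] pi vl by (cases "p = l") auto
        moreover have "v q \<ge> - 1 / 3 " using bnd[of q] ql vi by (cases "q = i") auto
        ultimately show ?thesis using pi ql by auto
      qed
    qed
    then show "v p - v q \<le> 1" "v p - v q = 1 \<longleftrightarrow> edge_vec p q \<in> {edge_vec i j, edge_vec j l}"
      unfolding mem[OF pq] by auto
  qed
qed

lemma unique_pair_imp_edge:
  fixes E :: "'n::finite set set"
  assumes E: "simple_graph UNIV E" and u: "unique_pair E a b"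
  shows "convex hull {a, b} edge_of sym_edge_polytope E"
proof -
  have ab: "a \<in> edge_vecs E" "b \<in> edge_vecs E" "a \<noteq> b" using u by (auto simp: unique_pair_def)
  note SE = simple_graphD[OF E]
  have no_loop: "{x} \<notin> E" for x using SE(3)[of x x] by auto
  obtain i j where a: "a = edge_vec i j" "{i, j} \<in> E" "i \<noteq> j" using edge_vecsE[OF ab(1) E] .
  obtain k l where b: "b = edge_vec k l" "{k, l} \<in> E" "k \<noteq> l" using edge_vecsE[OF ab(2) E] .
  have sums: "a + b \<noteq> 0" "a + b \<notin> edge_vecs E" using u by (auto simp: unique_pair_def)
  have ne: "\<not> (i = k \<and> j = l)" "\<not> (i = l \<and> j = k)"
    using ab(3) a b sums(1) by (auto simp: edge_vec_def)
  have mem: "edge_vec p q \<in> {a, b} \<longleftrightarrow> p = i \<and> q = j \<or> p = k \<and> q = l" if "{p, q} \<in> E" for p q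
    using that a b no_loop by (cases "p = q") (auto simp: edge_vec_eq_iff)
  note pe = potential_edge[OF E ab]
  consider "i = k" | "j = l" | "j = k" | "i = l" | "distinct [i, j, k, l]"
    using a(3) b(3) ne by auto
  then show ?thesis
  proof cases
    case 1
    define v where "v x = (if x = i then 1 / 2 else if x = j \<or> x = l then - 1 / 2 else 0 :: real)" for x
    show ?thesis
    proof (rule pe[of v])
      fix p q assume pq: "{p, q} \<in> E"
      show "v p - v q \<le> 1" "v p - v q = 1 \<longleftrightarrow> edge_vec p q \<in> {a, b}"
        unfolding mem[OF pq] using 1 a(3) b(3) by (auto simp: v_def)
    qed
  next
    case 2
    define v where "v x = (if x = j then - 1 / 2 else if x = i \<or> x = k then 1 / 2 else 0 :: real)" for x
    show ?thesis
    proof (rule pe[of v])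
      fix p q assume pq: "{p, q} \<in> E"
      show "v p - v q \<le> 1" "v p - v q = 1 \<longleftrightarrow> edge_vec p q \<in> {a, b}"
        unfolding mem[OF pq] using 2 a(3) b(3) by (auto simp: v_def)
    qed
  next
    case 5
    have two: "\<not> ({i, l} \<in> E \<and> {k, j} \<in> E)"
    proof
      assume il: "{i, l} \<in> E \<and> {k, j} \<in> E"
      have "edge_vec i l + edge_vec k j = a + b" using a b by (simp add: edge_vec_def)
      with il have "{edge_vec i l, edge_vec k j} = {a, b}"
        by (intro unique_pairD[OF u]) (auto intro: edge_vecsI)
      then have "edge_vec i l = a \<or> edge_vec i l = b" by (auto simp: doubleton_eq_iff)
      then show False using a b 5 by (auto simp: edge_vec_eq_iff)
    qed
    \<comment> \<open>Both darts drop by exactly 1. The offset between them makes one of (i, l), (k,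
      j) drop by 5 / 4 and the other by 3 / 4; by \<open>two\<close> they are not both present, and
      the sign of the offset is chosen so that the steep one is absent.\<close>
    define v where "v x = (if x = i then 1 / 2 else if x = j then - 1 / 2 else if {k, j} \<in> E
        then if x = k then 1 / 4 else if x = l then - 3 / 4 else 0
        else if x = k then 3 / 4 else if x = l then - 1 / 4 else 0 :: real)" for x
    show ?thesis
    proof (rule pe[of v])
      fix p q assume pq: "{p, q} \<in> E"
      have "{q, p} \<in> E" using pq by (simp add: insert_commute)
      show "v p - v q \<le> 1" "v p - v q = 1 \<longleftrightarrow> edge_vec p q \<in> {a, b}"
        unfolding mem[OF pq] using 5 two pq \<open>{q, p} \<in> E\<close> by (auto simp: v_def insert_commute)
    qed
  next
    case 3
    show ?thesis using unique_path_imp_edge[OF E, of i j l] u a b 3 by simp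
  next
    case 4
    have "convex hull {b, a} edge_of sym_edge_polytope E"
      using unique_path_imp_edge[OF E, of k i j] unique_pair_sym[OF u] a b 4 by simp
    then show ?thesis by (simp add: insert_commute)
  qed
qed

text \<open>A competing representation of \<open>a + b\<close> by points of the polytope has the
  same midpoint, so the face property forces both of its summands into the edge.\<close>

lemma edge_imp_unique_pair:
  fixes E :: "'n::finite set set"
  assumes E: "simple_graph UNIV E" and three: "card E \<ge> 2" and F: "F edge_of sym_edge_polytope E"
  obtains a b where "unique_pair E a b" "F = convex hull {a, b}"
proof -
  let ?P = "convex hull (edge_vecs E)"
  have face: "F face_of ?P" and dim: "aff_dim F = 1" using F by (auto simp: edge_of_def sym_edge_polytope_edge_vecs)
  have "compact ?P" using finite_edge_vecs[OF E] by (intro compact_convex_hull finite_imp_compact)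
  then have "compact F" using face by (metis face_of_imp_compact convex_convex_hull)
  moreover have "convex F" "F \<noteq> {}" using face dim face_of_imp_convex by auto
  moreover have "collinear F" using dim by (simp add: collinear_aff_dim)
  ultimately obtain a b where ab: "F = closed_segment a b"
    by (metis compact_convex_collinear_segment)
  have "a \<noteq> b" using dim ab by auto
  have "a extreme_point_of F" "b extreme_point_of F" by (auto simp: ab extreme_point_of_segment)
  then have abE: "a \<in> edge_vecs E" "b \<in> edge_vecs E"
    using face extreme_point_of_face extreme_point_of_convex_hull by blast+
  have norm: "norm c = sqrt 2" if "c \<in> edge_vecs E" for c
    using that by (metis edge_vecsE E norm_edge_vec)
  \<comment> \<open>All edge vectors have the same norm, whereas an interior point of a chord of a
    sphere has smaller norm than its ends.\<close>
  have ends: "c = a \<or> c = b" if "c \<in> F" "c \<in> edge_vecs E" for c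
  proof (rule ccontr)
    assume "\<not> (c = a \<or> c = b)"
    then have "c \<in> open_segment a b" using that ab by (auto simp: open_segment_def)
    from dist_decreases_open_segment[OF this, of 0] show False
      using norm that(2) abE by simp
  qed
  define m where "m = (1/2) *\<^sub>R (a + b)"
  have mF: "m \<in> F" unfolding ab m_def by (metis midpoint_def midpoint_in_closed_segment inverse_eq_divide)
  have pair: "x \<in> F \<and> y \<in> F" if "x + y = a + b" "x \<noteq> y" "x \<in> ?P" "y \<in> ?P" for x y
  proof -
    have "m = midpoint x y" using that by (simp add: m_def midpoint_def inverse_eq_divide)
    then have "m \<in> open_segment x y" using that by (simp add: midpoint_in_open_segment)
    then show ?thesis using face mF that unfolding face_of_def by blast
  qed
  have zero: "0 \<notin> edge_vecs E" using norm by force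
  have zeroP: "0 \<in> ?P"
  proof -
    have "(1/2) *\<^sub>R a + (1/2) *\<^sub>R (- a) \<in> ?P"
      using abE minus_edge_vecs by (intro convexD[OF convex_convex_hull] hull_inc) auto
    then show ?thesis by simp
  qed
  have "unique_pair E a b"
    unfolding unique_pair_def
  proof (intro conjI ballI impI)
    show "a \<in> edge_vecs E" "b \<in> edge_vecs E" "a \<noteq> b" by fact+
    have "a + b \<notin> edge_vecs E"
    proof
      assume c: "a + b \<in> edge_vecs E"
      then have "a + b \<noteq> 0" "a + b \<in> ?P" using zero by (auto intro: hull_inc)
      then have "a + b \<in> F" using pair[of "a + b" 0] zeroP by simp
      then have "a = 0 \<or> b = 0" using ends[OF _ c] by auto
      with abE zero show False by auto
    qed
    \<comment> \<open>Otherwise the segment contains 0 as its midpoint, hence every \<open>c\<close>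
      together with \<open>- c\<close>, and there would be only one graph edge.\<close>
    moreover have "a + b \<noteq> 0"
    proof
      assume "a + b = 0"
      have "edge_vecs E \<subseteq> {a, b}"
      proof
        fix c assume c: "c \<in> edge_vecs E"
        have "c \<noteq> - c" using c zero neq_minus by metis
        moreover have "c \<in> ?P" "- c \<in> ?P" using c minus_edge_vecs by (auto intro: hull_inc)
        ultimately have "c \<in> F" using pair[of c "- c"] \<open>a + b = 0\<close> by simp
        then show "c \<in> {a, b}" using ends c by auto
      qed
      then have "card (edge_vecs E) \<le> card {a, b}" by (intro card_mono) auto
      then show False using card_edge_vecs[OF E] three card_insert_le_m1[of 2 "{b}" a] by auto
    qed
    ultimately show "a + b \<notin> insert 0 (edge_vecs E)" by simp
    fix c d assume cd: "c \<in> edge_vecs E" "d \<in> edge_vecs E" "c + d = a + b"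
    have "c \<noteq> d"
    proof
      assume "c = d"
      then have "a + b = 2 *\<^sub>R c" using cd by (simp add: scaleR_2)
      then have "c = m" by (simp add: m_def)
      then have "c = a \<or> c = b" using ends mF cd by auto
      then show False using \<open>c = d\<close> cd(3) \<open>a \<noteq> b\<close> by auto
    qed
    then have "c \<in> F" "d \<in> F" using pair[OF cd(3)] cd by (auto intro: hull_inc)
    then show "{c, d} = {a, b}" using ends cd \<open>c \<noteq> d\<close> by blast
  qed
  then show thesis using that ab by (simp add: segment_convex_hull)
qed

section \<open>Lattice points lost by deleting an edge\<close>

definition unique_sums :: "'n::finite set set \<Rightarrow> (real ^ 'n) set" where
  "unique_sums E = {a + b | a b. unique_pair E a b}"

lemma unique_pair_inject:
  assumes "unique_pair E a b" "unique_pair E c d"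
  shows "a + b = c + d \<longleftrightarrow> {a, b} = {c, d}"
proof
  assume "a + b = c + d"
  then show "{a, b} = {c, d}"
    using unique_pairD[OF assms(2), of a b] assms(1) unfolding unique_pair_def by blast
next
  assume "{a, b} = {c, d}"
  then show "a + b = c + d" by (auto simp: doubleton_eq_iff add.commute)
qed

text \<open>The edge of the polytope and the sum of its ends both determine the same unordered
  pair.\<close>

lemma num_edges_sym_edge_polytope:
  fixes E :: "'n::finite set set"
  assumes E: "simple_graph UNIV E" and "card E \<ge> 2"
  shows "num_edges (sym_edge_polytope E) = card (unique_sums E)"
proof -
  define Q where "Q = {(a, b). unique_pair E a b}"
  have edges: "{F. F edge_of sym_edge_polytope E} = (\<lambda>(a, b). convex hull {a, b}) ` Q"
    using unique_pair_imp_edge[OF E] edge_imp_unique_pair[OF assms]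
    by (auto simp: Q_def image_iff) metis
  have sums: "unique_sums E = (\<lambda>(a, b). a + b) ` Q" by (auto simp: unique_sums_def Q_def)
  have hull: "convex hull {a, b} = convex hull {c, d} \<longleftrightarrow> {a, b} = {c, d}" for a b c d :: "real ^ 'n"
    using closed_segment_eq[of a b c d] by (simp only: segment_convex_hull)
  define f where "f x = (SOME F. \<exists>a b. unique_pair E a b \<and> x = a + b \<and> F = convex hull {a, b})" for x
  have f: "f (a + b) = convex hull {a, b}" if "unique_pair E a b" for a b
  proof -
    have "\<exists>c d. unique_pair E c d \<and> a + b = c + d \<and> f (a + b) = convex hull {c, d}"
      unfolding f_def by (rule someI_ex) (use that in blast)
    then show ?thesis using unique_pair_inject[OF that] hull by metis
  qed
  have "bij_betw f (unique_sums E) {F. F edge_of sym_edge_polytope E}"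
  proof (rule bij_betw_imageI)
    show "inj_on f (unique_sums E)"
      using f hull unique_pair_inject unfolding inj_on_def unique_sums_def by (smt (verit) mem_Collect_eq)
    show "f ` unique_sums E = {F. F edge_of sym_edge_polytope E}"
      unfolding edges sums image_image by (rule image_cong) (auto simp: Q_def f)
  qed
  then show ?thesis by (simp add: num_edges_def bij_betw_same_card)
qed

lemma edge_vecs_delete:
  assumes "simple_graph UNIV E" "i \<noteq> j"
  shows "edge_vecs (E - {{i, j}}) = edge_vecs E - {edge_vec i j, edge_vec j i}"
proof (intro subset_antisym subsetI)
  fix x assume "x \<in> edge_vecs (E - {{i, j}})"
  then obtain p q where pq: "x = edge_vec p q" "{p, q} \<in> E" "{p, q} \<noteq> {i, j}" by (auto simp: edge_vecs_def)
  moreover have "p \<noteq> q" using simple_graphD(3)[OF assms(1) pq(2)] .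
  ultimately show "x \<in> edge_vecs E - {edge_vec i j, edge_vec j i}"
    using assms(2) by (auto simp: edge_vec_eq_iff edge_vecsI doubleton_eq_iff)
next
  fix x assume x: "x \<in> edge_vecs E - {edge_vec i j, edge_vec j i}"
  then obtain p q where pq: "x = edge_vec p q" "{p, q} \<in> E" by (auto simp: edge_vecs_def)
  then have "{p, q} \<noteq> {i, j}" using x by (auto simp: doubleton_eq_iff)
  with pq show "x \<in> edge_vecs (E - {{i, j}})" by (auto intro: edge_vecsI)
qed

text \<open>The coordinates 2 at \<open>i\<close> and -2 at \<open>j\<close> force both summands to
  have the extreme values 1 and -1 there.\<close>

lemma edge_vec_sum_twice:
  assumes "simple_graph UNIV E" "c \<in> insert 0 (edge_vecs E)" "d \<in> insert 0 (edge_vecs E)"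
    "c + d = edge_vec i j + edge_vec i j" "i \<noteq> j"
  shows "c = edge_vec i j \<and> d = edge_vec i j"
proof -
  have "(c + d) $ i = 2" "(c + d) $ j = - 2" unfolding assms(4) using assms(5) by (simp_all add: edge_vec_nth)
  moreover have "x = edge_vec i j \<or> x $ i < 1 \<or> x $ j > - 1" "x $ i \<le> 1" "x $ j \<ge> - 1"
    if "x \<in> insert 0 (edge_vecs E)" for x
    using that by (auto simp: edge_vecs_def edge_vec_nth split: if_splits)
  ultimately show ?thesis using assms(2,3)
    by (metis (no_types, opaque_lifting) add_mono_thms_linordered_field(3) add_mono_thms_linordered_field(4)
        less_irrefl one_add_one vector_add_component add_neg_neg minus_add_distrib add.inverse_inverse)
qed

text \<open>For comparing a representation using \<open>a\<close> with one using \<open>- a\<close>: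
  from a + d = - a + e follows e - d = 2 a, which has only one representation. So \<open>d\<close>
  is \<open>- a\<close>, and the common sum is 0.\<close>

lemma edge_vec_twice_add:
  assumes E: "simple_graph UNIV E" and "d \<in> edge_vecs E" "e \<in> edge_vecs E"
    "edge_vec i j + edge_vec i j + d = e" "i \<noteq> j"
  shows "d = - edge_vec i j"
proof -
  have "- d \<in> insert 0 (edge_vecs E)" "e \<in> insert 0 (edge_vecs E)" using assms minus_edge_vecs by auto
  moreover have "e + - d = edge_vec i j + edge_vec i j" using assms(4) by (simp add: algebra_simps)
  ultimately show ?thesis using edge_vec_sum_twice[OF E, of e "- d" i j] assms(5) by (metis add.inverse_inverse)
qed

definition lost_sums :: "'n::finite set set \<Rightarrow> 'n set \<Rightarrow> (real ^ 'n) set" where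
  "lost_sums E e = two_sums E - two_sums (E - {e})"

lemma two_sumsI: "c \<in> insert 0 (edge_vecs E) \<Longrightarrow> d \<in> insert 0 (edge_vecs E) \<Longrightarrow> c + d \<in> two_sums E"
  unfolding two_sums_def by blast

lemma edge_vecs_subset_two_sums: "insert 0 (edge_vecs E) \<subseteq> two_sums E"
  using two_sumsI[of _ E 0] by auto

text \<open>Besides \<open>a + 0\<close>, the vector of a dart is represented only by paths of
  length two between its ends, that is, by the triangles on its edge.\<close>

lemma edge_vec_lost_iff:
  assumes E: "simple_graph UNIV E" and ij: "{i, j} \<in> E"
  shows "edge_vec i j \<in> lost_sums E {i, j} \<longleftrightarrow> {i, j} \<notin> triangle_edges E"
proof -
  have neq: "i \<noteq> j" using simple_graphD(3)[OF E ij] .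
  have "edge_vec i j \<in> two_sums E" using edge_vecs_subset_two_sums edge_vecsI[OF ij] by blast
  moreover have "edge_vec i j \<in> two_sums (E - {{i, j}}) \<longleftrightarrow> {i, j} \<in> triangle_edges E"
  proof
    assume "edge_vec i j \<in> two_sums (E - {{i, j}})"
    then obtain c d where cd: "edge_vec i j = c + d" "c \<in> insert 0 (edge_vecs E - {edge_vec i j, edge_vec j i})"
      "d \<in> insert 0 (edge_vecs E - {edge_vec i j, edge_vec j i})"
      unfolding two_sums_def edge_vecs_delete[OF E neq] by blast
    then have "c \<in> edge_vecs E" "d \<in> edge_vecs E" using edge_vec_nonzero[OF neq] by auto
    then obtain p q r s where pq: "c = edge_vec p q" "{p, q} \<in> E" "p \<noteq> q" "d = edge_vec r s" "{r, s} \<in> E" "r \<noteq> s"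
      by (metis edge_vecsE E)
    then have "p = i \<and> q = r \<and> s = j \<or> r = i \<and> s = p \<and> q = j"
      using edge_vec_sum_path[of p q r s i j] cd(1) neq by simp
    then obtain k where "{i, k} \<in> E" "{k, j} \<in> E" using pq by blast
    then have ki: "distinct [i, j, k]" "{j, k} \<in> E" "{k, i} \<in> E"
      using neq simple_graphD(3)[OF E, of i k] simple_graphD(3)[OF E, of k j] by (auto simp: insert_commute)
    then show "{i, j} \<in> triangle_edges E"
      using ij neq ki unfolding triangle_edges_def by blast
  next
    assume "{i, j} \<in> triangle_edges E"
    then obtain u v w where t: "distinct [u, v, w]" "{i, j} = {u, v}" "{v, w} \<in> E" "{w, u} \<in> E"
      unfolding triangle_edges_def by blast
    then have w: "w \<noteq> i" "w \<noteq> j" "{i, w} \<in> E" "{w, j} \<in> E"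
      by (auto simp: doubleton_eq_iff insert_commute)
    have "edge_vec i w \<in> edge_vecs (E - {{i, j}})" "edge_vec w j \<in> edge_vecs (E - {{i, j}})"
      using w by (auto intro!: edge_vecsI simp: doubleton_eq_iff)
    then have "edge_vec i w + edge_vec w j \<in> two_sums (E - {{i, j}})" by (intro two_sumsI) auto
    then show "edge_vec i j \<in> two_sums (E - {{i, j}})" by (simp add: edge_vec_add)
  qed
  ultimately show ?thesis by (simp add: lost_sums_def)
qed

lemma twice_edge_vec_lost:
  assumes E: "simple_graph UNIV E" and ij: "{i, j} \<in> E"
  shows "edge_vec i j + edge_vec i j \<in> lost_sums E {i, j}"
proof -
  have neq: "i \<noteq> j" using simple_graphD(3)[OF E ij] .
  have "edge_vec i j + edge_vec i j \<in> two_sums E" using edge_vecsI[OF ij] by (intro two_sumsI) auto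
  moreover have "edge_vec i j + edge_vec i j \<notin> two_sums (E - {{i, j}})"
  proof
    assume "edge_vec i j + edge_vec i j \<in> two_sums (E - {{i, j}})"
    then obtain c d where cd: "edge_vec i j + edge_vec i j = c + d" "c \<in> insert 0 (edge_vecs E - {edge_vec i j, edge_vec j i})"
      "d \<in> insert 0 (edge_vecs E - {edge_vec i j, edge_vec j i})"
      unfolding two_sums_def edge_vecs_delete[OF E neq] by blast
    then have "c = edge_vec i j" using edge_vec_sum_twice[OF E, of c d i j] neq by auto
    then show False using cd(2) edge_vec_nonzero[OF neq] by auto
  qed
  ultimately show ?thesis by (simp add: lost_sums_def)
qed

lemma unique_sum_lost_iff:
  assumes E: "simple_graph UNIV E" and ij: "{i, j} \<in> E" and u: "unique_pair E c d"
  shows "c + d \<in> lost_sums E {i, j} \<longleftrightarrow> {c, d} \<inter> {edge_vec i j, edge_vec j i} \<noteq> {}"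
proof -
  have neq: "i \<noteq> j" using simple_graphD(3)[OF E ij] .
  have cd: "c \<in> edge_vecs E" "d \<in> edge_vecs E" "c + d \<notin> insert 0 (edge_vecs E)"
    using u unfolding unique_pair_def by blast+
  have "c + d \<in> two_sums E" using cd by (intro two_sumsI) auto
  moreover have "c + d \<in> two_sums (E - {{i, j}}) \<longleftrightarrow> {c, d} \<inter> {edge_vec i j, edge_vec j i} = {}"
  proof
    assume "c + d \<in> two_sums (E - {{i, j}})"
    then obtain c' d' where cd': "c + d = c' + d'" "c' \<in> insert 0 (edge_vecs E - {edge_vec i j, edge_vec j i})"
      "d' \<in> insert 0 (edge_vecs E - {edge_vec i j, edge_vec j i})"
      unfolding two_sums_def edge_vecs_delete[OF E neq] by blast
    then have ne: "c' \<noteq> 0" "d' \<noteq> 0" using cd(3) by auto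
    then have "{c', d'} = {c, d}" using cd' by (intro unique_pairD[OF u]) auto
    then show "{c, d} \<inter> {edge_vec i j, edge_vec j i} = {}" using cd' ne by (auto simp: doubleton_eq_iff)
  next
    assume "{c, d} \<inter> {edge_vec i j, edge_vec j i} = {}"
    then show "c + d \<in> two_sums (E - {{i, j}})"
      using cd by (intro two_sumsI) (auto simp: edge_vecs_delete[OF E neq])
  qed
  ultimately show ?thesis by (simp add: lost_sums_def)
qed

text \<open>If \<open>c + d = c' + d'\<close> are different representations of a lattice point that is neither zero nor
  a vertex, then they use disjoint sets of edges, so no single deletion destroys both.\<close>

lemma lost_sums_eq:
  assumes E: "simple_graph UNIV E" and ij: "{i, j} \<in> E"
  defines "a \<equiv> edge_vec i j"
  shows "lost_sums E {i, j} = (if {i, j} \<in> triangle_edges E then {} else {a, - a}) \<union> {a + a, - a + - a} \<union>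
    {x\<in>unique_sums E. x \<in> lost_sums E {i, j}}"
proof -
  have neq: "i \<noteq> j" using simple_graphD(3)[OF E ij] .
  have ji: "{j, i} \<in> E" "{j, i} = {i, j}" using ij by (auto simp: insert_commute)
  have aE: "a \<in> edge_vecs E" using edge_vecsI[OF ij] by (simp add: a_def)
  have a: "a \<in> edge_vecs E" "- a \<in> edge_vecs E" "- a = edge_vec j i"
    using aE minus_edge_vecs[OF aE] minus_edge_vec[of i j] by (simp_all add: a_def)
  have a0: "a \<noteq> 0" using edge_vec_nonzero[OF neq] by (simp add: a_def)
  have del: "edge_vecs (E - {{i, j}}) = edge_vecs E - {a, - a}"
    using edge_vecs_delete[OF E neq] a by (simp add: a_def)
  have tri: "a \<in> lost_sums E {i, j} \<longleftrightarrow> {i, j} \<notin> triangle_edges E"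
    "- a \<in> lost_sums E {i, j} \<longleftrightarrow> {i, j} \<notin> triangle_edges E"
    using edge_vec_lost_iff[OF E ij] edge_vec_lost_iff[OF E ji(1)] ji(2) a(3) by (simp_all add: a_def)
  have tw: "a + a \<in> lost_sums E {i, j}" "- a + - a \<in> lost_sums E {i, j}"
    using twice_edge_vec_lost[OF E ij] twice_edge_vec_lost[OF E ji(1)] ji(2) a(3) by (simp_all add: a_def)
  have twice: "s + s + d = e \<Longrightarrow> d = - s" if "d \<in> edge_vecs E" "e \<in> edge_vecs E" "s = a \<or> s = - a" for s d e
    using edge_vec_twice_add[OF E that(1,2), of i j] edge_vec_twice_add[OF E that(1,2), of j i] neq that(3) a(3)
    by (auto simp: a_def)
  have "x \<in> {a, - a} \<union> {a + a, - a + - a} \<union> unique_sums E" if x: "x \<in> lost_sums E {i, j}" for x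
  proof (rule ccontr)
    assume not: "x \<notin> {a, - a} \<union> {a + a, - a + - a} \<union> unique_sums E"
    have notin: "x \<notin> two_sums (E - {{i, j}})" using x by (simp add: lost_sums_def)
    then have rep: "\<not> (x = c + d \<and> c \<in> insert 0 (edge_vecs E) \<and> d \<in> insert 0 (edge_vecs E) \<and> c \<notin> {a, - a} \<and> d \<notin> {a, - a})" for c d
      using two_sumsI[of c "E - {{i, j}}" d] unfolding del by blast
    obtain c d where cd: "x = c + d" "c \<in> insert 0 (edge_vecs E)" "d \<in> insert 0 (edge_vecs E)"
      using x unfolding lost_sums_def two_sums_def by blast
    have x0: "x \<notin> insert 0 (edge_vecs E)"
      using rep[of x 0] not a0 by auto
    then have cd': "c \<in> edge_vecs E" "d \<in> edge_vecs E" using cd by auto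
    have "c \<noteq> d" using rep[of c c] cd not by auto
    then obtain c' d' where c'd': "c' \<in> edge_vecs E" "d' \<in> edge_vecs E" "c' + d' = c + d" "{c', d'} \<noteq> {c, d}"
      using cd cd' x0 not unfolding unique_sums_def unique_pair_def by blast
    \<comment> \<open>Two different representations with first summands \<open>a\<close> or
      \<open>- a\<close> cannot agree there, so these summands are opposite; by \<open>twice\<close>
      the point would be 0.\<close>
    have main: False if h: "c \<in> edge_vecs E" "d \<in> edge_vecs E" "x = c + d" "c = a \<or> c = - a"
      "c' \<in> edge_vecs E" "d' \<in> edge_vecs E" "c' + d' = c + d" "{c', d'} \<noteq> {c, d}" "c' = a \<or> c' = - a" for c d c' d'
    proof -
      have "c' \<noteq> c" using h(7,8) by auto
      then have "c' = - c" using h(4,9) by auto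
      then have "c + c + d = d'" using h(7) by (simp add: algebra_simps)
      then have "d = - c" using twice[of d d' c] h by auto
      then show False using x0 h(3) by simp
    qed
    have one: "c \<in> {a, - a} \<or> d \<in> {a, - a}" using rep[of c d] cd by blast
    have two: "c' \<in> {a, - a} \<or> d' \<in> {a, - a}" using rep[of c' d'] cd c'd' by auto
    show False
      using one two main[of c d c' d'] main[of c d d' c'] main[of d c c' d'] main[of d c d' c'] cd cd' c'd'
      by (auto simp: add.commute insert_commute)
  qed
  then show ?thesis using tri tw by auto
qed

lemma triangle_edges_subset: "triangle_edges E \<subseteq> E"
  unfolding triangle_edges_def by blast

lemma finite_two_sums:
  assumes "simple_graph UNIV E"
  shows "finite (two_sums E)"
proof -
  define X where "X = insert 0 (edge_vecs E)"
  have "two_sums E = (\<lambda>(a, b). a + b) ` (X \<times> X)"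
    unfolding two_sums_def X_def[symmetric] by auto
  moreover have "finite X" using finite_edge_vecs[OF assms] by (simp add: X_def)
  ultimately show ?thesis by simp
qed

lemma unique_sums_subset: "unique_sums E \<subseteq> two_sums E"
  unfolding unique_sums_def unique_pair_def using two_sumsI by blast

lemma two_sums_delete_subset: "two_sums (E - {e}) \<subseteq> two_sums E"
proof -
  have "edge_vecs (E - {e}) \<subseteq> edge_vecs E" by (auto simp: edge_vecs_def)
  then show ?thesis unfolding two_sums_def by blast
qed

lemma card_lost_sums:
  assumes E: "simple_graph UNIV E" and e: "e \<in> E"
  shows "card (lost_sums E e) = (if e \<in> triangle_edges E then 0 else 2) + 2 + card {x\<in>unique_sums E. x \<in> lost_sums E e}"
proof -
  obtain i j where ij: "e = {i, j}" "i \<noteq> j" by (rule simple_graph_edgeE[OF E e])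
  define a where "a = edge_vec i j"
  have aE: "a \<in> edge_vecs E" "- a \<in> edge_vecs E"
    using edge_vecsI[of i j E] e ij minus_edge_vecs[of a E] by (simp_all add: a_def)
  have a0: "a \<noteq> 0" using edge_vec_nonzero[OF ij(2)] by (simp add: a_def)
  have neg: "a \<noteq> - a" using a0 by (rule neq_minus)
  have "a + a \<noteq> 0" using a0 by (simp flip: scaleR_2)
  then have neg2: "a + a \<noteq> - a + - a" using neq_minus[of "a + a"] by simp
  have tw: "c = a \<and> d = a" if "c \<in> insert 0 (edge_vecs E)" "d \<in> insert 0 (edge_vecs E)" "c + d = a + a" for c d
    using edge_vec_sum_twice[OF E that(1,2), of i j] that(3) ij(2) by (simp add: a_def)
  have tw': "c = - a \<and> d = - a" if "c \<in> insert 0 (edge_vecs E)" "d \<in> insert 0 (edge_vecs E)" "c + d = - a + - a" for c d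
    using edge_vec_sum_twice[OF E that(1,2), of j i] that(3) ij(2) by (simp add: a_def minus_edge_vec)
  define T where "T = (if e \<in> triangle_edges E then {} else {a, - a})"
  define D where "D = {a + a, - a + - a}"
  define U where "U = {x\<in>unique_sums E. x \<in> lost_sums E e}"
  have "a + a \<notin> edge_vecs E" "- a + - a \<notin> edge_vecs E"
    using tw[of "a + a" 0] tw'[of "- a + - a" 0] a0 by auto
  then have "D \<inter> edge_vecs E = {}" by (simp add: D_def)
  moreover have "T \<subseteq> edge_vecs E" using aE by (simp add: T_def)
  ultimately have "T \<inter> D = {}" by blast
  have U1: "x \<notin> edge_vecs E" if "x \<in> U" for x
    using that unfolding U_def unique_sums_def unique_pair_def by blast
  have "a + a \<notin> unique_sums E" "- a + - a \<notin> unique_sums E"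
    using tw tw' unfolding unique_sums_def unique_pair_def by (auto, metis+)
  then have "(T \<union> D) \<inter> U = {}" using U1 aE by (auto simp: T_def D_def U_def)
  have "finite (unique_sums E)"
    using finite_two_sums[OF E] unique_sums_subset finite_subset by blast
  then have "finite U" by (simp add: U_def)
  have ijE: "{i, j} \<in> E" using e ij(1) by simp
  have "lost_sums E e = T \<union> D \<union> U"
    unfolding T_def D_def U_def a_def ij(1) by (rule lost_sums_eq[OF E ijE])
  also have "card \<dots> = card T + card D + card U"
  proof -
    have fin: "finite T" "finite D" by (simp_all add: T_def D_def)
    then have "card (T \<union> D \<union> U) = card (T \<union> D) + card U"
      by (intro card_Un_disjoint \<open>finite U\<close> \<open>(T \<union> D) \<inter> U = {}\<close>) simp
    also have "card (T \<union> D) = card T + card D"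
      by (intro card_Un_disjoint fin \<open>T \<inter> D = {}\<close>)
    finally show ?thesis .
  qed
  also have "card D = 2" using neg2 by (simp add: D_def)
  also have "card T = (if e \<in> triangle_edges E then 0 else 2)" using neg by (simp add: T_def)
  finally show ?thesis by (simp add: U_def)
qed

text \<open>The two summands of a unique sum are neither equal nor opposite, so they belong to two
  different edges, and deleting either one destroys the point.\<close>

lemma sum_card_unique_lost:
  assumes E: "simple_graph UNIV E"
  shows "(\<Sum>e\<in>E. card {x\<in>unique_sums E. x \<in> lost_sums E e}) = 2 * card (unique_sums E)"
proof -
  have "finite (unique_sums E)"
    using finite_two_sums[OF E] unique_sums_subset finite_subset by blast
  moreover have "card {e\<in>E. x \<in> lost_sums E e} = 2" if x: "x \<in> unique_sums E" for x
  proof -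
    obtain c d where cd: "unique_pair E c d" "x = c + d" using x unfolding unique_sums_def by blast
    have cd': "c \<in> edge_vecs E" "d \<in> edge_vecs E" "c \<noteq> d" "c + d \<noteq> 0"
      using cd(1) unfolding unique_pair_def by blast+
    obtain p q where p: "c = edge_vec p q" "{p, q} \<in> E" "p \<noteq> q" by (rule edge_vecsE[OF cd'(1) E])
    obtain r s where r: "d = edge_vec r s" "{r, s} \<in> E" "r \<noteq> s" by (rule edge_vecsE[OF cd'(2) E])
    have "{p, q} \<noteq> {r, s}" using cd'(3,4) p(1) r(1) by (auto simp: doubleton_eq_iff edge_vec_def)
    moreover have "{e\<in>E. x \<in> lost_sums E e} = {{p, q}, {r, s}}"
    proof -
      have "x \<in> lost_sums E {i, j} \<longleftrightarrow> {i, j} = {p, q} \<or> {i, j} = {r, s}" if ij: "{i, j} \<in> E" for i j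
      proof -
        have "i \<noteq> j" using simple_graphD(3)[OF E ij] .
        then show ?thesis
          unfolding cd(2) unique_sum_lost_iff[OF E ij cd(1)] unfolding p(1) r(1)
          using p(3) r(3) by (auto simp: edge_vec_eq_iff doubleton_eq_iff)
      qed
      then have "x \<in> lost_sums E e \<longleftrightarrow> e = {p, q} \<or> e = {r, s}" if "e \<in> E" for e
        using that simple_graph_edgeE[OF E that] by metis
      then show ?thesis using p(2) r(2) by blast
    qed
    ultimately show ?thesis by simp
  qed
  ultimately show ?thesis
    using sum_multicount_gen[of E "unique_sums E" "\<lambda>e x. x \<in> lost_sums E e" "\<lambda>_. 2"] simple_graphD(2)[OF E]
    by simp
qed

lemma sum_card_lost_sums:
  assumes E: "simple_graph UNIV E"
  shows "(\<Sum>e\<in>E. int (card (two_sums E)) - int (card (two_sums (E - {e})))) =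
    4 * int (card E) - 2 * int (card (triangle_edges E)) + 2 * int (card (unique_sums E))"
proof -
  have fin: "finite E" by (rule simple_graphD(2)[OF E])
  have "(\<Sum>e\<in>E. int (card (two_sums E)) - int (card (two_sums (E - {e})))) = (\<Sum>e\<in>E. int (card (lost_sums E e)))"
  proof (intro sum.cong refl)
    fix e
    have "card (lost_sums E e) = card (two_sums E) - card (two_sums (E - {e}))"
      unfolding lost_sums_def using two_sums_delete_subset finite_two_sums[OF E] finite_subset
      by (intro card_Diff_subset) blast+
    moreover have "card (two_sums (E - {e})) \<le> card (two_sums E)"
      by (intro card_mono finite_two_sums E two_sums_delete_subset)
    ultimately show "int (card (two_sums E)) - int (card (two_sums (E - {e}))) = int (card (lost_sums E e))"
      by simp
  qed
  also have "\<dots> = (\<Sum>e\<in>E. (if e \<in> triangle_edges E then 0 else 2) + 2 + int (card {x\<in>unique_sums E. x \<in> lost_sums E e}))"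
    using card_lost_sums[OF E] by (intro sum.cong) auto
  also have "\<dots> = (\<Sum>e\<in>E. if e \<in> triangle_edges E then 0 else 2) + 2 * int (card E) + int (\<Sum>e\<in>E. card {x\<in>unique_sums E. x \<in> lost_sums E e})"
    by (simp add: sum.distrib)
  also have "(\<Sum>e\<in>E. if e \<in> triangle_edges E then 0 else 2) = 2 * int (card (E - triangle_edges E))"
  proof -
    have "(\<Sum>e\<in>E. if e \<in> triangle_edges E then 0 else 2) = (\<Sum>e\<in>E - triangle_edges E. 2 :: int)"
      using fin by (intro sum.mono_neutral_cong_right) auto
    then show ?thesis by simp
  qed
  also have "int (card (E - triangle_edges E)) = int (card E) - int (card (triangle_edges E))"
    using fin triangle_edges_subset[of E] finite_subset[OF triangle_edges_subset fin]
    by (simp add: card_Diff_subset of_nat_diff card_mono)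
  finally show ?thesis unfolding sum_card_unique_lost[OF E] by simp
qed

section \<open>A lower bound for the number of edges of the polytope\<close>

text \<open>If all four ends are distinct, the only competing representation swaps the heads, which
  the last clause excludes.\<close>

definition compatible_darts :: "'a set set \<Rightarrow> 'a \<Rightarrow> 'a \<Rightarrow> ('a \<times> 'a) set" where
  "compatible_darts E i j = {(k, l)\<in>darts E. k = i \<and> l \<noteq> j \<or> l = j \<and> k \<noteq> i \<or>
     distinct [i, j, k, l] \<and> \<not> ({i, l} \<in> E \<and> {k, j} \<in> E)}"

text \<open>A common tail gives deg i - 1 darts, a common head deg j - 1, and 2 (|E| + 1 - deg i -
  deg j) darts avoid both ends, of which those in four-cycles are discarded. The sum is 2 |E| - deg
  i - deg j minus the number of four-cycles.\<close>

lemma card_compatible_darts: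
  assumes E: "simple_graph V E" and ij: "{i, j} \<in> E"
  shows "2 * card E \<le> card (compatible_darts E i j) + card (nbrs E i) + card (nbrs E j) + card (four_cycles E i j)"
proof -
  define F where "F = {e\<in>E. i \<notin> e \<and> j \<notin> e}"
  have F: "simple_graph V F" using simple_graph_subset[OF E] by (auto simp: F_def)
  have no_loop: "{x} \<notin> E" for x using simple_graphD(3)[OF E, of x x] by auto
  have neq: "i \<noteq> j" using simple_graphD(3)[OF E ij] .
  define A where "A = (\<lambda>l. (i, l)) ` (nbrs E i - {j})"
  define B where "B = (\<lambda>k. (k, j)) ` (nbrs E j - {i})"
  define C where "C = darts F - four_cycles E i j"
  have sub: "four_cycles E i j \<subseteq> darts F" unfolding four_cycles_eq[OF E] F_def by auto
  have fin: "finite (darts F)" "finite (darts E)" "finite (nbrs E i)" "finite (nbrs E j)"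
    using finite_darts[OF F] finite_darts[OF E] finite_nbrs[OF E] by auto
  have cA: "card A = card (nbrs E i) - 1"
    unfolding A_def using ij by (subst card_image) (auto simp: inj_on_def card_Diff_singleton)
  have cB: "card B = card (nbrs E j) - 1"
    unfolding B_def using ij by (subst card_image) (auto simp: inj_on_def card_Diff_singleton insert_commute)
  have cC: "card C + card (four_cycles E i j) = 2 * card F"
    using card_Diff_subset[OF finite_subset[OF sub fin(1)] sub] card_mono[OF fin(1) sub] card_darts[OF F]
    by (simp add: C_def)
  have pos: "card (nbrs E i) > 0" "card (nbrs E j) > 0"
    using fin(3,4) ij mem_nbrs[of j E i] mem_nbrs[of i E j] unfolding card_gt_0_iff insert_commute[of j i]
    by blast+
  have "A \<subseteq> compatible_darts E i j" by (auto simp: A_def compatible_darts_def)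
  moreover have "B \<subseteq> compatible_darts E i j" by (auto simp: B_def compatible_darts_def insert_commute)
  moreover have "C \<subseteq> compatible_darts E i j"
    using no_loop neq unfolding C_def four_cycles_eq[OF E]
    by (auto simp: F_def compatible_darts_def darts_def)
  moreover have "finite (compatible_darts E i j)"
    using fin(2) by (rule finite_subset[rotated]) (auto simp: compatible_darts_def)
  ultimately have "card (A \<union> B \<union> C) \<le> card (compatible_darts E i j)" by (intro card_mono) auto
  moreover have "A \<inter> B = {}" by (auto simp: A_def B_def)
  moreover have "(A \<union> B) \<inter> C = {}" by (auto simp: A_def B_def C_def F_def darts_def)
  moreover have "finite A" "finite B" "finite C" using fin by (simp_all add: A_def B_def C_def)
  ultimately have "card A + card B + card C \<le> card (compatible_darts E i j)"
    by (simp add: card_Un_disjoint)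
  then show ?thesis using cA cB cC pos card_edges_avoiding[OF E ij] unfolding F_def[symmetric] by linarith
qed

lemma compatible_darts_unique:
  assumes E: "simple_graph UNIV E" and ij: "{i, j} \<in> E" and kl: "(k, l) \<in> compatible_darts E i j"
  shows "unique_pair E (edge_vec i j) (edge_vec k l)"
proof -
  have star: "unique_pair E (edge_vec i j) (edge_vec i l)" if "{i, j} \<in> E" "{i, l} \<in> E" "j \<noteq> l" for i j l
    unfolding unique_pair_def
  proof (intro conjI ballI impI)
    have neq: "i \<noteq> j" "i \<noteq> l" using that simple_graphD(3)[OF E] by blast+
    show "edge_vec i j \<in> edge_vecs E" "edge_vec i l \<in> edge_vecs E" "edge_vec i j \<noteq> edge_vec i l"
      using that neq by (auto simp: edge_vecsI edge_vec_eq_iff)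
    have "(edge_vec i j + edge_vec i l) $ i = 2" using neq by (simp add: edge_vec_nth)
    moreover have "x $ i \<noteq> 2" if "x \<in> insert 0 (edge_vecs E)" for x
      using that by (auto simp: edge_vecs_def edge_vec_nth split: if_splits)
    ultimately show "edge_vec i j + edge_vec i l \<notin> insert 0 (edge_vecs E)" by metis
    fix c d assume cd: "c \<in> edge_vecs E" "d \<in> edge_vecs E" "c + d = edge_vec i j + edge_vec i l"
    obtain p q where p: "c = edge_vec p q" "p \<noteq> q" by (rule edge_vecsE[OF cd(1) E])
    obtain r s where r: "d = edge_vec r s" "r \<noteq> s" by (rule edge_vecsE[OF cd(2) E])
    show "{c, d} = {edge_vec i j, edge_vec i l}"
      using edge_vec_sum_double[of p q r s i j l] cd(3) p r neq by auto
  qed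
  have kl': "{k, l} \<in> E" using kl by (simp add: compatible_darts_def)
  have neq: "i \<noteq> j" "k \<noteq> l" using simple_graphD(3)[OF E ij] simple_graphD(3)[OF E kl'] .
  consider "k = i" "l \<noteq> j" | "l = j" "k \<noteq> i" | "distinct [i, j, k, l]" "\<not> ({i, l} \<in> E \<and> {k, j} \<in> E)"
    using kl by (auto simp: compatible_darts_def)
  then show ?thesis
  proof cases
    case 1
    then show ?thesis using star[of i j l] ij kl' by simp
  next
    case 2
    \<comment> \<open>Negation turns a common head into a common tail.\<close>
    have "unique_pair E (edge_vec j i) (edge_vec j k)"
      using 2 ij kl' by (intro star) (auto simp: insert_commute)
    then have "unique_pair E (- edge_vec j i) (- edge_vec j k)" by (rule unique_pair_minus)
    then show ?thesis using 2 by (simp add: minus_edge_vec)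
  next
    case 3
    show ?thesis unfolding unique_pair_def
    proof (intro conjI ballI impI)
      show "edge_vec i j \<in> edge_vecs E" "edge_vec k l \<in> edge_vecs E" "edge_vec i j \<noteq> edge_vec k l"
        using ij kl' neq 3(1) by (auto simp: edge_vecsI edge_vec_eq_iff)
      have "(edge_vec i j + edge_vec k l) $ i > 0" "(edge_vec i j + edge_vec k l) $ k > 0"
        using 3(1) by (auto simp: edge_vec_nth)
      moreover have "\<not> (x $ i > 0 \<and> x $ k > 0)" if "x \<in> insert 0 (edge_vecs E)" for x
        using that 3(1) by (auto simp: edge_vecs_def edge_vec_nth split: if_splits)
      ultimately show "edge_vec i j + edge_vec k l \<notin> insert 0 (edge_vecs E)" by metis
      fix c d assume cd: "c \<in> edge_vecs E" "d \<in> edge_vecs E" "c + d = edge_vec i j + edge_vec k l"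
      obtain p q where p: "c = edge_vec p q" "{p, q} \<in> E" by (rule edge_vecsE[OF cd(1) E])
      obtain r s where r: "d = edge_vec r s" "{r, s} \<in> E" by (rule edge_vecsE[OF cd(2) E])
      have "(p = i \<and> r = k \<or> p = k \<and> r = i) \<and> (q = j \<and> s = l \<or> q = l \<and> s = j)"
        using edge_vec_sum_disjoint[of p q r s i j k l] cd(3) p r 3(1) by simp
      then show "{c, d} = {edge_vec i j, edge_vec k l}" using p r 3(2) by auto
    qed
  qed
qed

text \<open>A dart together with a compatible dart is an ordered pair of vectors with a unique sum;
  the factor 2 accounts for the two orders.\<close>

lemma card_unique_sums_ge:
  fixes E :: "'n::finite set set"
  assumes E: "simple_graph UNIV E"
  shows "(\<Sum>(i, j)\<in>darts E. card (compatible_darts E i j)) \<le> 2 * card (unique_sums E)"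
proof -
  define Q where "Q = {(a, b). unique_pair E a b}"
  have "Q \<subseteq> edge_vecs E \<times> edge_vecs E" unfolding Q_def unique_pair_def by blast
  then have finQ: "finite Q" using finite_edge_vecs[OF E] finite_subset by blast
  have sums: "unique_sums E = (\<lambda>(a, b). a + b) ` Q" by (auto simp: unique_sums_def Q_def)
  have "card Q = (\<Sum>x\<in>unique_sums E. card {p\<in>Q. (\<lambda>(a, b). a + b) p = x})"
    using finQ unfolding sums by (intro card_fibers) auto
  also have "\<dots> = (\<Sum>x\<in>unique_sums E. 2)"
  proof (intro sum.cong refl)
    fix x assume "x \<in> unique_sums E"
    then obtain a b where ab: "unique_pair E a b" "x = a + b" unfolding unique_sums_def by blast
    let ?T = "{p\<in>Q. (\<lambda>(a, b). a + b) p = x}"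
    have "?T = {(a, b), (b, a)}"
      using ab unique_pair_sym[OF ab(1)] unique_pair_inject[OF _ ab(1)]
      by (auto simp: Q_def doubleton_eq_iff add.commute)
    moreover have "a \<noteq> b" using ab(1) unfolding unique_pair_def by blast
    ultimately show "card ?T = 2" by simp
  qed
  finally have cQ: "card Q = 2 * card (unique_sums E)" by simp
  define S where "S = Sigma (darts E) (\<lambda>(i, j). compatible_darts E i j)"
  have comp: "compatible_darts E i j \<subseteq> darts E" for i j by (auto simp: compatible_darts_def)
  have finC: "finite (compatible_darts E i j)" for i j
    using finite_darts[OF E] comp finite_subset by blast
  let ?f = "\<lambda>((i, j), (k, l)). (edge_vec i j, edge_vec k l)"
  have "card S = (\<Sum>(i, j)\<in>darts E. card (compatible_darts E i j))"
    unfolding S_def using finite_darts[OF E] finC by (subst card_SigmaI) (auto simp: case_prod_unfold)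
  moreover have "card S \<le> card Q"
  proof (rule card_inj_on_le[OF _ _ finQ])
    show "inj_on ?f S"
    proof (rule inj_onI)
      fix x y assume xy: "x \<in> S" "y \<in> S"
        and eq: "?f x = ?f y"
      obtain i j k l where x: "x = ((i, j), (k, l))" by (metis surj_pair)
      obtain i' j' k' l' where y: "y = ((i', j'), (k', l'))" by (metis surj_pair)
      have "{i, j} \<in> E" "{i', j'} \<in> E" "{k, l} \<in> E" "{k', l'} \<in> E"
        using xy unfolding x y by (auto simp: S_def compatible_darts_def)
      then have "i \<noteq> j" "i' \<noteq> j'" "k \<noteq> l" "k' \<noteq> l'" using simple_graphD(3)[OF E] by blast+
      with eq show "x = y" by (simp add: x y edge_vec_eq_iff)
    qed
    show "?f ` S \<subseteq> Q"
      using compatible_darts_unique[OF E] by (auto simp: S_def Q_def)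
  qed
  ultimately show ?thesis using cQ by simp
qed

section \<open>Deleting an edge and the final count\<close>

text \<open>A second neighbour \<open>w\<close> of \<open>i\<close> serves as a hub: every other
  vertex is joined to \<open>w\<close> avoiding \<open>i\<close>, hence avoiding \<open>e\<close>,
  and \<open>i\<close> itself is joined to \<open>w\<close> by another edge.\<close>

lemma connected_delete_edge:
  assumes E: "simple_graph V E" and two: "two_connected V E" and e: "e \<in> E"
  shows "graph_connected V (E - {e})"
  unfolding graph_connected_def
proof (intro conjI ballI)
  obtain i j where ij: "e = {i, j}" "i \<noteq> j" "i \<in> V" "j \<in> V" by (rule simple_graph_edgeE[OF E e])
  show "V \<noteq> {}" using ij by auto
  have del: "joined (E - {e}) u v" if "c \<in> {i, j}" "u \<in> V - {c}" "v \<in> V - {c}" for c u v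
    using connected_delete[OF two, of c u v] that ij by (auto intro: joined_mono)
  have "nbrs E i - {j} \<noteq> {}" using nbrs_nonempty[OF E two ij(3,4,2)] .
  then have "\<exists>w. w \<in> nbrs E i \<and> w \<noteq> j" by blast
  then obtain w where w: "{i, w} \<in> E" "w \<noteq> j" by auto
  have wV: "w \<in> V" "w \<noteq> i" using simple_graphD(3,4)[OF E w(1)] by auto
  have iw: "joined (E - {e}) i w" using w ij by (intro joined_edge) (auto simp: doubleton_eq_iff)
  have base: "joined (E - {e}) w v" if "v \<in> V" for v
  proof (cases "v = i")
    case True
    then show ?thesis using joined_sym[OF iw] by simp
  next
    case False
    then show ?thesis using del[of i w v] that wV by auto
  qed
  fix u v assume "u \<in> V" "v \<in> V"
  then show "joined (E - {e}) u v" using joined_trans[OF joined_sym[OF base] base] by blast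
qed

lemma card_triangle_darts:
  assumes E: "simple_graph V E"
  shows "card (triangle_darts E) = 2 * card (triangle_edges E)"
proof -
  have "{i, j} \<in> triangle_edges E \<longleftrightarrow> {i, j} \<in> E \<and> nbrs E i \<inter> nbrs E j \<noteq> {}" for i j
  proof
    assume "{i, j} \<in> triangle_edges E"
    then obtain u v w where t: "{i, j} \<in> E" "{i, j} = {u, v}" "{v, w} \<in> E" "{w, u} \<in> E"
      unfolding triangle_edges_def by blast
    then have "w \<in> nbrs E i \<inter> nbrs E j" by (auto simp: doubleton_eq_iff insert_commute)
    with t show "{i, j} \<in> E \<and> nbrs E i \<inter> nbrs E j \<noteq> {}" by blast
  next
    assume ij: "{i, j} \<in> E \<and> nbrs E i \<inter> nbrs E j \<noteq> {}"
    then obtain w where w: "{i, w} \<in> E" "{j, w} \<in> E" by auto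
    then have "distinct [i, j, w]" "{w, i} \<in> E"
      using ij simple_graphD(3)[OF E, of i j] simple_graphD(3)[OF E, of i w] simple_graphD(3)[OF E, of j w]
      by (auto simp: insert_commute)
    with ij w show "{i, j} \<in> triangle_edges E" unfolding triangle_edges_def by blast
  qed
  then have "triangle_darts E = darts (triangle_edges E)"
    by (auto simp: triangle_darts_def disjoint_iff)
  then show ?thesis
    using card_darts[OF simple_graph_subset[OF E triangle_edges_subset]] by simp
qed

theorem theoremC:
  fixes E :: "'n::finite set set"
  assumes "simple_graph (UNIV :: 'n set) E"
    and "two_connected (UNIV :: 'n set) E"
  shows "coeff (Z_poly E) 2 =
      2 * (int (num_edges (sym_edge_polytope E))
           - int (card E) * (2 * int CARD('n) - 5)
           - int (card (triangle_edges E)))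
    \<and> coeff (Z_poly E) 2 \<ge> 0"
proof -
  note E = assms(1) and two = assms(2)
  define m n t f where "m = int (card E)" and "n = int CARD('n)"
    and "t = int (card (triangle_edges E))" and "f = int (card (unique_sums E))"
  have fin: "finite E" by (rule simple_graphD(2)[OF E])
  have n3: "CARD('n) \<ge> 3" and conn: "graph_connected UNIV E"
    using two by (simp_all add: two_connected_def)
  \<comment> \<open>This yields at least two edges, which excludes the degenerate polytope that is a
    single segment.\<close>
  have "CARD('n) \<le> card E + 1"
    using conn fin by (intro card_edges_ge) (auto simp: graph_connected_def)
  then have edges: "int (num_edges (sym_edge_polytope E)) = f"
    using num_edges_sym_edge_polytope[OF E] n3 by (simp add: f_def)
  \<comment> \<open>The dimension d = n - 1 is unchanged and one edge is missing, so the linear term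
    contributes twice 2 d - 1 = 2 n - 3.\<close>
  have diff: "coeff (gamma_poly (sym_edge_polytope E)) 2 - coeff (gamma_poly (sym_edge_polytope (E - {e}))) 2 =
      int (card (two_sums E)) - int (card (two_sums (E - {e}))) - 2 * (2 * n - 3)" if e: "e \<in> E" for e
  proof -
    have s: "simple_graph UNIV (E - {e})" using simple_graph_subset[OF E] by auto
    have "card E = card (E - {e}) + 1" using e fin by (metis Suc_eq_plus1 card_Suc_Diff1)
    then show ?thesis
      unfolding coeff_2_gamma_sym_edge_polytope[OF E conn n3]
        coeff_2_gamma_sym_edge_polytope[OF s connected_delete_edge[OF E two e] n3]
      by (simp add: n_def algebra_simps)
  qed
  have "coeff (Z_poly E) 2 = (\<Sum>e\<in>E. int (card (two_sums E)) - int (card (two_sums (E - {e}))) - 2 * (2 * n - 3))"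
    unfolding Z_poly_def by (simp add: coeff_sum diff)
  also have "\<dots> = (4 * m - 2 * t + 2 * f) - m * (2 * (2 * n - 3))"
    using sum_card_lost_sums[OF E]
    by (subst sum_subtractf) (simp add: m_def t_def f_def)
  also have "\<dots> = 2 * (f - m * (2 * n - 5) - t)" by (simp add: algebra_simps)
  finally have Z: "coeff (Z_poly E) 2 = 2 * (f - m * (2 * n - 5) - t)" .
  let ?q = "\<lambda>i j. int (card (nbrs E i)) + int (card (nbrs E j)) + int (card (four_cycles E i j))"
  \<comment> \<open>Summing over darts doubles all quantities: \<open>2 * f\<close> bounds the
    compatible pairs from above, and \<open>triangle_darts E\<close> has \<open>2 * t\<close>
    elements.\<close>
  have "(\<Sum>(i, j)\<in>darts E. 2 * m - ?q i j) \<le> (\<Sum>(i, j)\<in>darts E. int (card (compatible_darts E i j)))"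
  proof (intro sum_mono, clarify)
    fix i j assume "(i, j) \<in> darts E"
    then show "2 * m - ?q i j \<le> int (card (compatible_darts E i j))"
      using card_compatible_darts[OF E, of i j] by (simp add: m_def)
  qed
  also have "\<dots> = int (\<Sum>(i, j)\<in>darts E. card (compatible_darts E i j))"
    by (simp only: of_nat_sum case_prod_unfold)
  also have "\<dots> \<le> 2 * f" using card_unique_sums_ge[OF E] unfolding f_def by (metis of_nat_le_iff of_nat_mult of_nat_numeral)
  finally have "(\<Sum>(i, j)\<in>darts E. 2 * m - ?q i j) \<le> 2 * f" .
  moreover have "(\<Sum>(i, j)\<in>darts E. 2 * m - ?q i j) = 2 * m * (2 * m) - (\<Sum>(i, j)\<in>darts E. ?q i j)"
    using card_darts[OF E] by (simp add: case_prod_unfold sum_subtractf m_def)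
  moreover have "(\<Sum>(i, j)\<in>darts E. ?q i j) + 2 * t \<le> 2 * m * (2 * m - 2 * n + 5)"
    using sum_darts_bound[OF E two] card_triangle_darts[OF E] by (simp add: m_def n_def t_def)
  ultimately have "0 \<le> 2 * f - 2 * m * (2 * n - 5) - 2 * t" by (simp add: algebra_simps)
  then show ?thesis unfolding Z edges by (simp add: m_def n_def t_def algebra_simps)
qed

end
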